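(* Let $n,t,k$ be positive integers with $n,t\ge 2$ and $k\ge 3$, and assume that $n=d+kt$ for an integer $d$ with $1\le d\le t$. Let $K$ be a field and $S=K[x_1,\dots,x_n]$. Let $I\subset S$ be a $t$-spread strongly stable ideal all of whose extremal Betti numbers are equal to $1$ (that is, $I\in\mathcal{S}_{t,n,\mathbf{1}}$), of initial degree $2$, and having a corner in degree $2$ (that is, a corner of the form $(k_1,2)$ for some $k_1$). Then $I$ has at most $$k+\left\lfloor\frac{d-3}{t}\right\rfloor=\begin{cases}k-1 & \text{if } d=1,2,\\ k & \text{if } 3\le d\le t,\end{cases}$$ corners.
   Context: $S=K[x_1,\dots,x_n]$ is the standard graded polynomial ring over a field $K$ ($\deg x_i=1$). Let $t\ge 1$. A monomial $x_{i_1}x_{i_2}\cdots x_{i_d}$ with $1\le i_1\le\dots\le i_d\le n$ is called $t$-spread if $i_{j+1}-i_j\ge t$ for all $j=1,\dots,d-1$. A monomial ideal is a $t$-spread monomial ideal if it is generated by $t$-spread monomials. For a monomial $u$, $\mathrm{supp}(u)=\{i: x_i \text{ divides } u\}$. A $t$-spread monomial ideal $I$ is $t$-spread strongly stable if for all $t$-spread monomials $u\in I$, all $j\in\mathrm{supp}(u)$ and all $i<j$ such that $x_i(u/x_j)$ is $t$-spread, one has $x_i(u/x_j)\in I$. The initial degree of a nonzero graded ideal $I$ is the minimum $j$ such that the degree-$j$ component $I_j$ is nonzero. The graded Betti numbers of $I$ are $\beta_{i,i+j}(I)=\dim_K \mathrm{Tor}^S_i(I,K)_{i+j}$. A graded Betti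 number $\beta_{k,k+\ell}(I)\neq 0$ is called extremal if $\beta_{i,i+j}(I)=0$ for all $i\ge k$, $j\ge \ell$ with $(i,j)\ne(k,\ell)$; the pair $(k,\ell)$ is then called a corner of $I$ (in degree $\ell$). The corners of $I$ are listed as $(k_1,\ell_1),\dots,(k_r,\ell_r)$ with $n-1\ge k_1>k_2>\dots>k_r\ge 1$ and $1\le\ell_1<\ell_2<\dots<\ell_r$. $\mathcal{S}_{t,n,\mathbf 1}$ denotes the set of $t$-spread strongly stable ideals $I$ of $S$ such that $\beta_{k,k+\ell}(I)=1$ for every corner $(k,\ell)$ of $I$. *)

theory Defs
  imports
    "HOL-Library.Poly_Mapping"
    "HOL-Library.Function_Algebras"
    "HOL-Algebra.Ideal"
    Complex_Main
begin

section \<open>The polynomial ring\<close>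

text \<open>
  An exponent vector is a finitely supported function from variable indices to exponents, and a
  polynomial is a finitely supported function from exponent vectors to coefficients. This type has
  infinitely many variables; \<open>S = K[x_1, ..., x_n]\<close> is the subring of those polynomials in which
  only the variables with index in \<open>{1..n}\<close> occur.
\<close>

type_synonym expo = "nat \<Rightarrow>\<^sub>0 nat"
type_synonym 'k mpoly = "expo \<Rightarrow>\<^sub>0 'k"

definition polys :: "nat \<Rightarrow> 'k::field mpoly set" where
  "polys n = {f. \<forall>m \<in> Poly_Mapping.keys f. Poly_Mapping.keys m \<subseteq> {1..n}}"

definition poly_ring :: "nat \<Rightarrow> 'k::field mpoly ring" where
  "poly_ring n = \<lparr>carrier = polys n, mult = (*), one = 1, zero = 0, add = (+)\<rparr>"

definition total_deg :: "expo \<Rightarrow> nat" where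
  "total_deg m = (\<Sum>i \<in> Poly_Mapping.keys m. Poly_Mapping.lookup m i)"

text \<open>The zero polynomial is homogeneous of every degree.\<close>

definition homogeneous :: "nat \<Rightarrow> 'k::field mpoly \<Rightarrow> bool" where
  "homogeneous j f \<longleftrightarrow> (\<forall>m \<in> Poly_Mapping.keys f. total_deg m = j)"

definition monom :: "expo \<Rightarrow> 'k::field mpoly" where
  "monom u = Poly_Mapping.single u 1"

section \<open>Spread monomials and ideals\<close>

text \<open>The list \<open>[i_1, ..., i_d]\<close> encodes the monomial \<open>x_{i_1} * ... * x_{i_d}\<close>.\<close>

definition expo_of_list :: "nat list \<Rightarrow> expo" where
  "expo_of_list is = (\<Sum>i\<leftarrow>is. Poly_Mapping.single i 1)"

definition t_spread :: "nat \<Rightarrow> nat \<Rightarrow> expo \<Rightarrow> bool" where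
  "t_spread n t u \<longleftrightarrow>
     (\<exists>is. sorted is \<and> set is \<subseteq> {1..n} \<and> u = expo_of_list is \<and>
           (\<forall>j. Suc j < length is \<longrightarrow> is ! j + t \<le> is ! Suc j))"

definition t_spread_ideal :: "nat \<Rightarrow> nat \<Rightarrow> 'k::field mpoly set \<Rightarrow> bool" where
  "t_spread_ideal n t I \<longleftrightarrow>
     (\<exists>A. (\<forall>u \<in> A. t_spread n t u) \<and> I = Idl\<^bsub>poly_ring n\<^esub> (monom ` A))"

definition t_spread_strongly_stable :: "nat \<Rightarrow> nat \<Rightarrow> 'k::field mpoly set \<Rightarrow> bool" where
  "t_spread_strongly_stable n t I \<longleftrightarrow> t_spread_ideal n t I \<and>
     (\<forall>u. t_spread n t u \<and> monom u \<in> I \<longrightarrow>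
        (\<forall>j \<in> Poly_Mapping.keys u. \<forall>i \<in> {1..<j}.
           (let v = Poly_Mapping.single i 1 + (u - Poly_Mapping.single j 1)
            in t_spread n t v \<longrightarrow> monom v \<in> I)))"

text \<open>Meaningful only for nonzero graded ideals.\<close>

definition initial_degree :: "'k::field mpoly set \<Rightarrow> nat" where
  "initial_degree I = (LEAST j. \<exists>f \<in> I. f \<noteq> 0 \<and> homogeneous j f)"

section \<open>Graded free resolutions, Tor, and graded Betti numbers\<close>

text \<open>
  A complex \<open>... \<rightarrow> F_2 \<rightarrow> F_1 \<rightarrow> F_0 \<rightarrow> I\<close> of graded free \<open>S\<close>-modules of finite rank, given by matrices:
  \<open>F_i\<close> is free with basis \<open>e_p\<close> for \<open>p \<in> basis i\<close>, where \<open>e_p\<close> has degree \<open>shift i p\<close>; the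
  differential from \<open>F_i\<close> to \<open>F_{i-1}\<close> (for \<open>i \<ge> 1\<close>) sends \<open>e_p\<close> to the sum of the
  \<open>diff i p q * e_q\<close>; and the augmentation from \<open>F_0\<close> to \<open>I\<close> sends \<open>e_p\<close> to \<open>aug p\<close>.
\<close>

record (overloaded) 'k free_complex =
  basis :: "nat \<Rightarrow> nat set"
  shift :: "nat \<Rightarrow> nat \<Rightarrow> nat"
  diff :: "nat \<Rightarrow> nat \<Rightarrow> nat \<Rightarrow> 'k mpoly"
  aug :: "nat \<Rightarrow> 'k mpoly"

definition free_mod :: "nat \<Rightarrow> 'k::field free_complex \<Rightarrow> nat \<Rightarrow> (nat \<Rightarrow> 'k mpoly) set" where
  "free_mod n F i = {v. (\<forall>p. v p \<in> polys n) \<and> (\<forall>p. p \<notin> basis F i \<longrightarrow> v p = 0)}"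

definition aug_map :: "'k::field free_complex \<Rightarrow> (nat \<Rightarrow> 'k mpoly) \<Rightarrow> 'k mpoly" where
  "aug_map F v = (\<Sum>p \<in> basis F 0. v p * aug F p)"

definition diff_map ::
    "'k::field free_complex \<Rightarrow> nat \<Rightarrow> (nat \<Rightarrow> 'k mpoly) \<Rightarrow> nat \<Rightarrow> 'k mpoly" where
  "diff_map F i v =
     (\<lambda>q. if q \<in> basis F (i - 1) then \<Sum>p \<in> basis F i. v p * diff F i p q else 0)"

definition graded_free_resolution ::
    "nat \<Rightarrow> 'k::field mpoly set \<Rightarrow> 'k free_complex \<Rightarrow> bool" where
  "graded_free_resolution n I F \<longleftrightarrow>
     (\<forall>i. finite (basis F i)) \<and>
     (\<forall>p \<in> basis F 0. aug F p \<in> I \<and> homogeneous (shift F 0 p) (aug F p)) \<and>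
     (\<forall>i. \<forall>p \<in> basis F (Suc i). \<forall>q \<in> basis F i.
        diff F (Suc i) p q \<in> polys n \<and>
        (\<forall>m \<in> Poly_Mapping.keys (diff F (Suc i) p q).
           total_deg m + shift F i q = shift F (Suc i) p)) \<and>
     aug_map F ` free_mod n F 0 = I \<and>
     {v \<in> free_mod n F 0. aug_map F v = 0} = diff_map F 1 ` free_mod n F 1 \<and>
     (\<forall>i \<ge> 1. {v \<in> free_mod n F i. diff_map F i v = 0} =
              diff_map F (Suc i) ` free_mod n F (Suc i))"

text \<open>
  The complex \<open>F \<otimes> K\<close>, where \<open>K = S/(x_1, ..., x_n)\<close>: the module \<open>F_i \<otimes> K\<close> is the \<open>K\<close>-vector space
  with basis \<open>basis i\<close>, and the differential is given by the residue classes in \<open>K\<close>, that is, the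
  constant terms, of the matrix entries. Its component in internal degree \<open>j\<close> is spanned by the
  basis elements of degree \<open>j\<close>.
\<close>

definition tens :: "'k::field free_complex \<Rightarrow> nat \<Rightarrow> nat \<Rightarrow> (nat \<Rightarrow> 'k) set" where
  "tens F i j = {v. \<forall>p. v p \<noteq> 0 \<longrightarrow> p \<in> basis F i \<and> shift F i p = j}"

definition tens_map :: "'k::field free_complex \<Rightarrow> nat \<Rightarrow> (nat \<Rightarrow> 'k) \<Rightarrow> nat \<Rightarrow> 'k" where
  "tens_map F i v =
     (\<lambda>q. if q \<in> basis F (i - 1)
          then \<Sum>p \<in> basis F i. v p * Poly_Mapping.lookup (diff F i p q) 0 else 0)"

definition tens_cycles :: "'k::field free_complex \<Rightarrow> nat \<Rightarrow> nat \<Rightarrow> (nat \<Rightarrow> 'k) set" where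
  "tens_cycles F i j = {v \<in> tens F i j. i = 0 \<or> tens_map F i v = 0}"

definition tens_boundaries :: "'k::field free_complex \<Rightarrow> nat \<Rightarrow> nat \<Rightarrow> (nat \<Rightarrow> 'k) set" where
  "tens_boundaries F i j = tens_map F (Suc i) ` tens F (Suc i) j"

abbreviation vdim :: "(nat \<Rightarrow> 'k::field) set \<Rightarrow> nat" where
  "vdim \<equiv> vector_space.dim (\<lambda>c v p. c * v p)"

definition homology_dim :: "'k::field free_complex \<Rightarrow> nat \<Rightarrow> nat \<Rightarrow> nat" where
  "homology_dim F i j = vdim (tens_cycles F i j) - vdim (tens_boundaries F i j)"

text \<open>
  \<open>\<beta>_{i,m}(I)\<close> is the dimension of the degree \<open>m\<close> component of \<open>Tor_i(I, K)\<close>, computed from some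
  graded free resolution of \<open>I\<close>; the result does not depend on the choice. The second index is the
  internal degree, so \<open>\<beta>_{i,i+j}(I)\<close> is \<open>betti n I i (i + j)\<close>.
\<close>

definition betti :: "nat \<Rightarrow> 'k::field mpoly set \<Rightarrow> nat \<Rightarrow> nat \<Rightarrow> nat" where
  "betti n I i m = homology_dim (SOME F. graded_free_resolution n I F) i m"

definition corner :: "nat \<Rightarrow> 'k::field mpoly set \<Rightarrow> nat \<times> nat \<Rightarrow> bool" where
  "corner n I = (\<lambda>(k, l). betti n I k (k + l) \<noteq> 0 \<and>
     (\<forall>i \<ge> k. \<forall>j \<ge> l. (i, j) \<noteq> (k, l) \<longrightarrow> betti n I i (i + j) = 0))"

definition spread_stable_one :: "nat \<Rightarrow> nat \<Rightarrow> 'k::field mpoly set set" where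
  "spread_stable_one t n =
     {I. t_spread_strongly_stable n t I \<and>
         (\<forall>k l. corner n I (k, l) \<longrightarrow> betti n I k (k + l) = 1)}"

end

theory Submission
  imports Defs "HOL-Library.List_Lexorder" "HOL-Library.Nat_Bijection"
begin

text \<open>
  By balancing of Tor (a double complex argument), \<open>\<beta>\<^sub>i\<^sub>,\<^sub>m(I)\<close> vanishes iff the Koszul complex with
  coefficients in \<open>I\<close> is exact in homological degree \<open>i\<close> and internal degree \<open>m\<close>. Linear quotients
  show that \<open>\<beta>\<^sub>i\<^sub>,\<^sub>i\<^sub>+\<^sub>l(I) \<noteq> 0\<close> forces a minimal generator of degree \<open>l\<close> with at least \<open>i\<close> gaps, so
  every corner lives in a degree \<open>2 \<le> l \<le> k + 1\<close>, and distinct corners have distinct degrees.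

  The case \<open>d = 1\<close> is immediate: a generator of degree \<open>k + 1\<close> would be divisible by
  \<open>x\<^sub>1 x\<^bsub>1+t\<^esub> \<in> I\<close>. For \<open>d = 2\<close>, a corner \<open>(k\<^sub>1, 2)\<close> gives \<open>x\<^sub>1 x\<^sub>c \<in> I\<close> for
  \<open>1 + t \<le> c \<le> k\<^sub>1 + t + 1\<close>, so the generator of a corner in degree \<open>k + 1\<close> is
  \<open>x\<^sub>2 x\<^bsub>2+t\<^esub> \<dots> x\<^bsub>2+kt\<^esub>\<close>. A generator \<open>v\<close> of degree \<open>k\<close> then has to start with \<open>x\<^sub>1 x\<^sub>c\<close>, where
  \<open>c > k\<^sub>1 + t + 1\<close>; replacing \<open>x\<^sub>c\<close> by the variables between \<open>1 + t\<close> and \<open>c - 1\<close> yields a Koszul cycle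
  which is not a boundary and contradicts the extremality of \<open>(k\<^sub>1, 2)\<close>. Hence corners in the degrees
  \<open>k\<close> and \<open>k + 1\<close> exclude each other.
\<close>

section \<open>Exponent vectors and coefficients\<close>

text \<open>\<open>betti\<close> uses a resolution chosen by \<open>SOME\<close>, so nothing can be
  said about it until a resolution is known to exist. The Taylor complex on the supports of the
  minimal generators supplies one: its slices in a fixed multidegree are cones, hence exact. It is
  rarely minimal, so Betti numbers cannot be read off from it; the double complex compares whichever
  resolution was chosen with the Koszul complex. On the Koszul side everything is again split by
  multidegree, where polynomials disappear and simplicial chains remain. Sorting the faces by
  leading generator turns linear quotients into a sequence of cone contractions. The possible
  degrees of corners form an interval with k elements, whence the bound k. For d at most 2 one
  degree is lost because a generator of degree k + 1 has little room: its entry at position l (from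
  0) lies between 1 + l t and d + l t. The floor records this difference, being -1 for d <= 2 and 0
  otherwise.\<close>

abbreviation lookup :: "('a \<Rightarrow>\<^sub>0 'b::zero) \<Rightarrow> 'a \<Rightarrow> 'b" where
  "lookup \<equiv> Poly_Mapping.lookup"

abbreviation keys :: "('a \<Rightarrow>\<^sub>0 'b::zero) \<Rightarrow> 'a set" where
  "keys \<equiv> Poly_Mapping.keys"

abbreviation single :: "'a \<Rightarrow> 'b \<Rightarrow> 'a \<Rightarrow>\<^sub>0 'b::zero" where
  "single \<equiv> Poly_Mapping.single"

text \<open>The order \<open>\<le>\<close> that the library puts on \<open>expo\<close> is lexicographic, not divisibility.\<close>

definition edvd :: "expo \<Rightarrow> expo \<Rightarrow> bool" where
  "edvd u m \<longleftrightarrow> (\<forall>i. lookup u i \<le> lookup m i)"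

lemma edvd_diff_add: "edvd u m \<Longrightarrow> m - u + u = m"
  by (rule poly_mapping_eqI) (simp add: edvd_def lookup_add lookup_minus)

lemma edvd_add [simp]: "edvd u (m + u)" "edvd u (u + m)"
  by (simp_all add: edvd_def lookup_add)

lemma edvd_trans: "edvd u v \<Longrightarrow> edvd v w \<Longrightarrow> edvd u w"
  unfolding edvd_def using order_trans by blast

lemma lookup_single_mult:
  fixes f :: "'k::comm_ring_1 mpoly"
  shows "lookup (single u c * f) m = (if edvd u m then c * lookup f (m - u) else 0)"
proof -
  have "lookup (single u c * f) m = (\<Sum>l. c * (\<Sum>q. lookup f q when m = l + q) when u = l)"
    by (simp add: lookup_mult lookup_single when_mult)
  also have "\<dots> = c * (\<Sum>q. lookup f q when m = u + q)"
    by simp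
  \<comment> \<open>Subtraction of exponents is truncated, so the equation is solved for q only
    under the divisibility guard; a single possible index remains.\<close>
  also have "(\<Sum>q. lookup f q when m = u + q) =
      (\<Sum>q. (lookup f q when edvd u m) when m - u = q)"
  proof (rule Sum_any.cong)
    fix q
    have "m = u + q \<longleftrightarrow> edvd u m \<and> m - u = q"
      using edvd_diff_add[of u m] by (auto simp: add.commute)
    then show "(lookup f q when m = u + q) = ((lookup f q when edvd u m) when m - u = q)"
      by (auto simp: when_def)
  qed
  also have "\<dots> = (lookup f (m - u) when edvd u m)"
    by simp
  finally show ?thesis by (simp add: when_def)
qed

text \<open>The squarefree monomial with support X. A sum over an infinite set is 0, so for infinite
  X this is the monomial 1; hence the finiteness conditions below.\<close>

definition ind :: "nat set \<Rightarrow> expo" where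
  "ind X = (\<Sum>i\<in>X. single i 1)"

lemma lookup_ind: "lookup (ind X) i = of_bool (finite X \<and> i \<in> X)"
  by (cases "finite X") (auto simp: ind_def lookup_sum lookup_single when_def)

lemma keys_ind [simp]: "finite X \<Longrightarrow> keys (ind X) = X"
  by (auto simp: in_keys_iff lookup_ind)

lemma edvd_ind_Un: "finite Y \<Longrightarrow> edvd (ind X) (ind (Y \<union> X))"
  by (auto simp: edvd_def lookup_ind)

lemma edvd_ind_iff: "finite X \<Longrightarrow> edvd (ind X) m \<longleftrightarrow> X \<subseteq> keys m"
  by (auto simp: edvd_def lookup_ind in_keys_iff subset_iff Suc_le_eq)

section \<open>Simplicial boundaries and multigraded complexes\<close>

definition bsgn :: "nat \<Rightarrow> nat set \<Rightarrow> 'a::comm_ring_1" where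
  "bsgn j s = (-1) ^ card {l \<in> s. l < j}"

lemma bsgn_sq [simp]: "bsgn j s * bsgn j s = 1" "bsgn j s * (bsgn j s * x) = x"
  by (simp_all add: bsgn_def power_add[symmetric] mult.assoc[symmetric] flip: mult_2)

lemma bsgn_nonzero [simp]: "(bsgn j s :: 'a::field) \<noteq> 0"
  by (simp add: bsgn_def)

lemma bsgn_insert_less:
  assumes "finite s" "j \<notin> s" "j < l"
  shows "(bsgn l (insert j s) :: 'a::comm_ring_1) = - bsgn l s"
    and "(bsgn j (insert l s) :: 'a) = bsgn j s"
proof -
  have "{i \<in> insert j s. i < l} = insert j {i \<in> s. i < l}" using assms by auto
  then show "(bsgn l (insert j s) :: 'a) = - bsgn l s"
    using assms by (simp add: bsgn_def)
  have "{i \<in> insert l s. i < j} = {i \<in> s. i < j}" using assms by auto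
  then show "(bsgn j (insert l s) :: 'a) = bsgn j s" by (simp add: bsgn_def)
qed

text \<open>Only the larger of the two indices changes its position when the other one is inserted,
  so exactly one sign flips. This is the source of \<open>bd_bd\<close>.\<close>

lemma bsgn_swap:
  assumes "finite s" "j \<notin> s" "l \<notin> s" "j \<noteq> l"
  shows "(bsgn j s * bsgn l (insert j s) :: 'a::comm_ring_1) = - (bsgn l s * bsgn j (insert l s))"
  using assms bsgn_insert_less[of s j l, where 'a = 'a] bsgn_insert_less[of s l j, where 'a = 'a]
  by (cases j l rule: linorder_cases) (auto simp: mult.commute)

text \<open>A chain is stored as its coefficient function on faces, so the boundary at s collects
  the coefficients of the faces with one more vertex. The empty face counts: this is the augmented
  simplicial boundary.\<close>

definition bd :: "nat set \<Rightarrow> (nat set \<Rightarrow> 'a::comm_ring_1) \<Rightarrow> nat set \<Rightarrow> 'a" where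
  "bd V g s = (\<Sum>j\<in>V - s. bsgn j s * g (insert j s))"

lemma bd_diff: "bd V (g - h) s = bd V g s - bd V h s"
  by (simp add: bd_def sum_subtractf algebra_simps)

lemma bd_zero [simp]: "bd V 0 = 0"
  by (rule ext) (simp add: bd_def)

text \<open>The pairs with j < l cancel those with l < j. To show that the sum equals its own
  negative would not suffice in characteristic 2.\<close>

lemma sum_antisym:
  fixes F :: "nat \<Rightarrow> nat \<Rightarrow> 'a::comm_ring_1"
  assumes "finite W" "\<And>j l. j \<in> W \<Longrightarrow> l \<in> W \<Longrightarrow> j \<noteq> l \<Longrightarrow> F j l = - F l j"
  shows "(\<Sum>j\<in>W. \<Sum>l\<in>W - {j}. F j l) = 0"
proof -
  define A where "A = {(j, l). j \<in> W \<and> l \<in> W \<and> j < l}"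
  define B where "B = {(j, l). j \<in> W \<and> l \<in> W \<and> l < j}"
  have fin: "finite A" "finite B"
    by (rule finite_subset[of _ "W \<times> W"]; use assms in \<open>auto simp: A_def B_def\<close>)+
  have "(\<Sum>j\<in>W. \<Sum>l\<in>W - {j}. F j l) = (\<Sum>(j, l)\<in>(SIGMA j:W. W - {j}). F j l)"
    using assms by (subst sum.Sigma) auto
  also have "(SIGMA j:W. W - {j}) = A \<union> B"
    by (auto simp: A_def B_def)
  also have "(\<Sum>(j, l)\<in>A \<union> B. F j l) = (\<Sum>(j, l)\<in>A. F j l) + (\<Sum>(j, l)\<in>B. F j l)"
    using fin by (intro sum.union_disjoint) (auto simp: A_def B_def)
  also have "(\<Sum>(j, l)\<in>B. F j l) = (\<Sum>(j, l)\<in>A. F l j)"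
    by (rule sum.reindex_bij_witness[of _ prod.swap prod.swap]) (auto simp: A_def B_def)
  also have "\<dots> = - (\<Sum>(j, l)\<in>A. F j l)"
    unfolding sum_negf[symmetric] using assms(2) by (intro sum.cong) (auto simp: A_def)
  finally show ?thesis by simp
qed

lemma bd_bd:
  assumes "finite V" "finite s"
  shows "bd V (bd V g) s = 0"
proof -
  have "bd V (bd V g) s =
      (\<Sum>j\<in>V - s. \<Sum>l\<in>(V - s) - {j}. bsgn j s * (bsgn l (insert j s) * g (insert l (insert j s))))"
    unfolding bd_def sum_distrib_left
    by (intro sum.cong) auto
  also have "\<dots> = 0"
  proof (rule sum_antisym)
    fix j l assume "j \<in> V - s" "l \<in> V - s" "j \<noteq> l"
    then show "bsgn j s * (bsgn l (insert j s) * g (insert l (insert j s))) =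
      - (bsgn l s * (bsgn j (insert l s) * g (insert j (insert l s))))"
      using bsgn_swap[of s j l, where 'a = 'a] assms
      by (simp add: insert_commute mult.assoc[symmetric])
  qed (use assms in auto)
  finally show ?thesis .
qed

text \<open>The contracting homotopy of a cone with apex p, restricted to the faces in L.\<close>

definition toggle :: "nat \<Rightarrow> nat set set \<Rightarrow> (nat set \<Rightarrow> 'a::comm_ring_1) \<Rightarrow> nat set \<Rightarrow> 'a" where
  "toggle p L g s = (if p \<in> s \<and> s \<in> L then bsgn p (s - {p}) * g (s - {p}) else 0)"

text \<open>Toggled chains live on faces containing p, so on a face without p only the term j = p
  survives and returns g. For a face s containing p, the difference of g and the boundary is a
  cycle; at s - {p} all terms of its boundary except the one of s are already known to vanish, so
  that one vanishes too. \<open>key\<close> covers the neighbours outside L.\<close>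

lemma bd_toggle:
  assumes "finite V" "p \<in> V" "L \<subseteq> Pow V"
    and tog: "\<And>s. s \<subseteq> V \<Longrightarrow> insert p s \<in> L \<longleftrightarrow> s - {p} \<in> L"
    and cyc: "\<And>s. s \<subseteq> V \<Longrightarrow> bd V g s = 0"
    and key: "\<And>s j. s \<in> L \<Longrightarrow> p \<notin> s \<Longrightarrow> j \<in> V - s \<Longrightarrow> j \<noteq> p \<Longrightarrow> insert j s \<notin> L \<Longrightarrow> g (insert j s) = 0"
    and s: "s \<in> L"
  shows "bd V (toggle p L g) s = g s"
proof -
  define w where "w = toggle p L g"
  have off: "bd V w r = (if r \<in> L then g r else 0)" if "p \<notin> r" "r \<subseteq> V" for r
  proof -
    have "bd V w r = (\<Sum>j\<in>V - r. if j = p then bsgn p r * w (insert p r) else 0)"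
      unfolding bd_def using that by (intro sum.cong) (auto simp: w_def toggle_def)
    also have "\<dots> = bsgn p r * w (insert p r)"
      using assms that by simp
    also have "\<dots> = (if r \<in> L then g r else 0)"
      using that tog[of r] by (simp add: w_def toggle_def)
    finally show ?thesis .
  qed
  show ?thesis
  proof (cases "p \<in> s")
    case False
    then show ?thesis using off[of s] s assms by (auto simp: w_def)
  next
    case True
    define r where "r = s - {p}"
    have r: "r \<subseteq> V" "p \<notin> r" "insert p r = s" "finite r"
      using True s assms by (auto simp: r_def intro: finite_subset)
    then have rL: "r \<in> L" using tog[of s] s r_def True assms by (simp add: insert_absorb) blast
    define z where "z = g - bd V w"
    have "bd V z r = 0"
      using bd_diff[of V g "bd V w" r] cyc[of r] bd_bd[of V r w] r assms(1) by (simp add: z_def)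
    moreover have "bd V z r = (\<Sum>j\<in>V - r. if j = p then bsgn p r * z s else 0)"
      unfolding bd_def
    proof (intro sum.cong refl)
      fix j assume j: "j \<in> V - r"
      show "bsgn j r * z (insert j r) = (if j = p then bsgn p r * z s else 0)"
      proof (cases "j = p")
        case False
        then have "z (insert j r) = 0"
          using off[of "insert j r"] key[of r j] j r rL by (auto simp: z_def)
        then show ?thesis using False by simp
      qed (use r in simp)
    qed
    ultimately have "bsgn p r * z s = 0"
      using assms r by simp
    then have "bsgn p r * (bsgn p r * z s) = 0" by (simp only: mult_zero_right)
    then show ?thesis by (simp add: z_def w_def)
  qed
qed

lemma bd_cone:
  assumes "finite V" "p \<in> V"
    and supp: "\<And>s. g s \<noteq> 0 \<Longrightarrow> s \<subseteq> V" and cyc: "\<And>s. s \<subseteq> V \<Longrightarrow> bd V g s = 0"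
  shows "bd V (toggle p (Pow V) g) = g"
proof
  fix s
  show "bd V (toggle p (Pow V) g) s = g s"
  proof (cases "s \<subseteq> V")
    case True
    then show ?thesis using assms by (intro bd_toggle) auto
  next
    case False
    then have "g s = 0" using supp by blast
    moreover have "bd V (toggle p (Pow V) g) s = 0"
      using False by (auto simp: bd_def toggle_def intro!: sum.neutral)
    ultimately show ?thesis by simp
  qed
qed

text \<open>
  A multigraded complex whose basis element \<open>s\<close> has multidegree \<open>L s\<close>; the Koszul and the Taylor
  complex are both of this form. Its slice in multidegree \<open>a\<close> is a simplicial chain complex.
\<close>

definition wbd :: "nat set \<Rightarrow> (nat set \<Rightarrow> expo) \<Rightarrow> (nat set \<Rightarrow> 'k::comm_ring_1 mpoly) \<Rightarrow> nat set \<Rightarrow> 'k mpoly"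
  where "wbd V L f s = (\<Sum>j\<in>V - s. single (L (insert j s) - L s) (bsgn j s) * f (insert j s))"

text \<open>The slice in multidegree a: the face s contributes the coefficient of the monomial
  complementary to its own multidegree. The guard keeps truncated subtraction from letting in
  foreign coefficients.\<close>

definition cf :: "(nat set \<Rightarrow> expo) \<Rightarrow> (nat set \<Rightarrow> 'k::comm_ring_1 mpoly) \<Rightarrow> expo \<Rightarrow> nat set \<Rightarrow> 'k" where
  "cf L f a s = (if edvd (L s) a then lookup (f s) (a - L s) else 0)"

lemma cf_shift: "cf L f (m + L s) s = lookup (f s) m"
  by (simp add: cf_def)

lemma cf_eqD:
  assumes "\<And>a. cf L f a = cf L g a"
  shows "f = g"
proof
  fix s
  show "f s = g s"
  proof (rule poly_mapping_eqI)
    fix m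
    show "lookup (f s) m = lookup (g s) m"
      using cf_shift[of L f m s] cf_shift[of L g m s] assms[of "m + L s"] by simp
  qed
qed

lemma cf_zero [simp]: "cf L 0 a = 0"
  by (rule ext) (simp add: cf_def)

text \<open>The monomial entries only carry differences of multidegrees, so in a slice just the
  signs are left. By \<open>mono\<close>, if L s does not divide a, neither does the multidegree of
  a larger face.\<close>

lemma cf_wbd:
  assumes mono: "\<And>s j. edvd (L s) (L (insert j s))"
  shows "cf L (wbd V L f) a = bd V (cf L f a)"
proof
  fix s
  show "cf L (wbd V L f) a s = bd V (cf L f a) s"
  proof (cases "edvd (L s) a")
    case False
    then have "\<not> edvd (L (insert j s)) a" for j
      using mono edvd_trans by blast
    then show ?thesis using False by (simp add: cf_def bd_def)
  next
    case True
    have "lookup (single (L (insert j s) - L s) (bsgn j s) * f (insert j s)) (a - L s)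
        = bsgn j s * cf L f a (insert j s)" for j
    proof -
      have m: "lookup (L s) i \<le> lookup (L (insert j s)) i" "lookup (L s) i \<le> lookup a i" for i
        using mono[of s j] True by (auto simp: edvd_def)
      have "edvd (L (insert j s) - L s) (a - L s) \<longleftrightarrow> edvd (L (insert j s)) a"
        unfolding edvd_def lookup_minus using m by (meson diff_le_mono le_diff_iff)
      moreover have "a - L s - (L (insert j s) - L s) = a - L (insert j s)"
        by (rule poly_mapping_eqI) (use m in \<open>simp add: lookup_minus\<close>)
      ultimately show ?thesis by (simp add: lookup_single_mult cf_def)
    qed
    then show ?thesis using True by (simp add: cf_def wbd_def bd_def lookup_sum)
  qed
qed

text \<open>Preimages found slice by slice are glued into one chain of polynomials; P transports
  what is known about the faces and multidegrees that occur. Only finitely many slices are nonzero,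
  because V and the support of each polynomial are finite.\<close>

lemma lift_boundary:
  fixes f :: "nat set \<Rightarrow> 'k::comm_ring_1 mpoly"
  assumes V: "finite V" and mono: "\<And>s j. edvd (L s) (L (insert j s))"
    and supp: "\<And>s. f s \<noteq> 0 \<Longrightarrow> s \<subseteq> V"
    and ex: "\<And>a. cf L f a \<noteq> 0 \<Longrightarrow>
      \<exists>w. bd V w = cf L f a \<and> (\<forall>s. w s \<noteq> 0 \<longrightarrow> edvd (L s) a \<and> P a s)"
  shows "\<exists>h. wbd V L h = f \<and> (\<forall>s m. lookup (h s) m \<noteq> 0 \<longrightarrow> P (m + L s) s)"
proof -
  define M where "M = {a. cf L f a \<noteq> 0}"
  have "M \<subseteq> (\<Union>s\<in>Pow V. (\<lambda>m. m + L s) ` keys (f s))"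
  proof
    fix a assume "a \<in> M"
    then obtain s where s: "cf L f a s \<noteq> 0" by (auto simp: M_def fun_eq_iff)
    then have "edvd (L s) a" "lookup (f s) (a - L s) \<noteq> 0" "f s \<noteq> 0"
      by (auto simp: cf_def split: if_splits)
    then show "a \<in> (\<Union>s\<in>Pow V. (\<lambda>m. m + L s) ` keys (f s))"
      using supp[of s] edvd_diff_add[of "L s" a]
      by (intro UN_I[of s] image_eqI[of _ _ "a - L s"]) (auto simp: in_keys_iff)
  qed
  then have M: "finite M" by (rule finite_subset) (use V in auto)
  \<comment> \<open>The preimage is taken to be 0 outside M, so that the glued coefficients have
    finite support and \<open>Abs_poly_mapping\<close> is meaningful.\<close>
  have "\<exists>w. bd V w = cf L f a \<and> (\<forall>s. w s \<noteq> 0 \<longrightarrow> edvd (L s) a \<and> P a s \<and> a \<in> M)" for a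
    using ex[of a] by (cases "a \<in> M") (auto simp: M_def intro!: exI[of _ 0])
  then obtain w where w: "\<And>a. bd V (w a) = cf L f a"
    and w0: "\<And>a s. w a s \<noteq> 0 \<Longrightarrow> edvd (L s) a \<and> P a s \<and> a \<in> M"
    by metis
  define h where "h s = Abs_poly_mapping (\<lambda>m. w (m + L s) s)" for s
  have h: "lookup (h s) m = w (m + L s) s" for s m
  proof -
    have "{m. w (m + L s) s \<noteq> 0} \<subseteq> (\<lambda>a. a - L s) ` M"
    proof
      fix m assume "m \<in> {m. w (m + L s) s \<noteq> 0}"
      then have "m + L s \<in> M" using w0 by blast
      then show "m \<in> (\<lambda>a. a - L s) ` M" by (intro image_eqI[of _ _ "m + L s"]) auto
    qed
    then have "finite {m. w (m + L s) s \<noteq> 0}" using M by (meson finite_imageI finite_subset)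
    then show ?thesis by (simp add: h_def)
  qed
  have "cf L h a = w a" for a
  proof
    fix s
    show "cf L h a s = w a s"
      using w0[of a s] edvd_diff_add[of "L s" a] by (auto simp: cf_def h)
  qed
  then have "wbd V L h = f"
    by (intro cf_eqD[of L]) (simp add: cf_wbd mono w)
  moreover have "P (m + L s) s" if "lookup (h s) m \<noteq> 0" for s m
    using that w0[of "m + L s" s] by (auto simp: h)
  ultimately show ?thesis by blast
qed

section \<open>Spread lists and strongly stable families\<close>

definition spread :: "nat \<Rightarrow> nat \<Rightarrow> nat list \<Rightarrow> bool" where
  "spread n t xs \<longleftrightarrow> set xs \<subseteq> {1..n} \<and> (\<forall>j. Suc j < length xs \<longrightarrow> xs ! j + t \<le> xs ! Suc j)"

lemma spread_Nil [simp]: "spread n t []"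
  by (simp add: spread_def)

lemma spread_nth_add:
  assumes "spread n t xs" "j < length xs" "i \<le> j"
  shows "xs ! i + (j - i) * t \<le> xs ! j"
  using assms(2,3)
proof (induction j)
  case (Suc j)
  show ?case
  proof (cases "i = Suc j")
    case False
    then have "xs ! i + (j - i) * t \<le> xs ! j" using Suc by simp
    moreover have "xs ! j + t \<le> xs ! Suc j" using assms(1) Suc.prems by (simp add: spread_def)
    moreover have "(Suc j - i) * t = (j - i) * t + t" using False Suc.prems by (simp add: Suc_diff_le)
    ultimately show ?thesis by simp
  qed simp
qed simp

lemma spread_nth_less:
  assumes "spread n t xs" "t \<ge> 1" "j < length xs" "i < j"
  shows "xs ! i < xs ! j"
proof -
  have "xs ! i + (j - i) * t \<le> xs ! j" using assms by (intro spread_nth_add) auto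
  moreover have "(j - i) * t > 0" using assms by simp
  ultimately show ?thesis by linarith
qed

lemma spread_nth_range:
  assumes "spread n t xs" "j < length xs"
  shows "1 \<le> xs ! j" "xs ! j \<le> n"
  using assms nth_mem[of j xs] unfolding spread_def by (meson atLeastAtMost_iff subsetD)+

lemma spread_sorted_distinct:
  assumes "spread n t xs" "t \<ge> 1"
  shows "sorted xs" "distinct xs"
proof -
  have "sorted_wrt (<) xs"
    using spread_nth_less[OF assms] by (simp add: sorted_wrt_iff_nth_less)
  then show "sorted xs" "distinct xs" by (auto simp: strict_sorted_iff)
qed

lemma spread_set_eqD:
  assumes "spread n t xs" "spread n t ys" "t \<ge> 1" "set xs = set ys"
  shows "xs = ys"
  using assms spread_sorted_distinct by (metis sorted_distinct_set_unique)

lemma spread_take: "spread n t xs \<Longrightarrow> spread n t (take e xs)"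
  using set_take_subset[of e xs] by (auto simp: spread_def)

text \<open>Lowering an entry widens the distance to its successor, so only the predecessor has to
  be checked.\<close>

lemma spread_update:
  assumes "spread n t xs" "l < length xs" "1 \<le> s" "s \<le> xs ! l" "l = 0 \<or> xs ! (l - 1) + t \<le> s"
  shows "spread n t (xs[l := s])"
proof -
  have "s \<le> n" using assms spread_nth_range[of n t xs l] by simp
  then have "set (xs[l := s]) \<subseteq> {1..n}"
    using assms set_update_subset_insert[of xs l s] by (auto simp: spread_def)
  moreover have "xs[l := s] ! j + t \<le> xs[l := s] ! Suc j" if "Suc j < length xs" for j
  proof -
    have "xs ! j + t \<le> xs ! Suc j" using assms that by (simp add: spread_def)
    then show ?thesis using assms that by (auto simp: nth_list_update)
  qed
  ultimately show ?thesis by (simp add: spread_def)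
qed

text \<open>Removing elements from an increasing list can only push up the entry at a given
  position. This supplies the componentwise comparison that \<open>borel\<close> asks for.\<close>

lemma spread_sublist_nth_le:
  assumes "spread n t xs" "spread n t ys" "t \<ge> 1" "set ys \<subseteq> set xs"
  shows "l < length ys \<Longrightarrow> l < length xs \<and> xs ! l \<le> ys ! l"
proof (induction l)
  case 0
  then obtain f where "f < length xs" "ys ! 0 = xs ! f"
    using assms(4) by (metis in_set_conv_nth nth_mem subsetD)
  then show ?case using spread_nth_less[OF assms(1,3), of f 0] by (cases "f = 0") auto
next
  case (Suc l)
  then obtain f where f: "f < length xs" "ys ! Suc l = xs ! f"
    using assms(4) by (metis in_set_conv_nth nth_mem subsetD)
  have "xs ! l < xs ! f"
    using Suc f spread_nth_less[OF assms(2,3), of "Suc l" l] by simp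
  then have "l < f" using spread_nth_less[OF assms(1,3), of l f] Suc f
    by (metis Suc_lessD less_asym linorder_neqE_nat nat_neq_iff)
  then show ?case
    using f spread_nth_less[OF assms(1,3), of f "Suc l"] by (cases "f = Suc l") auto
qed

lemma first_difference:
  "(\<exists>zs. ys = xs @ zs) \<or> (\<exists>zs. xs = ys @ zs) \<or>
    (\<exists>as b bs c cs. xs = as @ b # bs \<and> ys = as @ c # cs \<and> b \<noteq> c)"
proof (induction xs arbitrary: ys)
  case (Cons x xs)
  show ?case
  proof (cases ys)
    case (Cons y ys')
    show ?thesis
    proof (cases "x = y")
      case True
      then show ?thesis using Cons.IH[of ys'] \<open>ys = y # ys'\<close>
        by (metis append_Cons)
    next
      case False
      then show ?thesis using \<open>ys = y # ys'\<close> by (metis append_Nil)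
    qed
  qed simp
qed simp

lemma lex_append_less [simp]: "as @ b # bs < as @ (c::nat) # cs \<longleftrightarrow> b < c \<or> b = c \<and> bs < cs"
  by (induction as) simp_all

text \<open>The indices to which some entry can be lowered as in \<open>spread_update\<close>. When
  the generators are ordered lexicographically, these variables generate the colon ideal of the
  linear quotients.\<close>

definition gap :: "nat \<Rightarrow> nat list \<Rightarrow> nat set" where
  "gap t xs = {s. 1 \<le> s \<and> (\<exists>l<length xs. s < xs ! l \<and> (l = 0 \<or> xs ! (l - 1) + t \<le> s))}"

lemma gap_Nil [simp]: "gap t [] = {}"
  by (simp add: gap_def)

lemma gap_disjoint:
  assumes "spread n t xs" "t \<ge> 1"
  shows "gap t xs \<inter> set xs = {}"
proof -
  have False if "s \<in> gap t xs" "s \<in> set xs" for s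
  proof -
    obtain l where l: "l < length xs" "s < xs ! l" "l = 0 \<or> xs ! (l - 1) + t \<le> s"
      using \<open>s \<in> gap t xs\<close> by (auto simp: gap_def)
    obtain j where j: "j < length xs" "s = xs ! j"
      using \<open>s \<in> set xs\<close> by (metis in_set_conv_nth)
    have "j < l" using spread_nth_less[OF assms, of j l] l j
      by (cases j l rule: linorder_cases) auto
    then have "xs ! j \<le> xs ! (l - 1)"
    proof (cases "j < l - 1")
      case True
      then show ?thesis
        using spread_nth_less[OF assms, of "l - 1" j] l by (simp add: less_imp_le)
    next
      case False
      then have "j = l - 1" using \<open>j < l\<close> by linarith
      then show ?thesis by simp
    qed
    then show False using l j assms \<open>j < l\<close> by simp
  qed
  then show ?thesis by blast
qed

lemma finite_gap: "finite (gap t xs)"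
proof (rule finite_subset)
  show "gap t xs \<subseteq> (\<Union>x\<in>set xs. {..x})"
  proof
    fix s assume "s \<in> gap t xs"
    then obtain l where "l < length xs" "s < xs ! l" by (auto simp: gap_def)
    then show "s \<in> (\<Union>x\<in>set xs. {..x})" by (intro UN_I[of "xs ! l"]) auto
  qed
qed simp

text \<open>
  \<open>J\<close> is the set of supports of the monomials of a \<open>t\<close>-spread strongly stable ideal; the ideal is
  determined by it because its generators are squarefree.
\<close>

locale stable_family =
  fixes n t :: nat and J :: "nat set set"
  assumes t_pos: "t \<ge> 1"
    and J_sub: "X \<in> J \<Longrightarrow> X \<subseteq> {1..n}"
    and J_up: "X \<in> J \<Longrightarrow> X \<subseteq> Y \<Longrightarrow> Y \<subseteq> {1..n} \<Longrightarrow> Y \<in> J"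
    and J_gen: "X \<in> J \<Longrightarrow> \<exists>xs. spread n t xs \<and> set xs \<in> J \<and> set xs \<subseteq> X"
    and J_stable: "spread n t xs \<Longrightarrow> set xs \<in> J \<Longrightarrow> l < length xs \<Longrightarrow> s < xs ! l \<Longrightarrow>
      spread n t (xs[l := s]) \<Longrightarrow> set (xs[l := s]) \<in> J"
begin

section \<open>Minimal generators and the lexicographically leading one\<close>

definition gens :: "nat list set" where
  "gens = {xs. spread n t xs \<and> set xs \<in> J \<and> (\<forall>x\<in>set xs. set xs - {x} \<notin> J)}"

lemma gens_spread: "xs \<in> gens \<Longrightarrow> spread n t xs"
  and gens_J: "xs \<in> gens \<Longrightarrow> set xs \<in> J"
  by (auto simp: gens_def)

lemma gens_minimal:
  assumes "xs \<in> gens" "X \<in> J" "X \<subseteq> set xs"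
  shows "X = set xs"
proof (rule ccontr)
  assume "X \<noteq> set xs"
  then obtain x where "x \<in> set xs" "X \<subseteq> set xs - {x}" using assms by blast
  moreover have "set xs - {x} \<subseteq> {1..n}" using assms J_sub gens_J by blast
  ultimately have "set xs - {x} \<in> J" using J_up assms by blast
  then show False using assms \<open>x \<in> set xs\<close> by (auto simp: gens_def)
qed

lemma finite_gens: "finite gens"
proof (rule finite_subset)
  show "gens \<subseteq> {xs. set xs \<subseteq> {1..n} \<and> length xs \<le> n}"
  proof
    fix xs assume "xs \<in> gens"
    then have s: "spread n t xs" by (rule gens_spread)
    then have "length xs = card (set xs)"
      using spread_sorted_distinct[OF s t_pos] by (simp add: distinct_card)
    also have "\<dots> \<le> card {1..n}" using s by (intro card_mono) (auto simp: spread_def)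
    finally show "xs \<in> {xs. set xs \<subseteq> {1..n} \<and> length xs \<le> n}"
      using s by (auto simp: spread_def)
  qed
  show "finite {xs. set xs \<subseteq> {1..n} \<and> length xs \<le> n}"
    by (rule finite_lists_length_le) simp
qed

text \<open>The entries are lowered one at a time from the left: when position e is reached, its
  predecessor has already been lowered, so the intermediate lists stay spread and
  \<open>J_stable\<close> applies to each step.\<close>

lemma borel:
  assumes xs: "spread n t xs" "set xs \<in> J" and ys: "spread n t ys"
    and len: "length ys = length xs" and le: "\<And>l. l < length xs \<Longrightarrow> ys ! l \<le> xs ! l"
  shows "set ys \<in> J"
proof -
  have "spread n t (take e ys @ drop e xs) \<and> set (take e ys @ drop e xs) \<in> J"
    if "e \<le> length xs" for e
    using that
  proof (induction e)
    case 0
    then show ?case using xs by simp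
  next
    case (Suc e)
    define zs where "zs = take e ys @ drop e xs"
    have zs: "spread n t zs" "set zs \<in> J" using Suc by (auto simp: zs_def)
    have nth: "zs ! e = xs ! e" "length zs = length xs" "e > 0 \<Longrightarrow> zs ! (e - 1) = ys ! (e - 1)"
      using Suc.prems len by (auto simp: zs_def nth_append)
    have upd: "take (Suc e) ys @ drop (Suc e) xs = zs[e := ys ! e]"
      using Suc.prems len unfolding zs_def
      by (simp add: take_Suc_conv_app_nth list_update_append Cons_nth_drop_Suc[symmetric])
    have sp: "spread n t (zs[e := ys ! e])"
    proof (rule spread_update[OF zs(1)])
      show "e = 0 \<or> zs ! (e - 1) + t \<le> ys ! e"
      proof (cases e)
        case (Suc e')
        then show ?thesis using nth(3) ys len Suc.prems \<open>Suc e \<le> length xs\<close>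
          by (auto simp: spread_def)
      qed simp
    qed (use Suc.prems le nth len spread_nth_range[OF ys] in auto)
    have "set (zs[e := ys ! e]) \<in> J"
    proof (cases "ys ! e = xs ! e")
      case True
      then show ?thesis using zs nth by (metis list_update_id)
    next
      case False
      then show ?thesis using J_stable[OF zs _ _ sp] le[of e] nth Suc.prems by auto
    qed
    then show ?case using sp by (simp only: upd)
  qed
  from this[of "length xs"] show ?thesis using len by simp
qed

text \<open>The shortest prefix in J is minimal. Otherwise a strictly shorter spread list in J has
  its support inside that prefix; its entries dominate those of v, so lowering them puts an even
  shorter prefix of v into J.\<close>

lemma prefix_gen:
  assumes v: "spread n t v" "set v \<in> J"
  shows "\<exists>e\<le>length v. take e v \<in> gens"
proof -
  define e where "e = (LEAST e. set (take e v) \<in> J)"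
  have ex: "set (take (length v) v) \<in> J" using v by simp
  have e: "set (take e v) \<in> J" "e \<le> length v"
    using LeastI[of "\<lambda>e. set (take e v) \<in> J", OF ex] Least_le[of "\<lambda>e. set (take e v) \<in> J", OF ex]
    by (simp_all add: e_def)
  have "set (take e v) - {x} \<notin> J" if x: "x \<in> set (take e v)" for x
  proof
    assume "set (take e v) - {x} \<in> J"
    then obtain us where us: "spread n t us" "set us \<in> J" "set us \<subseteq> set (take e v) - {x}"
      using J_gen by blast
    have "length us = card (set us)"
      using spread_sorted_distinct[OF us(1) t_pos] by (simp add: distinct_card)
    also have "\<dots> < card (set (take e v))"
      using us x by (intro psubset_card_mono) auto
    also have "\<dots> \<le> e" using card_length[of "take e v"] e by simp
    finally have less: "length us < e" .
    have "set us \<subseteq> set v" using us set_take_subset by fastforce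
    note le = spread_sublist_nth_le[OF v(1) us(1) t_pos this]
    have "set (take (length us) v) \<in> J"
      by (rule borel[OF us(1,2) spread_take[OF v(1)]]) (use less e le in auto)
    then show False using less not_less_Least[of "length us" "\<lambda>e. set (take e v) \<in> J"]
      by (simp add: e_def)
  qed
  then show ?thesis using e spread_take[OF v(1)] by (auto simp: gens_def)
qed

definition lead :: "nat set \<Rightarrow> nat list" where
  "lead X = Min {xs \<in> gens. set xs \<subseteq> X}"

lemma lead_props:
  assumes "X \<in> J"
  shows "lead X \<in> gens" "set (lead X) \<subseteq> X"
    and "\<And>ys. ys \<in> gens \<Longrightarrow> set ys \<subseteq> X \<Longrightarrow> lead X \<le> ys"
proof -
  obtain xs where xs: "spread n t xs" "set xs \<in> J" "set xs \<subseteq> X" using J_gen assms by blast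
  obtain e where "take e xs \<in> gens" using prefix_gen xs by blast
  moreover have "set (take e xs) \<subseteq> X" using xs set_take_subset by fastforce
  ultimately have ne: "{xs \<in> gens. set xs \<subseteq> X} \<noteq> {}" by blast
  have fin: "finite {xs \<in> gens. set xs \<subseteq> X}" using finite_gens by simp
  show "lead X \<in> gens" "set (lead X) \<subseteq> X"
    using Min_in[OF fin ne] by (auto simp: lead_def)
  show "\<And>ys. ys \<in> gens \<Longrightarrow> set ys \<subseteq> X \<Longrightarrow> lead X \<le> ys"
    using fin by (auto simp: lead_def)
qed

lemma lead_antimono: "X \<in> J \<Longrightarrow> Y \<in> J \<Longrightarrow> X \<subseteq> Y \<Longrightarrow> lead Y \<le> lead X"
  using lead_props by (meson order_trans)

text \<open>Lowering an entry of the leading generator to a common element of X and the gaps gives a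
  list in J with support in X, and some prefix of it is a generator. A prefix ending before the
  lowered position contradicts minimality; a longer one is lexicographically smaller.\<close>

lemma gap_disjoint_lead:
  assumes "X \<in> J"
  shows "X \<inter> gap t (lead X) = {}"
proof (rule ccontr)
  define xs where "xs = lead X"
  assume "X \<inter> gap t (lead X) \<noteq> {}"
  then obtain s l where s: "s \<in> X" "1 \<le> s" "l < length xs" "s < xs ! l" "l = 0 \<or> xs ! (l - 1) + t \<le> s"
    by (auto simp: gap_def xs_def)
  have xs: "xs \<in> gens" "set xs \<subseteq> X" using lead_props assms by (auto simp: xs_def)
  have sp: "spread n t (xs[l := s])"
    by (rule spread_update) (use s gens_spread xs in auto)
  have "set (xs[l := s]) \<in> J"
    using J_stable[OF gens_spread gens_J] xs s sp by blast
  then obtain e where e: "e \<le> length xs" "take e (xs[l := s]) \<in> gens"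
    using prefix_gen[OF sp] by auto
  show False
  proof (cases "e \<le> l")
    case True
    then have "take e xs \<in> gens" using e by simp
    then have "set (take e xs) = set xs"
      using gens_minimal[OF xs(1) gens_J] set_take_subset by fastforce
    then have "take e xs = xs"
      using spread_set_eqD[OF spread_take gens_spread t_pos] gens_spread xs by blast
    then have "length xs \<le> e" by (metis length_take min.cobounded2)
    then show False using True s by simp
  next
    case False
    have "xs = take l xs @ xs ! l # drop (Suc l) xs" using s by (simp add: id_take_nth_drop)
    moreover have "take e (xs[l := s]) = take l xs @ s # take (e - Suc l) (drop (Suc l) xs)"
      using s False by (simp add: upd_conv_take_nth_drop min_def take_Cons' )
    ultimately have "take e (xs[l := s]) < xs"
      using s by (metis lex_append_less)
    moreover have "set (take e (xs[l := s])) \<subseteq> X"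
      using set_take_subset[of e "xs[l := s]"] set_update_subset_insert[of xs l s] xs s by blast
    then have "xs \<le> take e (xs[l := s])" using lead_props(3)[OF assms] e by (simp add: xs_def)
    ultimately show False by simp
  qed
qed

text \<open>For the converse, distinct generators are not prefixes of one another, so the leading
  one has a smaller entry at the first difference. That entry is a gap of xs lying in X.\<close>

lemma lead_eq_iff:
  assumes xs: "xs \<in> gens" and X: "X \<in> J"
  shows "lead X = xs \<longleftrightarrow> set xs \<subseteq> X \<and> X \<inter> gap t xs = {}"
proof
  assume "lead X = xs"
  then show "set xs \<subseteq> X \<and> X \<inter> gap t xs = {}"
    using gap_disjoint_lead lead_props(2) X by blast
next
  assume a: "set xs \<subseteq> X \<and> X \<inter> gap t xs = {}"
  define ys where "ys = lead X"
  have ys: "ys \<in> gens" "set ys \<subseteq> X" "ys \<le> xs" using lead_props X xs a by (auto simp: ys_def)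
  have eq: "xs = ys" if "set xs \<subseteq> set ys \<or> set ys \<subseteq> set xs"
    using that gens_minimal[OF xs gens_J[OF ys(1)]] gens_minimal[OF ys(1) gens_J[OF xs]]
      spread_set_eqD[OF gens_spread[OF xs] gens_spread[OF ys(1)] t_pos] by blast
  have "xs = ys"
  proof (rule ccontr)
    assume ne: "xs \<noteq> ys"
    then have "\<not> (\<exists>zs. ys = xs @ zs)" "\<not> (\<exists>zs. xs = ys @ zs)"
      using eq by (metis Un_upper1 set_append)+
    then obtain as b bs c cs where d: "xs = as @ b # bs" "ys = as @ c # cs" "b \<noteq> c"
      using first_difference[of ys xs] by blast
    have "ys < xs" using ys ne by simp
    then have "c < b" using d by simp
    moreover have "1 \<le> c" using spread_nth_range[OF gens_spread[OF ys(1)], of "length as"] d by simp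
    moreover have "length as = 0 \<or> xs ! (length as - 1) + t \<le> c"
    proof (cases as rule: rev_cases)
      case (snoc as' b')
      then show ?thesis using gens_spread[OF ys(1)] d
        by (auto simp: spread_def nth_append dest!: spec[of _ "length as'"])
    qed simp
    ultimately have "c \<in> gap t xs" using d by (auto simp: gap_def intro!: exI[of _ "length as"])
    then show False using a ys d by auto
  qed
  then show "lead X = xs" by (simp add: ys_def)
qed

text \<open>
  Process the generators in lexicographic order. In the slice of multidegree \<open>a\<close>, the \<open>s\<close> for which
  \<open>a - ind s\<close> has a given leading generator form an interval of sets, so this part can be contracted
  unless the interval is a single point.
\<close>

lemma koszul_slice_acyclic:
  fixes z :: "nat set \<Rightarrow> 'a::comm_ring_1"
  assumes a: "keys a \<subseteq> {1..n}"
    and none: "\<And>xs T. xs \<in> gens \<Longrightarrow> T \<subseteq> gap t xs \<Longrightarrow> card T = i \<Longrightarrow> a \<noteq> ind (set xs) + ind T"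
    and supp: "\<And>s. z s \<noteq> 0 \<Longrightarrow> s \<subseteq> keys a \<and> card s = i \<and> keys (a - ind s) \<in> J"
    and cyc: "\<And>s. s \<subseteq> {1..n} \<Longrightarrow> bd {1..n} z s = 0"
  shows "\<exists>w. (\<forall>s. w s \<noteq> 0 \<longrightarrow> s \<subseteq> keys a \<and> card s = Suc i \<and> keys (a - ind s) \<in> J) \<and> 
    (\<forall>s. bd {1..n} w s = z s)"
proof -
  \<comment> \<open>The support of the coefficient monomial at the face s; it shrinks as s grows.
    The rank below, the position in lexicographic order, is the filtration level for the
    induction.\<close>
  define A where "A s = keys (a - ind s)" for s
  define rk where "rk xs = card {ys \<in> gens. ys < xs}" for xs
  have mem_A: "x \<in> A s \<longleftrightarrow> x \<in> keys a \<and> (x \<in> s \<longrightarrow> lookup a x \<noteq> 1)" if "s \<subseteq> keys a" for s x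
    using that finite_subset[OF that finite_keys]
    by (auto simp: A_def in_keys_iff lookup_minus lookup_ind)
  have rk_less: "rk xs < rk ys" if "xs \<in> gens" "xs < ys" for xs ys
    unfolding rk_def using that finite_gens by (intro psubset_card_mono) auto
  have A_J: "A s \<in> J" if "s \<subseteq> r" "r \<subseteq> keys a" "A r \<in> J" for s r
  proof (rule J_up[OF that(3)])
    show "A r \<subseteq> A s" using that mem_A[of s] mem_A[of r] by auto
    show "A s \<subseteq> {1..n}" using that mem_A[of s] a by auto
  qed
  have "\<exists>w. (\<forall>s. w s \<noteq> 0 \<longrightarrow> s \<subseteq> keys a \<and> card s = Suc i \<and> A s \<in> J) \<and> (\<forall>s. bd {1..n} w s = z s)"
    if "\<And>s. z s \<noteq> 0 \<Longrightarrow> s \<subseteq> keys a \<and> card s = i \<and> A s \<in> J \<and> rk (lead (A s)) < N"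
      and "\<And>s. s \<subseteq> {1..n} \<Longrightarrow> bd {1..n} z s = 0" for N and z :: "nat set \<Rightarrow> 'a"
    using that
  proof (induction N arbitrary: z)
    case 0
    then show ?case by (intro exI[of _ 0]) (force simp: bd_def)
  next
    case (Suc N)
    show ?case
    proof (cases "\<exists>s. z s \<noteq> 0 \<and> rk (lead (A s)) = N")
      case False
      show ?thesis
      proof (rule Suc.IH)
        fix s assume "z s \<noteq> 0"
        then show "s \<subseteq> keys a \<and> card s = i \<and> A s \<in> J \<and> rk (lead (A s)) < N"
          using Suc.prems(1)[of s] False by (auto simp: less_Suc_eq)
      qed (rule Suc.prems(2))
    next
      case True
      then obtain s0 where s0: "z s0 \<noteq> 0" "rk (lead (A s0)) = N" by blast
      define u where "u = lead (A s0)"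
      have s0': "s0 \<subseteq> keys a" "card s0 = i" "A s0 \<in> J" using Suc.prems(1)[OF s0(1)] by auto
      have u: "u \<in> gens" using lead_props s0' by (simp add: u_def)
      have rk_u: "lead (A s) = u" if "A s \<in> J" "rk (lead (A s)) = N" for s
      proof -
        have "lead (A s) \<in> gens" using lead_props that by blast
        then show ?thesis
          using rk_less[of "lead (A s)" u] rk_less[of u "lead (A s)"] u that s0
          by (cases "lead (A s)" u rule: linorder_cases) (auto simp: u_def)
      qed
      define L where "L = {s. s \<subseteq> keys a \<and> set u \<subseteq> A s \<and> A s \<inter> gap t u = {}}"
      have L_J: "A s \<in> J" if "s \<in> L" for s
      proof (rule J_up)
        show "set u \<in> J" using u gens_J by blast
        show "A s \<subseteq> {1..n}" using that a mem_A[of s] by (auto simp: L_def)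
      qed (use that in \<open>auto simp: L_def\<close>)
      have L_iff: "s \<in> L \<longleftrightarrow> lead (A s) = u" if "A s \<in> J" "s \<subseteq> keys a" for s
        using lead_eq_iff[OF u that(1)] that by (auto simp: L_def)
      have s0L: "s0 \<in> L" using s0' L_iff by (simp add: u_def)
      \<comment> \<open>A vertex that can be added or removed without leaving the block of u. If
        there is none, every index of a is either a gap, and then in s0 with exponent 1, or an entry
        of u with exponent 1; so a is the product excluded by \<open>none\<close>.\<close>
      have "\<exists>p. p \<in> keys a \<and> p \<notin> gap t u \<and> (p \<notin> set u \<or> lookup a p \<noteq> 1)"
      proof (rule ccontr)
        assume no: "\<not> ?thesis"
        have 5: "p \<in> set u" if "p \<in> keys a" "p \<notin> gap t u" for p
          using no that by blast
        have 1: "lookup a p = 1 \<and> p \<notin> s0" if "p \<in> keys a" "p \<notin> gap t u" for p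
        proof -
          have "p \<in> A s0" using 5[OF that] s0L by (auto simp: L_def)
          then show ?thesis using no that mem_A[OF s0'(1), of p] by blast
        qed
        have 2: "lookup a p = 1 \<and> p \<in> s0" if "p \<in> keys a" "p \<in> gap t u" for p
          using mem_A[OF s0'(1), of p] that s0L by (auto simp: L_def)
        have 3: "set u \<subseteq> keys a" using s0L mem_A[OF s0'(1)] by (auto simp: L_def)
        have 4: "set u \<inter> gap t u = {}" using gap_disjoint[OF gens_spread[OF u] t_pos] by blast
        have 6: "s0 \<subseteq> gap t u" using 1 s0' by blast
        have "a = ind (set u) + ind s0"
        proof (rule poly_mapping_eqI)
          fix p
          have "finite s0" using finite_subset[OF s0'(1) finite_keys] .
          then have "lookup (ind (set u) + ind s0) p = of_bool (p \<in> set u) + of_bool (p \<in> s0)"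
            by (simp add: lookup_add lookup_ind)
          also have "\<dots> = lookup a p"
          proof (cases "p \<in> keys a")
            case True
            then show ?thesis
            proof (cases "p \<in> gap t u")
              case g: True
              then have "p \<notin> set u" using 4 by blast
              then show ?thesis using 2[OF True g] by simp
            qed (use 1[of p] 5[of p] True in simp)
          next
            case False
            then have "p \<notin> set u" "p \<notin> s0" "lookup a p = 0"
              using 3 s0' by (auto simp: in_keys_iff)
            then show ?thesis by simp
          qed
          finally show "lookup a p = lookup (ind (set u) + ind s0) p" ..
        qed
        then show False using none[OF u 6 s0'(2)] by blast
      qed
      then obtain p where p: "p \<in> keys a" "p \<notin> gap t u" "p \<notin> set u \<or> lookup a p \<noteq> 1"
        by blast
      have pn: "p \<in> {1..n}" using p a by blast
      define w1 where "w1 = toggle p L z"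
      have w1: "s \<in> L \<and> card s = Suc i" if "w1 s \<noteq> 0" for s
      proof -
        have s: "p \<in> s" "s \<in> L" "z (s - {p}) \<noteq> 0"
          using that by (auto simp: w1_def toggle_def split: if_splits)
        then have "finite s" using finite_subset[of s "keys a"] by (simp add: L_def)
        then show ?thesis using s Suc.prems(1)[OF s(3)] card_Suc_Diff1[of s p] by simp
      qed
      have bd_L: "bd {1..n} w1 s = z s" if "s \<in> L" for s
        unfolding w1_def
      proof (rule bd_toggle)
        show "L \<subseteq> Pow {1..n}" using a by (auto simp: L_def)
        show "insert p r \<in> L \<longleftrightarrow> r - {p} \<in> L" for r
        proof (cases "r \<subseteq> keys a")
          case True
          then have r: "insert p r \<subseteq> keys a" "r - {p} \<subseteq> keys a" using p by auto
          have "x \<in> A (insert p r) \<longleftrightarrow> x \<in> A (r - {p})" if "x \<in> set u \<or> x \<in> gap t u" for x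
            using mem_A[OF r(1)] mem_A[OF r(2)] that p by auto
          then have "set u \<subseteq> A (insert p r) \<longleftrightarrow> set u \<subseteq> A (r - {p})"
            "A (insert p r) \<inter> gap t u = {} \<longleftrightarrow> A (r - {p}) \<inter> gap t u = {}"
            by blast+
          then show ?thesis using r by (simp add: L_def)
        qed (use p in \<open>auto simp: L_def\<close>)
        \<comment> \<open>A larger face has a smaller coefficient support, so its leading generator
          does not precede u. As z lives in ranks up to N, the rank of u, a nonzero value would put
          this face into the block.\<close>
        show "z (insert j r) = 0" if r: "r \<in> L" "insert j r \<notin> L" for r j
        proof (rule ccontr)
          assume z: "z (insert j r) \<noteq> 0"
          then have j: "insert j r \<subseteq> keys a" "A (insert j r) \<in> J" "rk (lead (A (insert j r))) < Suc N"
            using Suc.prems(1)[OF z] by auto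
          have "A (insert j r) \<subseteq> A r" using mem_A[OF j(1)] mem_A[of r] j(1) by auto
          moreover have "lead (A r) = u" using L_iff[of r] L_J r j by auto
          ultimately have "u \<le> lead (A (insert j r))"
            using lead_antimono[OF j(2) L_J[OF r(1)]] by simp
          then have "\<not> rk (lead (A (insert j r))) < N"
            using rk_less[OF u, of "lead (A (insert j r))"] s0 u_def by (auto simp: le_less)
          then show False using rk_u[OF j(2)] j r L_iff[OF j(2,1)] by simp
        qed
      qed (use pn that Suc.prems in auto)
      \<comment> \<open>Subtracting the boundary clears the block of u; the terms it creates
        elsewhere have strictly earlier leading generators.\<close>
      define z' where "z' = z - bd {1..n} w1"
      have "\<exists>w. (\<forall>s. w s \<noteq> 0 \<longrightarrow> s \<subseteq> keys a \<and> card s = Suc i \<and> A s \<in> J) \<and> 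
        (\<forall>s. bd {1..n} w s = z' s)"
      proof (rule Suc.IH)
        fix s
        show "bd {1..n} z' s = 0" if "s \<subseteq> {1..n}"
          using bd_diff[of "{1..n}" z "bd {1..n} w1" s] Suc.prems(2)[OF that]
            bd_bd[of "{1..n}" s w1] finite_subset[OF that] by (simp add: z'_def)
        assume z': "z' s \<noteq> 0"
        then have sL: "s \<notin> L" using bd_L by (auto simp: z'_def)
        show "s \<subseteq> keys a \<and> card s = i \<and> A s \<in> J \<and> rk (lead (A s)) < N"
        proof (cases "z s = 0")
          case False
          then show ?thesis
            using Suc.prems(1)[OF False] rk_u[of s] L_iff[of s] sL by (auto simp: less_Suc_eq)
        next
          case True
          then have "bd {1..n} w1 s \<noteq> 0" using z' by (auto simp: z'_def)
          then obtain j where j: "j \<notin> s" "w1 (insert j s) \<noteq> 0"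
            unfolding bd_def by (metis (no_types, lifting) DiffD2 mult_zero_right sum.neutral)
          then have jL: "insert j s \<in> L" "card (insert j s) = Suc i" using w1 by auto
          then have jk: "insert j s \<subseteq> keys a" by (auto simp: L_def)
          have fin: "finite s" using finite_subset[of s "keys a"] jk by simp
          have sJ: "A s \<in> J" using A_J[of s "insert j s"] L_J jL jk by auto
          have "A (insert j s) \<subseteq> A s" using mem_A[OF jk] mem_A[of s] jk by auto
          then have "lead (A s) \<le> u"
            using lead_antimono[OF L_J[OF jL(1)] sJ] L_iff[OF L_J[OF jL(1)] jk] jL by simp
          moreover have "lead (A s) \<noteq> u" using L_iff[of s] sJ jk sL by auto
          ultimately have "rk (lead (A s)) < N"
            using rk_less[of "lead (A s)" u] lead_props(1)[OF sJ] s0 by (simp add: u_def)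
          then show ?thesis using sJ jk jL(2) fin j by simp
        qed
      qed
      then obtain w2 where w2: "\<And>s. w2 s \<noteq> 0 \<Longrightarrow> s \<subseteq> keys a \<and> card s = Suc i \<and> A s \<in> J"
        "\<And>s. bd {1..n} w2 s = z' s" by blast
      have "bd {1..n} (w1 + w2) s = z s" for s
        using w2(2)[of s] by (simp add: bd_def z'_def algebra_simps sum.distrib)
      moreover have "s \<subseteq> keys a \<and> card s = Suc i \<and> A s \<in> J" if "(w1 + w2) s \<noteq> 0" for s
        using that w1[of s] w2(1)[of s] L_J[of s] by (cases "w1 s = 0") (auto simp: L_def)
      ultimately show ?thesis by blast
    qed
  qed
  from this[of z "Suc (Max ((\<lambda>s. rk (lead (A s))) ` Pow (keys a)))"] show ?thesis
    using supp cyc unfolding A_def[symmetric]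
    by (simp add: less_Suc_eq_le)
qed

end

section \<open>The Koszul complex\<close>

lemma total_deg_eq:
  assumes "finite B" "keys m \<subseteq> B"
  shows "total_deg m = (\<Sum>i\<in>B. lookup m i)"
  unfolding total_deg_def using assms
  by (intro sum.mono_neutral_left) (auto simp: in_keys_iff)

lemma total_deg_add [simp]: "total_deg (a + b) = total_deg a + total_deg b"
proof -
  have "keys (a + b) \<subseteq> keys a \<union> keys b" by (rule Poly_Mapping.keys_add)
  then show ?thesis
    by (simp add: total_deg_eq[of "keys a \<union> keys b"] lookup_add sum.distrib)
qed

lemma total_deg_zero [simp]: "total_deg 0 = 0"
  by (simp add: total_deg_def)

lemma total_deg_eq_0_iff: "total_deg m = 0 \<longleftrightarrow> m = 0"
proof
  assume "total_deg m = 0"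
  then have "\<forall>i\<in>keys m. lookup m i = 0" by (simp add: total_deg_def)
  then have "lookup m i = 0" for i by (cases "i \<in> keys m") (simp_all add: in_keys_iff)
  then show "m = 0" by (intro poly_mapping_eqI) simp
qed simp

lemma total_deg_ind [simp]: "finite X \<Longrightarrow> total_deg (ind X) = card X"
  by (simp add: total_deg_eq[of X] lookup_ind)

lemma keys_add_expo: "keys (a + b) = keys a \<union> keys (b :: expo)"
  by (auto simp: in_keys_iff lookup_add)

definition kos :: "nat \<Rightarrow> (nat set \<Rightarrow> 'k::comm_ring_1 mpoly) \<Rightarrow> nat set \<Rightarrow> 'k mpoly" where
  "kos n = wbd {1..n} ind"

text \<open>Chains of homological degree \<open>q\<close> and internal degree \<open>D\<close>, over a free generator of degree \<open>s\<close>.\<close>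

definition kchain :: "nat \<Rightarrow> nat \<Rightarrow> nat \<Rightarrow> nat \<Rightarrow> (nat set \<Rightarrow> 'k::comm_ring_1 mpoly) \<Rightarrow> bool" where
  "kchain n s D q f \<longleftrightarrow> (\<forall>\<sigma> m. lookup (f \<sigma>) m \<noteq> 0 \<longrightarrow>
     \<sigma> \<subseteq> {1..n} \<and> card \<sigma> = q \<and> keys m \<subseteq> {1..n} \<and> total_deg m + q + s = D)"

text \<open>Coefficients in the ideal given by J. Supports suffice, since a squarefree monomial
  ideal contains a monomial iff it contains its squarefree part.\<close>

definition supp_in :: "nat set set \<Rightarrow> (nat set \<Rightarrow> 'k::comm_ring_1 mpoly) \<Rightarrow> bool" where
  "supp_in J f \<longleftrightarrow> (\<forall>\<sigma> m. lookup (f \<sigma>) m \<noteq> 0 \<longrightarrow> keys m \<in> J)"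

lemma kchainD:
  assumes "kchain n s D q f" "lookup (f \<sigma>) m \<noteq> 0"
  shows "\<sigma> \<subseteq> {1..n}" "finite \<sigma>" "card \<sigma> = q" "keys m \<subseteq> {1..n}" "total_deg m + q + s = D"
  using assms finite_subset[of \<sigma> "{1..n}"] unfolding kchain_def by blast+

lemma kchain_zero [simp]: "kchain n s D q (\<lambda>_. 0)" "kchain n s D q 0"
  by (simp_all add: kchain_def)

lemma kchain_support: "kchain n s D q f \<Longrightarrow> f \<sigma> \<noteq> 0 \<Longrightarrow> \<sigma> \<subseteq> {1..n}"
  using kchainD(1)[of n s D q f \<sigma>] by (metis lookup_zero poly_mapping_eqI)

lemma kchain_diff: "kchain n s D q f \<Longrightarrow> kchain n s D q g \<Longrightarrow> kchain n s D q (f - g)"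
  unfolding kchain_def fun_diff_def lookup_minus by (metis diff_zero)

lemma supp_in_diff: "supp_in J f \<Longrightarrow> supp_in J g \<Longrightarrow> supp_in J (f - g)"
  unfolding supp_in_def fun_diff_def lookup_minus by (metis diff_zero)

lemma kos_diff: "kos n (f - g) = kos n f - kos n g"
  by (rule ext) (simp add: kos_def wbd_def sum_subtractf algebra_simps)

lemma kos_zero [simp]: "kos n (\<lambda>_. 0) = (\<lambda>_. 0)" "kos n 0 = 0"
  by (rule ext; simp add: kos_def wbd_def)+

text \<open>Linearity over S; with matrix entries as g b, this makes the squares of the double
  complex commute.\<close>

lemma kos_lincomb:
  "kos n (\<lambda>\<sigma>. \<Sum>b\<in>B. x b \<sigma> * g b) \<sigma> = (\<Sum>b\<in>B. kos n (x b) \<sigma> * g b)"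
  unfolding kos_def wbd_def sum_distrib_left sum_distrib_right
  by (subst sum.swap) (simp add: mult.assoc)

lemma ind_insert_mono: "edvd (ind s) (ind (insert j s))"
  using edvd_ind_Un[of "{j}" s] by simp

lemma cf_kos: "cf ind (kos n f) a = bd {1..n} (cf ind f a)"
  unfolding kos_def by (rule cf_wbd) (rule ind_insert_mono)

lemma lookup_kos: "lookup (kos n f \<sigma>) m = bd {1..n} (cf ind f (m + ind \<sigma>)) \<sigma>"
  by (simp add: cf_shift[of ind, symmetric] cf_kos)

lemma lookup_kos_nonzero:
  assumes "lookup (kos n f \<sigma>) m \<noteq> 0"
  obtains j m' where "j \<in> {1..n}" "j \<notin> \<sigma>" "lookup (f (insert j \<sigma>)) m' \<noteq> 0"
    "m + ind \<sigma> = m' + ind (insert j \<sigma>)"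
proof -
  obtain j where j: "j \<in> {1..n} - \<sigma>" "cf ind f (m + ind \<sigma>) (insert j \<sigma>) \<noteq> 0"
    using assms unfolding lookup_kos bd_def by (metis (no_types, lifting) mult_zero_right sum.neutral)
  then have "edvd (ind (insert j \<sigma>)) (m + ind \<sigma>)"
    "lookup (f (insert j \<sigma>)) (m + ind \<sigma> - ind (insert j \<sigma>)) \<noteq> 0"
    by (auto simp: cf_def split: if_splits)
  then show ?thesis using that[of j "m + ind \<sigma> - ind (insert j \<sigma>)"] j edvd_diff_add by auto
qed

lemma ind_insert: "finite \<sigma> \<Longrightarrow> j \<notin> \<sigma> \<Longrightarrow> ind (insert j \<sigma>) = single j 1 + ind \<sigma>"
  by (simp add: ind_def)

lemma lookup_kos_nonzero':
  assumes "lookup (kos n f \<sigma>) m \<noteq> 0" "kchain n s D (Suc q) f"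
  obtains j m' where "j \<in> {1..n}" "j \<notin> \<sigma>" "lookup (f (insert j \<sigma>)) m' \<noteq> 0"
    "m = m' + single j 1" "finite \<sigma>"
proof -
  obtain j m' where j: "j \<in> {1..n}" "j \<notin> \<sigma>" "lookup (f (insert j \<sigma>)) m' \<noteq> 0"
    "m + ind \<sigma> = m' + ind (insert j \<sigma>)" by (rule lookup_kos_nonzero[OF assms(1)])
  have "finite \<sigma>" using kchainD(2)[OF assms(2) j(3)] by simp
  then have "m = m' + single j 1"
    using j by (simp add: ind_insert add.assoc[symmetric])
  then show ?thesis using that j \<open>finite \<sigma>\<close> by blast
qed

lemma kchain_kos:
  assumes "kchain n s D (Suc q) f"
  shows "kchain n s D q (kos n f)"
  unfolding kchain_def
proof (intro allI impI)
  fix \<sigma> m assume "lookup (kos n f \<sigma>) m \<noteq> 0"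
  then obtain j m' where j: "j \<in> {1..n}" "j \<notin> \<sigma>" "lookup (f (insert j \<sigma>)) m' \<noteq> 0"
    "m = m' + single j 1" "finite \<sigma>" using lookup_kos_nonzero' assms by metis
  have "total_deg (single j 1) = 1" by (simp add: total_deg_def)
  then show "\<sigma> \<subseteq> {1..n} \<and> card \<sigma> = q \<and> keys m \<subseteq> {1..n} \<and> total_deg m + q + s = D"
    using kchainD[OF assms j(3)] j by (auto simp: keys_add_expo)
qed

lemma supp_in_kos:
  assumes "kchain n s D (Suc q) f" "supp_in J f"
    and up: "\<And>X Y. X \<in> J \<Longrightarrow> X \<subseteq> Y \<Longrightarrow> Y \<subseteq> {1..n} \<Longrightarrow> Y \<in> J"
  shows "supp_in J (kos n f)"
  unfolding supp_in_def
proof (intro allI impI)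
  fix \<sigma> m assume m: "lookup (kos n f \<sigma>) m \<noteq> 0"
  then obtain j m' where j: "lookup (f (insert j \<sigma>)) m' \<noteq> 0" "m = m' + single j 1"
    using lookup_kos_nonzero' assms(1) by metis
  have "keys m' \<in> J" using assms(2) j unfolding supp_in_def by blast
  moreover have "keys m \<subseteq> {1..n}" using kchainD(4)[OF kchain_kos[OF assms(1)] m] .
  moreover have "keys m' \<subseteq> keys m" using j by (auto simp: keys_add_expo)
  ultimately show "keys m \<in> J" using up by blast
qed

lemma kos_kchain_0:
  assumes "kchain n s D 0 f"
  shows "kos n f = 0"
proof (intro ext poly_mapping_eqI)
  fix \<sigma> m
  show "lookup (kos n f \<sigma>) m = lookup (0 \<sigma>) m"
  proof (rule ccontr)
    assume "lookup (kos n f \<sigma>) m \<noteq> lookup (0 \<sigma>) m"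
    then have "lookup (kos n f \<sigma>) m \<noteq> 0" by simp
    then obtain j m' where "lookup (f (insert j \<sigma>)) m' \<noteq> 0"
      by (rule lookup_kos_nonzero)
    then show False using kchainD(2,3)[OF assms] by fastforce
  qed
qed

lemma kos_kos:
  assumes "kchain n s D q f"
  shows "kos n (kos n f) = 0"
proof (rule cf_eqD[of ind], rule ext)
  fix a \<sigma>
  have supp: "\<tau> \<subseteq> {1..n}" if "cf ind f a \<tau> \<noteq> 0" for \<tau>
    using that kchainD(1)[OF assms] by (auto simp: cf_def split: if_splits)
  show "cf ind (kos n (kos n f)) a \<sigma> = cf ind 0 a \<sigma>"
  proof (cases "finite \<sigma>")
    case True
    then show ?thesis by (simp add: cf_kos bd_bd)
  next
    case False
    then have "cf ind f a (insert j (insert l \<sigma>)) = 0" for j l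
      using supp[of "insert j (insert l \<sigma>)"] finite_subset[of \<sigma> "{1..n}"] by auto
    then show ?thesis by (simp add: cf_kos bd_def)
  qed
qed

text \<open>Up to sign the entries of the Koszul differential are variables, so its image has no
  constant term and dies under the augmentation to K.\<close>

lemma lookup_kos_0:
  "lookup (kos n f {}) 0 = 0"
proof (rule ccontr)
  assume "lookup (kos n f {}) 0 \<noteq> 0"
  then obtain j m' where j: "0 + ind {} = m' + ind (insert j {})"
    using lookup_kos_nonzero by metis
  have "lookup (0 + ind {}) j = lookup (m' + ind {j}) j" using j by simp
  then show False by (simp add: lookup_add lookup_ind)
qed

text \<open>The slices that resist contraction have multidegree ind (set xs) + ind T, of total
  degree length xs + i. The numerical hypothesis excludes this degree, so all slices are
  exact.\<close>

lemma (in stable_family) koszul_exact: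
  assumes f: "kchain n s D i f" "supp_in J f" "kos n f = 0"
    and none: "\<And>xs T. xs \<in> gens \<Longrightarrow> T \<subseteq> gap t xs \<Longrightarrow> card T = i \<Longrightarrow> length xs + i + s \<noteq> D"
  shows "\<exists>h. kchain n s D (Suc i) h \<and> supp_in J h \<and> kos n h = f"
proof -
  define P where "P a \<sigma> \<longleftrightarrow> \<sigma> \<subseteq> keys a \<and> card \<sigma> = Suc i \<and> keys (a - ind \<sigma>) \<in> J \<and>
    keys a \<subseteq> {1..n} \<and> total_deg a + s = D" for a \<sigma>
  have "\<exists>h. wbd {1..n} ind h = f \<and> (\<forall>\<sigma> m. lookup (h \<sigma>) m \<noteq> 0 \<longrightarrow> P (m + ind \<sigma>) \<sigma>)"
  proof (rule lift_boundary)
    show "\<sigma> \<subseteq> {1..n}" if "f \<sigma> \<noteq> 0" for \<sigma> using kchain_support[OF f(1)] that .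
  next
    fix a assume a: "cf ind f a \<noteq> 0"
    have slice: "\<sigma> \<subseteq> keys a \<and> finite \<sigma> \<and> card \<sigma> = i \<and> keys (a - ind \<sigma>) \<in> J \<and>
        keys a \<subseteq> {1..n} \<and> total_deg a + s = D" if \<sigma>: "cf ind f a \<sigma> \<noteq> 0" for \<sigma>
    proof -
      have l: "edvd (ind \<sigma>) a" "lookup (f \<sigma>) (a - ind \<sigma>) \<noteq> 0"
        using \<sigma> by (auto simp: cf_def split: if_splits)
      note k = kchainD[OF f(1) l(2)]
      have "keys a = keys (a - ind \<sigma>) \<union> keys (ind \<sigma>)"
        using edvd_diff_add[OF l(1)] keys_add_expo[of "a - ind \<sigma>" "ind \<sigma>"] by simp
      moreover have "total_deg a = total_deg (a - ind \<sigma>) + card \<sigma>"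
        using edvd_diff_add[OF l(1)] total_deg_add[of "a - ind \<sigma>" "ind \<sigma>"] k by simp
      ultimately show ?thesis using k f(2) l by (auto simp: supp_in_def)
    qed
    obtain \<sigma>0 where "cf ind f a \<sigma>0 \<noteq> 0" using a by (auto simp: fun_eq_iff)
    note a' = slice[OF this]
    have "\<exists>w. (\<forall>\<sigma>. w \<sigma> \<noteq> 0 \<longrightarrow> \<sigma> \<subseteq> keys a \<and> card \<sigma> = Suc i \<and> keys (a - ind \<sigma>) \<in> J) \<and>
        (\<forall>\<sigma>. bd {1..n} w \<sigma> = cf ind f a \<sigma>)"
    proof (rule koszul_slice_acyclic)
      fix xs T assume x: "xs \<in> gens" "T \<subseteq> gap t xs" "card T = i"
      have "finite T" using x finite_gap finite_subset by blast
      moreover have "card (set xs) = length xs"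
        using spread_sorted_distinct[OF gens_spread[OF x(1)] t_pos] by (simp add: distinct_card)
      ultimately have "total_deg (ind (set xs) + ind T) = length xs + i"
        using x by simp
      then show "a \<noteq> ind (set xs) + ind T" using none[OF x] a' by auto
    next
      fix \<sigma>
      show "bd {1..n} (cf ind f a) \<sigma> = 0"
        unfolding cf_kos[symmetric] f(3) by simp
    qed (use slice a' in auto)
    then obtain w where w: "\<And>\<sigma>. w \<sigma> \<noteq> 0 \<Longrightarrow> \<sigma> \<subseteq> keys a \<and> card \<sigma> = Suc i \<and> keys (a - ind \<sigma>) \<in> J"
      "\<And>\<sigma>. bd {1..n} w \<sigma> = cf ind f a \<sigma>" by blast
    have "edvd (ind \<sigma>) a \<and> P a \<sigma>" if "w \<sigma> \<noteq> 0" for \<sigma>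
      using w(1)[OF that] a' edvd_ind_iff[of \<sigma> a] finite_subset[of \<sigma> "keys a"]
      by (simp add: P_def)
    then show "\<exists>w. bd {1..n} w = cf ind f a \<and> (\<forall>\<sigma>. w \<sigma> \<noteq> 0 \<longrightarrow> edvd (ind \<sigma>) a \<and> P a \<sigma>)"
      using w(2) by (intro exI[of _ w]) auto
  qed (simp_all add: ind_insert_mono)
  then obtain h where h: "kos n h = f" "\<And>\<sigma> m. lookup (h \<sigma>) m \<noteq> 0 \<Longrightarrow> P (m + ind \<sigma>) \<sigma>"
    unfolding kos_def by blast
  have "\<sigma> \<subseteq> {1..n} \<and> card \<sigma> = Suc i \<and> keys m \<subseteq> {1..n} \<and> total_deg m + Suc i + s = D \<and> keys m \<in> J"
    if "lookup (h \<sigma>) m \<noteq> 0" for \<sigma> m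
  proof -
    have "P (m + ind \<sigma>) \<sigma>" using h(2) that .
    moreover from this have "finite \<sigma>" unfolding P_def using finite_subset[of \<sigma>] finite_keys by blast
    ultimately show ?thesis by (auto simp: P_def keys_add_expo)
  qed
  then have "kchain n s D (Suc i) h" "supp_in J h"
    unfolding kchain_def supp_in_def by blast+
  then show ?thesis using h(1) by blast
qed

text \<open>The ring S as a stable family: its only minimal generator is the empty list, the
  monomial 1. Exactness over S thus becomes a case of \<open>koszul_exact\<close>.\<close>

lemma stable_family_Pow: "stable_family n 1 (Pow {1..n})"
proof
  show "\<exists>xs. spread n 1 xs \<and> set xs \<in> Pow {1..n} \<and> set xs \<subseteq> X" for X
    by (intro exI[of _ "[]"]) simp
  show "set (xs[l := s]) \<in> Pow {1..n}" if "spread n 1 (xs[l := s])" for xs l s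
    using that by (simp add: spread_def)
qed auto

lemma koszul_exact_polys:
  assumes f: "kchain n s D i f" "kos n f = 0" and "i = 0 \<Longrightarrow> lookup (f {}) 0 = 0"
  shows "\<exists>h. kchain n s D (Suc i) h \<and> kos n h = f"
\<comment> \<open>The one bidegree where the Koszul complex of S has homology. A chain there is a
  single constant, which the third hypothesis makes 0.\<close>
proof (cases "i = 0 \<and> s = D")
  case True
  have "f \<sigma> = 0" for \<sigma>
  proof (rule poly_mapping_eqI)
    fix m
    show "lookup (f \<sigma>) m = lookup 0 m"
    proof (rule ccontr)
      assume "lookup (f \<sigma>) m \<noteq> lookup 0 m"
      then have "lookup (f \<sigma>) m \<noteq> 0" by simp
      note k = kchainD[OF f(1) this]
      have "\<sigma> = {}" "m = 0" using k True by (auto simp: total_deg_eq_0_iff)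
      then show False using assms(3) True \<open>lookup (f \<sigma>) m \<noteq> 0\<close> by simp
    qed
  qed
  then have "f = 0" by auto
  then show ?thesis by (intro exI[of _ 0]) simp
next
  case False
  interpret stable_family n 1 "Pow {1..n}" by (rule stable_family_Pow)
  have gens: "xs = []" if "xs \<in> gens" for xs
  proof (rule ccontr)
    assume "xs \<noteq> []"
    then have "hd xs \<in> set xs" by simp
    moreover have "set xs - {hd xs} \<in> Pow {1..n}" using J_sub[OF gens_J[OF that]] by blast
    ultimately show False using that unfolding gens_def by blast
  qed
  have "\<exists>h. kchain n s D (Suc i) h \<and> supp_in (Pow {1..n}) h \<and> kos n h = f"
  proof (rule koszul_exact)
    show "supp_in (Pow {1..n}) f" using f(1) by (auto simp: supp_in_def kchain_def)
    fix xs T assume "xs \<in> gens" "T \<subseteq> gap 1 xs" "card T = i"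
    then have "xs = []" using gens by blast
    then have "i = 0" using \<open>T \<subseteq> gap 1 xs\<close> \<open>card T = i\<close> by simp
    then show "length xs + i + s \<noteq> D" using False \<open>xs = []\<close> by simp
  qed (use f in auto)
  then show ?thesis by blast
qed

text \<open>The cycle is the boundary of a chain e with one coefficient, the generator divided by
  x_b, which lies outside the ideal; \<open>repl\<close> puts the coefficients of the boundary
  inside. This is a connecting homomorphism made explicit. A chain over the ideal with the same
  boundary would have a coefficient involving a proper divisor of the generator, against
  minimality.\<close>

lemma (in stable_family) koszul_nonexact:
  assumes xs: "xs \<in> gens" "l < length xs"
    and \<sigma>: "\<sigma> \<subseteq> {1..n}" "\<sigma> \<inter> set xs = {}"
    and repl: "\<And>s. s \<in> \<sigma> \<Longrightarrow> insert s (set xs - {xs ! l}) \<in> J"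
  shows "\<exists>f :: nat set \<Rightarrow> 'k::field mpoly. kchain n 0 (length xs + card \<sigma>) (card \<sigma>) f \<and> supp_in J f \<and> kos n f = 0 \<and>
     \<not> (\<exists>h. supp_in J h \<and> kos n h = f)"
proof -
  define b where "b = xs ! l"
  have fin: "finite \<sigma>" using \<sigma> finite_subset by blast
  have b: "b \<in> set xs" "b \<notin> \<sigma>" "b \<in> {1..n}"
    using nth_mem[OF xs(2)] \<sigma> J_sub[OF gens_J[OF xs(1)]] unfolding b_def by blast+
  have card: "card (set xs) = length xs"
    using spread_sorted_distinct[OF gens_spread[OF xs(1)] t_pos] by (simp add: distinct_card)
  define e :: "nat set \<Rightarrow> 'k mpoly"
    where "e \<tau> = (if \<tau> = insert b \<sigma> then single (ind (set xs - {b})) 1 else 0)" for \<tau>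
  define f where "f = kos n e"
  define D where "D = length xs + card \<sigma>"
  have e: "lookup (e \<tau>) m \<noteq> 0 \<longleftrightarrow> \<tau> = insert b \<sigma> \<and> m = ind (set xs - {b})" for \<tau> m
    by (auto simp: e_def lookup_single when_def)
  have "length xs = Suc (card (set xs - {b}))" using b card by (simp add: card_Diff_singleton_if)
      (metis Suc_pred card_gt_0_iff empty_iff finite_set)
  then have ke: "kchain n 0 D (Suc (card \<sigma>)) e"
    using b fin \<sigma> J_sub[OF gens_J[OF xs(1)]] by (auto simp: kchain_def e D_def)
  have kf: "kchain n 0 D (card \<sigma>) f" using kchain_kos ke by (simp add: f_def)
  have Jf: "supp_in J f"
    unfolding supp_in_def
  proof (intro allI impI)
    fix \<tau> m assume "lookup (f \<tau>) m \<noteq> 0"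
    then obtain j m' where j: "j \<in> {1..n}" "j \<notin> \<tau>" "lookup (e (insert j \<tau>)) m' \<noteq> 0"
      "m = m' + single j 1" using lookup_kos_nonzero'[OF _ ke] unfolding f_def by metis
    then have "keys m = insert j (set xs - {b})" "j \<in> insert b \<sigma>"
      by (auto simp: e keys_add_expo)
    moreover have "insert b (set xs - {b}) = set xs" using b by blast
    ultimately show "keys m \<in> J" using repl[of j] gens_J[OF xs(1)]
      unfolding b_def[symmetric] by (cases "j = b") auto
  qed
  have "\<not> (\<exists>h. supp_in J h \<and> kos n h = f)"
  proof
    assume "\<exists>h. supp_in J h \<and> kos n h = f"
    then obtain h where h: "supp_in J h" "kos n h = f" by blast
    define m where "m = ind (set xs)"
    have decomp: "m + ind \<sigma> = ind (set xs - {b}) + ind (insert b \<sigma>)"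
      using ind_insert[of "set xs - {b}" b] ind_insert[OF fin b(2)] b(1)
      by (simp add: m_def insert_absorb ac_simps)
    have "bd {1..n} (cf ind e (m + ind \<sigma>)) \<sigma> = (\<Sum>j\<in>{1..n} - \<sigma>. if j = b then bsgn b \<sigma> else 0)"
      unfolding bd_def
    proof (intro sum.cong refl)
      fix j assume "j \<in> {1..n} - \<sigma>"
      then have "insert j \<sigma> = insert b \<sigma> \<longleftrightarrow> j = b" using b by auto
      moreover have "cf ind e (m + ind \<sigma>) (insert b \<sigma>) = 1"
        by (simp add: decomp cf_shift e_def)
      moreover have "cf ind e (m + ind \<sigma>) (insert j \<sigma>) = 0" if "insert j \<sigma> \<noteq> insert b \<sigma>"
        using that by (simp add: cf_def e_def)
      ultimately show "bsgn j \<sigma> * cf ind e (m + ind \<sigma>) (insert j \<sigma>) = (if j = b then bsgn b \<sigma> else 0)"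
        by auto
    qed
    also have "\<dots> = bsgn b \<sigma>" using b by simp
    finally have "lookup (f \<sigma>) m = bsgn b \<sigma>" by (simp add: f_def lookup_kos)
    then have "lookup (kos n h \<sigma>) m \<noteq> 0" using h by simp
    then obtain j m' where j: "j \<in> {1..n}" "j \<notin> \<sigma>" "lookup (h (insert j \<sigma>)) m' \<noteq> 0"
      "m + ind \<sigma> = m' + ind (insert j \<sigma>)" using lookup_kos_nonzero by metis
    then have m': "m = m' + single j 1" using fin by (simp add: ind_insert add.assoc[symmetric])
    have "keys m' \<in> J" using h j unfolding supp_in_def by blast
    \<comment> \<open>Since m is squarefree, dividing by x_j removes j from the support
      altogether.\<close>
    moreover have "lookup m' j = 0" "j \<in> set xs" "keys m' \<subseteq> set xs"
    proof -
      have "lookup m x = lookup m' x + (if x = j then 1 else 0)" for x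
        using m' by (simp add: lookup_add lookup_single when_def)
      then have *: "of_bool (x \<in> set xs) = lookup m' x + (if x = j then 1 else 0)" for x
        by (simp add: m_def lookup_ind)
      show "lookup m' j = 0" "j \<in> set xs" using *[of j] by (auto simp: of_bool_def split: if_splits)
      show "keys m' \<subseteq> set xs"
      proof
        fix x assume "x \<in> keys m'"
        then show "x \<in> set xs" using *[of x] by (auto simp: in_keys_iff of_bool_def split: if_splits)
      qed
    qed
    ultimately show False using gens_minimal[OF xs(1), of "keys m'"] by (auto simp: in_keys_iff)
  qed
  moreover have "kos n f = 0" using kos_kos[OF ke] by (simp add: f_def)
  ultimately show ?thesis using kf Jf unfolding D_def by blast
qed

section \<open>Double complexes\<close>

text \<open>
  Row \<open>0\<close> and column \<open>0\<close> are the two augmentations; only the rows \<open>q \<ge> 1\<close> and the columns \<open>p \<ge> 1\<close> are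
  exact. The condition \<open>exact_at\<close> interpolates along an antidiagonal between exactness of column \<open>0\<close>
  and exactness of row \<open>0\<close>.
\<close>

locale double_complex =
  fixes A :: "nat \<Rightarrow> nat \<Rightarrow> 'a::ab_group_add set" and dh dv :: "nat \<Rightarrow> nat \<Rightarrow> 'a \<Rightarrow> 'a"
  assumes A_diff: "x \<in> A p q \<Longrightarrow> y \<in> A p q \<Longrightarrow> x - y \<in> A p q"
    and dh_A: "x \<in> A (Suc p) q \<Longrightarrow> dh p q x \<in> A p q"
    and dv_A: "x \<in> A p (Suc q) \<Longrightarrow> dv p q x \<in> A p q"
    and dh_diff: "dh p q (x - y) = dh p q x - dh p q y"
    and dv_diff: "dv p q (x - y) = dv p q x - dv p q y"
    and dh_dh: "x \<in> A (Suc (Suc p)) q \<Longrightarrow> dh p q (dh (Suc p) q x) = 0"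
    and dv_dv: "x \<in> A p (Suc (Suc q)) \<Longrightarrow> dv p q (dv p (Suc q) x) = 0"
    and comm: "x \<in> A (Suc p) (Suc q) \<Longrightarrow> dh p q (dv (Suc p) q x) = dv p q (dh p (Suc q) x)"
    and row: "x \<in> A p (Suc q) \<Longrightarrow> (\<And>p'. p = Suc p' \<Longrightarrow> dh p' (Suc q) x = 0) \<Longrightarrow>
      \<exists>y\<in>A (Suc p) (Suc q). dh p (Suc q) y = x"
    and col: "x \<in> A (Suc p) q \<Longrightarrow> (\<And>q'. q = Suc q' \<Longrightarrow> dv (Suc p) q' x = 0) \<Longrightarrow>
      \<exists>y\<in>A (Suc p) (Suc q). dv (Suc p) q y = x"
begin

text \<open>For p = 0 the next row maps onto column 0, so the composite has the same image as
  \<open>dv\<close> alone and the condition is exactness of column 0 at q; for q = 0 it is likewise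
  exactness of row 0. At the edges the kernel conditions are vacuous.\<close>

definition exact_at :: "nat \<Rightarrow> nat \<Rightarrow> bool" where
  "exact_at p q \<longleftrightarrow> (\<forall>b\<in>A p q. (\<forall>p'. p = Suc p' \<longrightarrow> dh p' q b = 0) \<longrightarrow>
     (\<forall>q'. q = Suc q' \<longrightarrow> dv p q' b = 0) \<longrightarrow> (\<exists>c\<in>A (Suc p) (Suc q). b = dh p q (dv (Suc p) q c)))"

text \<open>A zigzag: lift b along the column to a, write the image of a under \<open>dh\<close> as
  a composite by hypothesis, and correct a accordingly. The corrected lift is killed by
  \<open>dh\<close>, so it comes from the row, and commutativity finishes.\<close>

lemma exact_at_step:
  assumes "exact_at p (Suc q)"
  shows "exact_at (Suc p) q"
  unfolding exact_at_def
proof (intro ballI impI)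
  fix b assume b: "b \<in> A (Suc p) q" "\<forall>p'. Suc p = Suc p' \<longrightarrow> dh p' q b = 0"
    "\<forall>q'. q = Suc q' \<longrightarrow> dv (Suc p) q' b = 0"
  obtain a where a: "a \<in> A (Suc p) (Suc q)" "dv (Suc p) q a = b"
    using col[OF b(1)] b(3) by blast
  have "dh p (Suc q) a \<in> A p (Suc q)" using dh_A a by blast
  moreover have "dh p' (Suc q) (dh p (Suc q) a) = 0" if "p = Suc p'" for p'
    using dh_dh a that by blast
  moreover have "dv p q (dh p (Suc q) a) = 0"
    using comm[OF a(1)] a b by simp
  ultimately obtain c where c: "c \<in> A (Suc p) (Suc (Suc q))"
    "dh p (Suc q) a = dh p (Suc q) (dv (Suc p) (Suc q) c)"
    using assms unfolding exact_at_def by fastforce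
  have "a - dv (Suc p) (Suc q) c \<in> A (Suc p) (Suc q)" using A_diff a dv_A c by blast
  moreover have "dh p (Suc q) (a - dv (Suc p) (Suc q) c) = 0" using c by (simp add: dh_diff)
  ultimately obtain e where e: "e \<in> A (Suc (Suc p)) (Suc q)"
    "dh (Suc p) (Suc q) e = a - dv (Suc p) (Suc q) c"
    using row[of _ "Suc p" q] by blast
  have "b = dv (Suc p) q (a - dv (Suc p) (Suc q) c)"
    using a dv_dv[OF c(1)] by (simp add: dv_diff)
  also have "\<dots> = dh (Suc p) q (dv (Suc (Suc p)) q e)"
    using comm[OF e(1)] e by simp
  finally show "\<exists>c\<in>A (Suc (Suc p)) (Suc q). b = dh (Suc p) q (dv (Suc (Suc p)) q c)"
    using e by blast
qed

lemma exact_at_diagonal: "exact_at p q \<Longrightarrow> r \<le> q \<Longrightarrow> exact_at (p + r) (q - r)"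
proof (induction r)
  case (Suc r)
  then have "exact_at (p + r) (Suc (q - Suc r))" by (simp add: Suc_diff_Suc)
  then show ?case using exact_at_step by simp
qed simp

lemma transpose: "double_complex (\<lambda>p q. A q p) (\<lambda>p q. dv q p) (\<lambda>p q. dh q p)"
  by standard (use A_diff dh_A dv_A dh_diff dv_diff dh_dh dv_dv comm row col in auto)

lemma exact_at_iff: "exact_at 0 i \<longleftrightarrow> exact_at i 0"
proof
  assume "exact_at 0 i"
  then show "exact_at i 0" using exact_at_diagonal[of 0 i i] by simp
next
  \<comment> \<open>Moving back along the antidiagonal is the same chase in the transposed
    complex.\<close>
  interpret T: double_complex "\<lambda>p q. A q p" "\<lambda>p q. dv q p" "\<lambda>p q. dh q p" by (rule transpose)
  have "(\<exists>c\<in>A (Suc q) (Suc p). b = dv q p (dh q (Suc p) c)) \<longleftrightarrow>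
      (\<exists>c\<in>A (Suc q) (Suc p). b = dh q p (dv (Suc q) p c))" for p q b
    using comm by (intro bex_cong) simp_all
  then have T: "T.exact_at p q \<longleftrightarrow> exact_at q p" for p q
    unfolding T.exact_at_def exact_at_def by blast
  assume "exact_at i 0"
  then show "exact_at 0 i" using T.exact_at_diagonal[of 0 i i] by (simp add: T)
qed

end

section \<open>Restriction of polynomials to sets of monomials\<close>

definition restr :: "(expo \<Rightarrow> bool) \<Rightarrow> 'k::comm_ring_1 mpoly \<Rightarrow> 'k mpoly" where
  "restr P f = Poly_Mapping.mapp (\<lambda>m c. c when P m) f"

lemma lookup_restr: "lookup (restr P f) m = (if P m then lookup f m else 0)"
  by (auto simp: restr_def lookup_mapp when_def in_keys_iff)

lemma restr_zero [simp]: "restr P 0 = 0"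
  by (rule poly_mapping_eqI) (simp add: lookup_restr)

lemma restr_add: "restr P (f + g) = restr P f + restr P g"
  by (rule poly_mapping_eqI) (simp add: lookup_add lookup_restr)

lemma restr_sum: "restr P (sum f B) = (\<Sum>b\<in>B. restr P (f b))"
  by (rule poly_mapping_eqI) (simp add: lookup_restr lookup_sum)

lemma restr_ident: "(\<And>m. m \<in> keys f \<Longrightarrow> P m) \<Longrightarrow> restr P f = f"
  by (rule poly_mapping_eqI) (auto simp: lookup_restr in_keys_iff)

lemma restr_polys: "f \<in> polys n \<Longrightarrow> restr P f \<in> polys n"
proof -
  have "keys (restr P f) \<subseteq> keys f" by (auto simp: in_keys_iff lookup_restr split: if_splits)
  then show "f \<in> polys n \<Longrightarrow> ?thesis" unfolding polys_def by blast
qed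

text \<open>For homogeneous g, the part of a product in one degree comes from one degree of the left
  factor; P and Q stand for these two degrees.\<close>

lemma restr_mult:
  assumes "\<And>m l. l \<in> keys g \<Longrightarrow> P (m + l) \<longleftrightarrow> Q m"
  shows "restr P (f * g) = restr Q f * g"
proof -
  have "f = restr Q f + restr (\<lambda>m. \<not> Q m) f"
    by (rule poly_mapping_eqI) (simp add: lookup_add lookup_restr)
  then have split: "f * g = restr Q f * g + restr (\<lambda>m. \<not> Q m) f * g"
    by (metis distrib_right)
  moreover have "restr P (restr Q f * g) = restr Q f * g"
  proof (rule restr_ident)
    fix m assume "m \<in> keys (restr Q f * g)"
    then obtain a b where "m = a + b" "a \<in> keys (restr Q f)" "b \<in> keys g"
      using keys_mult by blast
    then show "P m" using assms by (auto simp: in_keys_iff lookup_restr split: if_splits)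
  qed
  moreover have "restr P (restr (\<lambda>m. \<not> Q m) f * g) = 0"
  proof (rule poly_mapping_eqI)
    fix m
    show "lookup (restr P (restr (\<lambda>m. \<not> Q m) f * g)) m = lookup 0 m"
    proof (rule ccontr)
      assume "\<not> ?thesis"
      then have m: "P m" "m \<in> keys (restr (\<lambda>m. \<not> Q m) f * g)"
        by (auto simp: lookup_restr in_keys_iff split: if_splits)
      obtain a b where "m = a + b" "a \<in> keys (restr (\<lambda>m. \<not> Q m) f)" "b \<in> keys g"
        using keys_mult m(2) by blast
      then show False using assms m(1) by (auto simp: in_keys_iff lookup_restr split: if_splits)
    qed
  qed
  ultimately show ?thesis by (subst split) (simp add: restr_add)
qed

text \<open>A factor without constant term contributes none to the product, so g is split into its
  constant term and the rest.\<close>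

lemma lookup_mult_0: "lookup (f * g :: 'k::comm_ring_1 mpoly) 0 = lookup f 0 * lookup g 0"
proof -
  have k: "restr (\<lambda>m. m = 0) h = single 0 (lookup h 0)" for h :: "'k mpoly"
    by (rule poly_mapping_eqI) (auto simp: lookup_restr lookup_single when_def)
  have sum0: "m + l = 0 \<longleftrightarrow> m = 0 \<and> l = 0" for m l :: expo
    by (auto simp: poly_mapping_eq_iff lookup_add fun_eq_iff)
  define g' where "g' = g - single 0 (lookup g 0)"
  have "restr (\<lambda>m. m = 0) (f * g') = restr (\<lambda>_. False) f * g'"
    by (rule restr_mult) (auto simp: sum0 g'_def in_keys_iff lookup_minus)
  also have "restr (\<lambda>_. False) f = 0" by (rule poly_mapping_eqI) (simp add: lookup_restr)
  finally have "lookup (f * g') 0 = 0" by (simp add: k) (metis lookup_single_eq lookup_zero)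
  moreover have "f * g = f * g' + single 0 (lookup g 0) * f"
    by (simp add: g'_def algebra_simps)
  moreover have "edvd 0 0" "(0::expo) - 0 = 0" by (simp_all add: edvd_def)
  ultimately show ?thesis by (simp add: lookup_add lookup_single_mult)
qed

section \<open>Comparison of a resolution with the Koszul complex\<close>

locale resolution = stable_family n t J for n t J +
  fixes I :: "'k::field mpoly set" and F :: "'k free_complex"
  assumes gfr: "graded_free_resolution n I F"
    and I_eq: "I = {f \<in> polys n. \<forall>m\<in>keys f. keys m \<in> J}"
begin

section \<open>The axioms of the resolution and its homogeneous parts\<close>

lemma finite_basis [simp]: "finite (basis F i)"
  and aug_I: "p \<in> basis F 0 \<Longrightarrow> aug F p \<in> I"
  and aug_deg: "p \<in> basis F 0 \<Longrightarrow> m \<in> keys (aug F p) \<Longrightarrow> total_deg m = shift F 0 p"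
  and diff_polys: "p \<in> basis F (Suc i) \<Longrightarrow> q \<in> basis F i \<Longrightarrow> diff F (Suc i) p q \<in> polys n"
  and diff_deg: "p \<in> basis F (Suc i) \<Longrightarrow> q \<in> basis F i \<Longrightarrow> m \<in> keys (diff F (Suc i) p q) \<Longrightarrow>
    total_deg m + shift F i q = shift F (Suc i) p"
  and aug_surj: "aug_map F ` free_mod n F 0 = I"
  and exact_0: "{v \<in> free_mod n F 0. aug_map F v = 0} = diff_map F (Suc 0) ` free_mod n F (Suc 0)"
  and exact_Suc: "{v \<in> free_mod n F (Suc i). diff_map F (Suc i) v = 0} =
    diff_map F (Suc (Suc i)) ` free_mod n F (Suc (Suc i))"
  using gfr by (auto simp: graded_free_resolution_def homogeneous_def One_nat_def)

text \<open>The part in internal degree D once q Koszul generators, each of degree 1, are attached.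
  Cutting commutes with the graded maps of the resolution, so preimages can be made
  homogeneous.\<close>

definition trunc :: "nat \<Rightarrow> nat \<Rightarrow> nat \<Rightarrow> (nat \<Rightarrow> 'k mpoly) \<Rightarrow> nat \<Rightarrow> 'k mpoly" where
  "trunc p q D v b = restr (\<lambda>m. total_deg m + q + shift F p b = D) (v b)"

lemma diff_map_trunc:
  "diff_map F (Suc p) (trunc (Suc p) q D v) c = trunc p q D (diff_map F (Suc p) v) c"
proof (cases "c \<in> basis F p")
  case True
  have "restr (\<lambda>m. total_deg m + q + shift F p c = D) (v b * diff F (Suc p) b c) =
      restr (\<lambda>m. total_deg m + q + shift F (Suc p) b = D) (v b) * diff F (Suc p) b c"
    if "b \<in> basis F (Suc p)" for b
    by (rule restr_mult) (use diff_deg[OF that True] in force)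
  then show ?thesis using True by (simp add: diff_map_def trunc_def restr_sum)
qed (simp add: diff_map_def trunc_def)

lemma aug_map_trunc:
  "aug_map F (trunc 0 q D v) = restr (\<lambda>m. total_deg m + q = D) (aug_map F v)"
proof -
  have "restr (\<lambda>m. total_deg m + q = D) (v b * aug F b) =
      restr (\<lambda>m. total_deg m + q + shift F 0 b = D) (v b) * aug F b"
    if "b \<in> basis F 0" for b
    by (rule restr_mult) (use aug_deg[OF that] in force)
  then show ?thesis by (simp add: aug_map_def trunc_def restr_sum)
qed

lemma trunc_free_mod: "v \<in> free_mod n F p \<Longrightarrow> trunc p q D v \<in> free_mod n F p"
  by (simp add: free_mod_def trunc_def restr_polys)

lemma lookup_diff_map_0:
  "lookup (diff_map F i v c) 0 = tens_map F i (\<lambda>b. lookup (v b) 0) c"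
  by (simp add: diff_map_def tens_map_def lookup_sum lookup_mult_0)

text \<open>Degree D of the resolution tensored with the Koszul complex, shifted by one in both
  directions to make room for the augmentations. Column 0 is the Koszul complex over I, kept in the
  slot b = 0; row 0 is the resolution tensored with K, kept as constants at the empty face.\<close>

definition cplx :: "nat \<Rightarrow> nat \<Rightarrow> nat \<Rightarrow> (nat \<Rightarrow> nat set \<Rightarrow> 'k mpoly) set" where
  "cplx D P Q = (case P of
      0 \<Rightarrow> (case Q of
          0 \<Rightarrow> {0}
        | Suc q \<Rightarrow> {x. (\<forall>b. b \<noteq> 0 \<longrightarrow> x b = 0) \<and> kchain n 0 D q (x 0) \<and> supp_in J (x 0)})
    | Suc p \<Rightarrow> (case Q of
          0 \<Rightarrow> {x. \<forall>b \<sigma> m. lookup (x b \<sigma>) m \<noteq> 0 \<longrightarrow> \<sigma> = {} \<and> m = 0 \<and> b \<in> basis F p \<and> shift F p b = D}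
        | Suc q \<Rightarrow> {x. \<forall>b. (b \<notin> basis F p \<longrightarrow> x b = 0) \<and> kchain n (shift F p b) D q (x b)}))"

definition dhor :: "nat \<Rightarrow> nat \<Rightarrow> (nat \<Rightarrow> nat set \<Rightarrow> 'k mpoly) \<Rightarrow> nat \<Rightarrow> nat set \<Rightarrow> 'k mpoly" where
  "dhor P Q x = (\<lambda>c \<sigma>. case Q of
      0 \<Rightarrow> (case P of 0 \<Rightarrow> 0 | Suc p \<Rightarrow> single 0 (tens_map F (Suc p) (\<lambda>b. lookup (x b \<sigma>) 0) c))
    | Suc q \<Rightarrow> (case P of 0 \<Rightarrow> if c = 0 then aug_map F (\<lambda>b. x b \<sigma>) else 0
        | Suc p \<Rightarrow> diff_map F (Suc p) (\<lambda>b. x b \<sigma>) c))"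

definition dver :: "nat \<Rightarrow> nat \<Rightarrow> (nat \<Rightarrow> nat set \<Rightarrow> 'k mpoly) \<Rightarrow> nat \<Rightarrow> nat set \<Rightarrow> 'k mpoly" where
  "dver P Q x = (\<lambda>b \<sigma>. case Q of
      0 \<Rightarrow> (case P of 0 \<Rightarrow> 0 | Suc p \<Rightarrow> if \<sigma> = {} then single 0 (lookup (x b {}) 0) else 0)
    | Suc q \<Rightarrow> kos n (x b) \<sigma>)"

lemma dver_Suc: "dver P (Suc q) x b = kos n (x b)"
  by (rule ext) (simp add: dver_def)

lemma cplx_0_Suc: "x \<in> cplx D 0 (Suc q) \<longleftrightarrow>
    (\<forall>b. b \<noteq> 0 \<longrightarrow> x b = 0) \<and> kchain n 0 D q (x 0) \<and> supp_in J (x 0)"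
  and cplx_Suc_0: "x \<in> cplx D (Suc p) 0 \<longleftrightarrow> (\<forall>b \<sigma> m. lookup (x b \<sigma>) m \<noteq> 0 \<longrightarrow>
    \<sigma> = {} \<and> m = 0 \<and> b \<in> basis F p \<and> shift F p b = D)"
  and cplx_Suc_Suc: "x \<in> cplx D (Suc p) (Suc q) \<longleftrightarrow>
    (\<forall>b. (b \<notin> basis F p \<longrightarrow> x b = 0) \<and> kchain n (shift F p b) D q (x b))"
  and cplx_0_0: "x \<in> cplx D 0 0 \<longleftrightarrow> x = 0"
  by (auto simp: cplx_def)

lemma cplx_0_Suc_I: "x \<in> cplx D 0 (Suc q) \<Longrightarrow> x 0 \<sigma> \<in> I"
  unfolding I_eq polys_def cplx_0_Suc kchain_def supp_in_def by (auto simp: in_keys_iff)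

lemma cplx_free_mod: "x \<in> cplx D (Suc p) (Suc q) \<Longrightarrow> (\<lambda>b. x b \<sigma>) \<in> free_mod n F p"
  unfolding cplx_Suc_Suc free_mod_def polys_def kchain_def by (auto simp: in_keys_iff)

lemma cplx_Suc_SucD:
  "x \<in> cplx D (Suc p) (Suc q) \<Longrightarrow> lookup (x b \<sigma>) m \<noteq> 0 \<Longrightarrow>
    b \<in> basis F p \<and> \<sigma> \<subseteq> {1..n} \<and> card \<sigma> = q \<and> keys m \<subseteq> {1..n} \<and> total_deg m + q + shift F p b = D"
  unfolding cplx_Suc_Suc kchain_def by (metis lookup_zero zero_fun_apply)

lemma dhor_cplx:
  assumes "x \<in> cplx D (Suc P) Q"
  shows "dhor P Q x \<in> cplx D P Q"
proof (cases Q)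
  case 0
  show ?thesis
  proof (cases P)
    case (Suc p)
    have "\<sigma> = {} \<and> m = 0 \<and> c \<in> basis F p \<and> shift F p c = D"
      if "lookup (dhor P Q x c \<sigma>) m \<noteq> 0" for c \<sigma> m
    proof -
      have m: "m = 0" "tens_map F (Suc p) (\<lambda>b. lookup (x b \<sigma>) 0) c \<noteq> 0"
        using that Suc 0 by (auto simp: dhor_def lookup_single when_def split: if_splits)
      then have c: "c \<in> basis F p" by (auto simp: tens_map_def split: if_splits)
      then have "(\<Sum>b\<in>basis F (Suc p). lookup (x b \<sigma>) 0 * lookup (diff F (Suc p) b c) 0) \<noteq> 0"
        using m(2) by (simp add: tens_map_def)
      then obtain b where b: "b \<in> basis F (Suc p)" "lookup (x b \<sigma>) 0 \<noteq> 0"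
        "lookup (diff F (Suc p) b c) 0 \<noteq> 0"
        by (elim sum.not_neutral_contains_not_neutral) auto
      then show ?thesis
        using assms Suc 0 m c diff_deg[OF b(1) c, of 0] unfolding cplx_Suc_0
        by (auto simp: cplx_Suc_0 in_keys_iff)
    qed
    then show ?thesis by (simp only: Suc 0 cplx_Suc_0) blast
  qed (simp add: 0 cplx_0_0 dhor_def zero_fun_def)
next
  case (Suc q)
  note x = cplx_Suc_SucD[OF assms[unfolded Suc]]
  show ?thesis
  proof (cases P)
    case 0
    have "\<sigma> \<subseteq> {1..n} \<and> card \<sigma> = q \<and> keys m \<subseteq> {1..n} \<and> total_deg m + q + 0 = D \<and> keys m \<in> J"
      if "lookup (dhor P Q x 0 \<sigma>) m \<noteq> 0" for \<sigma> m
    proof -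
      have "lookup (aug_map F (\<lambda>b. x b \<sigma>)) m \<noteq> 0" using that Suc 0 by (simp add: dhor_def)
      then obtain b where b: "b \<in> basis F 0" "m \<in> keys (x b \<sigma> * aug F b)"
        unfolding aug_map_def in_keys_iff by (auto simp: lookup_sum elim: sum.not_neutral_contains_not_neutral split: if_splits)
      then obtain m1 m2 where m: "m = m1 + m2" "m1 \<in> keys (x b \<sigma>)" "m2 \<in> keys (aug F b)"
        using keys_mult by blast
      have J: "keys m2 \<in> J" using aug_I[OF b(1)] m by (auto simp: I_eq)
      then have m2: "total_deg m2 = shift F 0 b" "keys m2 \<subseteq> {1..n}"
        using aug_deg[OF b(1) m(3)] J_sub by auto
      have "keys m \<subseteq> {1..n}" using x[of b \<sigma> m1] m m2 by (auto simp: in_keys_iff keys_add_expo)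
      moreover from this have "keys m \<in> J" using J_up[OF J] m(1) by (simp add: keys_add_expo)
      ultimately show ?thesis using x[of b \<sigma> m1] m m2 0 by (auto simp: in_keys_iff)
    qed
    then have "kchain n 0 D q (dhor P Q x 0)" "supp_in J (dhor P Q x 0)"
      unfolding kchain_def supp_in_def by blast+
    then show ?thesis by (simp add: 0 Suc cplx_0_Suc) (simp add: dhor_def zero_fun_def)
  next
    case P: (Suc p)
    have "\<sigma> \<subseteq> {1..n} \<and> card \<sigma> = q \<and> keys m \<subseteq> {1..n} \<and> total_deg m + q + shift F p c = D"
      if l: "lookup (dhor P Q x c \<sigma>) m \<noteq> 0" for c \<sigma> m
    proof -
      have "lookup (diff_map F (Suc p) (\<lambda>b. x b \<sigma>) c) m \<noteq> 0" using l Suc P by (simp add: dhor_def)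
      moreover from this have c: "c \<in> basis F p" by (auto simp: diff_map_def split: if_splits)
      ultimately obtain b where b: "b \<in> basis F (Suc p)" "m \<in> keys (x b \<sigma> * diff F (Suc p) b c)"
        unfolding diff_map_def in_keys_iff by (auto simp: lookup_sum elim: sum.not_neutral_contains_not_neutral split: if_splits)
      then obtain m1 m2 where m: "m = m1 + m2" "m1 \<in> keys (x b \<sigma>)" "m2 \<in> keys (diff F (Suc p) b c)"
        using keys_mult by blast
      have "keys m2 \<subseteq> {1..n}" using diff_polys[OF b(1) c] m by (auto simp: polys_def)
      then show ?thesis
        using diff_deg[OF b(1) c m(3)] x[of b \<sigma> m1] m P by (auto simp: in_keys_iff keys_add_expo)
    qed
    then have "kchain n (shift F p c) D q (dhor P Q x c)" for c
      unfolding kchain_def by blast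
    then show ?thesis by (simp add: P Suc cplx_Suc_Suc) (simp add: dhor_def diff_map_def zero_fun_def)
  qed
qed

lemma dver_cplx:
  assumes "x \<in> cplx D P (Suc Q)"
  shows "dver P Q x \<in> cplx D P Q"
proof (cases Q)
  case 0
  show ?thesis
  proof (cases P)
    case (Suc p)
    have "\<sigma> = {} \<and> m = 0 \<and> b \<in> basis F p \<and> shift F p b = D"
      if l: "lookup (dver P Q x b \<sigma>) m \<noteq> 0" for b \<sigma> m
    proof -
      have "\<sigma> = {}" "m = 0" "lookup (x b {}) 0 \<noteq> 0"
        using l by (auto simp: Suc 0 dver_def lookup_single when_def split: if_splits)
      then show ?thesis using cplx_Suc_SucD[OF assms[unfolded Suc 0], of b "{}" 0] by simp
    qed
    then show ?thesis unfolding Suc 0 cplx_Suc_0 by blast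
  qed (simp add: 0 cplx_0_0 dver_def zero_fun_def)
next
  case (Suc q)
  show ?thesis
  proof (cases P)
    case 0
    then show ?thesis using assms kchain_kos[of n 0 D q "x 0"] supp_in_kos[of n 0 D q "x 0" J] J_up
      by (auto simp: 0 Suc cplx_0_Suc dver_Suc)
  next
    case (Suc p)
    then have "kchain n (shift F p b) D q (kos n (x b))" for b
      using assms \<open>Q = Suc q\<close> by (intro kchain_kos) (simp add: cplx_Suc_Suc)
    then show ?thesis using assms Suc \<open>Q = Suc q\<close> by (simp add: cplx_Suc_Suc dver_Suc)
  qed
qed

lemma dhor_diff: "dhor P Q (x - y) = dhor P Q x - dhor P Q y"
  by (intro ext) (simp add: dhor_def diff_map_def aug_map_def tens_map_def lookup_minus
      sum_subtractf left_diff_distrib single_diff split: nat.split)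

lemma dver_diff: "dver P Q (x - y) = dver P Q x - dver P Q y"
  by (intro ext) (simp add: dver_def kos_diff lookup_minus single_diff split: nat.split)

lemma cplx_diff:
  assumes "x \<in> cplx D P Q" "y \<in> cplx D P Q"
  shows "x - y \<in> cplx D P Q"
proof (cases P; cases Q)
  fix p assume "P = Suc p" "Q = 0"
  then show ?thesis using assms unfolding cplx_Suc_0
    by (simp add: cplx_Suc_0 lookup_minus) (metis diff_zero)
qed (use assms in \<open>auto simp: cplx_0_0 cplx_0_Suc cplx_Suc_Suc kchain_diff supp_in_diff\<close>)

text \<open>Scalars are lifted to constant polynomials, where the composite vanishes by exactness;
  taking constant terms is multiplicative.\<close>

lemma tens_map_tens_map: "tens_map F (Suc p) (tens_map F (Suc (Suc p)) u) c = 0"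
  if "\<And>b. b \<notin> basis F (Suc (Suc p)) \<Longrightarrow> u b = 0"
proof -
  define v where "v b = (single 0 (u b) :: 'k mpoly)" for b
  have "v \<in> free_mod n F (Suc (Suc p))"
    using that by (auto simp: free_mod_def polys_def v_def)
  then have "diff_map F (Suc p) (diff_map F (Suc (Suc p)) v) = 0"
    using exact_Suc[of p] by blast
  then have "lookup (diff_map F (Suc p) (diff_map F (Suc (Suc p)) v) c) 0 = 0" by simp
  then show ?thesis by (simp add: lookup_diff_map_0) (simp add: v_def)
qed

lemma double_complex: "double_complex (cplx D) dhor dver"
proof
  fix x P Q
  show "dhor P Q (dhor (Suc P) Q x) = 0" if x: "x \<in> cplx D (Suc (Suc P)) Q"
  proof (intro ext)
    fix c \<sigma>
    show "dhor P Q (dhor (Suc P) Q x) c \<sigma> = 0 c \<sigma>"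
    proof (cases Q)
      case 0
      have "tens_map F (Suc p) (tens_map F (Suc (Suc p)) (\<lambda>b. lookup (x b \<sigma>) 0)) c = 0"
        if "P = Suc p" for p
        using x that 0 by (intro tens_map_tens_map) (auto simp: cplx_Suc_0)
      then show ?thesis by (simp add: dhor_def 0 split: nat.split)
    next
      case (Suc q)
      have v: "(\<lambda>b. x b \<sigma>) \<in> free_mod n F (Suc P)" using cplx_free_mod x Suc by blast
      have "aug_map F (diff_map F (Suc 0) (\<lambda>b. x b \<sigma>)) = 0" if "P = 0"
        using exact_0 v that by blast
      moreover have "diff_map F (Suc p) (diff_map F (Suc (Suc p)) (\<lambda>b. x b \<sigma>)) = 0" if "P = Suc p" for p
        using exact_Suc[of p] v that by blast
      ultimately show ?thesis by (simp add: dhor_def Suc split: nat.split)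
    qed
  qed
  show "dver P Q (dver P (Suc Q) x) = 0" if x: "x \<in> cplx D P (Suc (Suc Q))"
  proof (intro ext)
    fix b \<sigma>
    have "\<exists>s. kchain n s D (Suc Q) (x b)"
    proof (cases P)
      case 0
      then show ?thesis using x by (cases "b = 0") (auto simp: cplx_0_Suc)
    next
      case (Suc p)
      then show ?thesis using x by (auto simp: cplx_Suc_Suc)
    qed
    then have "kos n (kos n (x b)) = 0" using kos_kos by blast
    then show "dver P Q (dver P (Suc Q) x) b \<sigma> = 0 b \<sigma>"
      by (cases Q) (simp_all add: dver_Suc dver_def[of _ 0] lookup_kos_0 split: nat.split)
  qed
  show "dhor P Q (dver (Suc P) Q x) = dver P Q (dhor P (Suc Q) x)"
  proof (intro ext)
    fix c \<sigma>
    show "dhor P Q (dver (Suc P) Q x) c \<sigma> = dver P Q (dhor P (Suc Q) x) c \<sigma>"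
    proof (cases Q)
      case 0
      have "tens_map F (Suc p) (\<lambda>b. 0) c = 0" for p
        by (simp add: tens_map_def)
      then show ?thesis
        by (cases P; cases "\<sigma> = {}") (simp_all add: dhor_def dver_def 0 lookup_diff_map_0)
    next
      case (Suc q)
      show ?thesis
      proof (cases P)
        case 0
        have "dhor 0 (Suc (Suc q)) x c = (if c = 0 then (\<lambda>\<sigma>. \<Sum>b\<in>basis F 0. x b \<sigma> * aug F b) else 0)"
          by (rule ext) (simp add: dhor_def aug_map_def)
        then show ?thesis
          by (simp add: 0 Suc dver_def kos_lincomb) (simp add: dhor_def aug_map_def)
      next
        case P: (Suc p)
        have "dhor (Suc p) (Suc (Suc q)) x c = (if c \<in> basis F p then
            (\<lambda>\<sigma>. \<Sum>b\<in>basis F (Suc p). x b \<sigma> * diff F (Suc p) b c) else 0)"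
          by (rule ext) (simp add: dhor_def diff_map_def)
        then show ?thesis
          by (simp add: P Suc dver_def kos_lincomb) (simp add: dhor_def diff_map_def)
      qed
    qed
  qed
  \<comment> \<open>Row exactness: such a row is a direct sum, over the faces with Q elements, of
    copies of the augmented resolution, so preimages are found for each face and then cut to degree
    D.\<close>
  show "\<exists>y\<in>cplx D (Suc P) (Suc Q). dhor P (Suc Q) y = x"
    if x: "x \<in> cplx D P (Suc Q)" and z: "\<And>p'. P = Suc p' \<Longrightarrow> dhor p' (Suc Q) x = 0"
  proof -
    have "\<exists>w. w \<in> free_mod n F P \<and> (\<forall>b m. lookup (w b) m \<noteq> 0 \<longrightarrow> \<sigma> \<subseteq> {1..n} \<and> card \<sigma> = Q \<and>
        total_deg m + Q + shift F P b = D) \<and> (\<forall>c. dhor P (Suc Q) (\<lambda>b _. w b) c \<sigma> = x c \<sigma>)" for \<sigma>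
    \<comment> \<open>Where x vanishes the preimage 0 is taken; this keeps y supported on faces of
      the right size.\<close>
    proof (cases "\<forall>c. x c \<sigma> = 0")
      case True
      then show ?thesis
        by (intro exI[of _ 0])
          (simp add: free_mod_def polys_def dhor_def aug_map_def diff_map_def split: nat.split)
    next
      case False
      have "\<exists>w. w \<in> free_mod n F P \<and> (\<forall>c. dhor P (Suc Q) (\<lambda>b _. trunc P Q D w b) c \<sigma> = x c \<sigma>)
          \<and> \<sigma> \<subseteq> {1..n} \<and> card \<sigma> = Q"
      proof (cases P)
        case 0
        obtain w where w: "w \<in> free_mod n F 0" "aug_map F w = x 0 \<sigma>"
          using aug_surj cplx_0_Suc_I[of x D Q \<sigma>] x 0 by (metis imageE)
        have x0: "x c = 0" if "c \<noteq> 0" for c using that x 0 by (simp add: cplx_0_Suc)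
        have k: "kchain n 0 D Q (x 0)" using x 0 by (simp add: cplx_0_Suc)
        obtain m where "lookup (x 0 \<sigma>) m \<noteq> 0" using False x0
          by (metis lookup_zero poly_mapping_eqI zero_fun_apply)
        note kD = kchainD[OF k this]
        have "restr (\<lambda>m. total_deg m + Q = D) (x 0 \<sigma>) = x 0 \<sigma>"
          by (rule restr_ident) (use kchainD(5)[OF k] in \<open>auto simp: in_keys_iff\<close>)
        then have "\<forall>c. dhor P (Suc Q) (\<lambda>b _. trunc P Q D w b) c \<sigma> = x c \<sigma>"
          using x0 w by (simp add: dhor_def 0 aug_map_trunc)
        then show ?thesis using w kD 0 by blast
      next
        case (Suc p)
        have "\<exists>w\<in>free_mod n F (Suc p). diff_map F (Suc p) w = (\<lambda>b. x b \<sigma>)"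
        proof (cases p)
          case 0
          have "aug_map F (\<lambda>b. x b \<sigma>) = dhor 0 (Suc Q) x 0 \<sigma>" by (simp add: dhor_def)
          also have "\<dots> = 0" using z[of 0] Suc 0 by simp
          finally have "(\<lambda>b. x b \<sigma>) \<in> {v \<in> free_mod n F 0. aug_map F v = 0}"
            using cplx_free_mod[OF x[unfolded Suc]] 0 by blast
          then show ?thesis unfolding exact_0 0 by force
        next
          case p: (Suc p')
          have "diff_map F (Suc p') (\<lambda>b. x b \<sigma>) = (\<lambda>c. dhor (Suc p') (Suc Q) x c \<sigma>)"
            by (simp add: dhor_def)
          also have "\<dots> = 0" using z[of "Suc p'"] Suc p by auto
          finally have "(\<lambda>b. x b \<sigma>) \<in> {v \<in> free_mod n F (Suc p'). diff_map F (Suc p') v = 0}"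
            using cplx_free_mod[OF x[unfolded Suc]] p by blast
          then show ?thesis unfolding exact_Suc p by force
        qed
        then obtain w where w: "w \<in> free_mod n F (Suc p)" "diff_map F (Suc p) w = (\<lambda>b. x b \<sigma>)" by blast
        note xD = cplx_Suc_SucD[OF x[unfolded Suc]]
        obtain b m where "lookup (x b \<sigma>) m \<noteq> 0" using False
          by (metis lookup_zero poly_mapping_eqI)
        then have s: "\<sigma> \<subseteq> {1..n} \<and> card \<sigma> = Q" using xD by blast
        have "trunc p Q D (\<lambda>b. x b \<sigma>) c = x c \<sigma>" for c
          unfolding trunc_def by (rule restr_ident) (use xD in \<open>auto simp: in_keys_iff\<close>)
        then have "\<forall>c. dhor P (Suc Q) (\<lambda>b _. trunc P Q D w b) c \<sigma> = x c \<sigma>"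
          using w by (simp add: dhor_def Suc diff_map_trunc)
        then show ?thesis using w s Suc by blast
      qed
      then obtain w where w: "w \<in> free_mod n F P"
        "\<forall>c. dhor P (Suc Q) (\<lambda>b _. trunc P Q D w b) c \<sigma> = x c \<sigma>" "\<sigma> \<subseteq> {1..n}" "card \<sigma> = Q" by blast
      then show ?thesis
        by (intro exI[of _ "trunc P Q D w"] conjI trunc_free_mod)
          (auto simp: trunc_def lookup_restr split: if_splits)
    qed
    then obtain w where w: "\<And>\<sigma>. w \<sigma> \<in> free_mod n F P"
      "\<And>\<sigma> b m. lookup (w \<sigma> b) m \<noteq> 0 \<Longrightarrow> \<sigma> \<subseteq> {1..n} \<and> card \<sigma> = Q \<and> total_deg m + Q + shift F P b = D"
      "\<And>\<sigma> c. dhor P (Suc Q) (\<lambda>b _. w \<sigma> b) c \<sigma> = x c \<sigma>" by metis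
    define y where "y b \<sigma> = w \<sigma> b" for b \<sigma>
    have "kchain n (shift F P b) D Q (y b)" for b
      using w(1,2) by (auto simp: kchain_def y_def free_mod_def polys_def in_keys_iff)
    moreover have "y b = 0" if "b \<notin> basis F P" for b
      using w(1) that by (auto simp: y_def free_mod_def fun_eq_iff)
    ultimately have "y \<in> cplx D (Suc P) (Suc Q)" by (simp add: cplx_Suc_Suc)
    moreover have "dhor P (Suc Q) y = x"
    proof (intro ext)
      fix c \<sigma>
      have "dhor P (Suc Q) y c \<sigma> = dhor P (Suc Q) (\<lambda>b _. w \<sigma> b) c \<sigma>"
        by (simp add: dhor_def y_def split: nat.split)
      then show "dhor P (Suc Q) y c \<sigma> = x c \<sigma>" by (simp add: w)
    qed
    ultimately show ?thesis by blast
  qed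
  \<comment> \<open>Column exactness: a column is a direct sum, over the basis of a free module, of
    Koszul complexes of S augmented to K.\<close>
  show "\<exists>y\<in>cplx D (Suc P) (Suc Q). dver (Suc P) Q y = x"
    if x: "x \<in> cplx D (Suc P) Q" and z: "\<And>q'. Q = Suc q' \<Longrightarrow> dver (Suc P) q' x = 0"
  proof (cases Q)
    case 0
    have xD: "\<sigma> = {} \<and> m = 0 \<and> b \<in> basis F P \<and> shift F P b = D" if "lookup (x b \<sigma>) m \<noteq> 0" for b \<sigma> m
      using x that 0 by (auto simp: cplx_Suc_0)
    have "x b = 0" if "b \<notin> basis F P" for b
      using xD that by (intro ext poly_mapping_eqI) fastforce
    moreover have "kchain n (shift F P b) D 0 (x b)" for b
      unfolding kchain_def using xD by fastforce
    ultimately have "x \<in> cplx D (Suc P) (Suc 0)" by (simp add: cplx_Suc_Suc)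
    moreover have "dver (Suc P) 0 x = x"
      using xD by (intro ext poly_mapping_eqI) (fastforce simp: dver_def lookup_single when_def)
    ultimately show ?thesis using 0 by blast
  next
    case (Suc q)
    have "\<exists>h. kchain n (shift F P b) D (Suc q) h \<and> kos n h = x b \<and> (b \<notin> basis F P \<longrightarrow> h = 0)" for b
    proof (cases "b \<in> basis F P")
      case True
      have k: "kchain n (shift F P b) D q (x b)" using x Suc by (simp add: cplx_Suc_Suc)
      have "\<exists>h. kchain n (shift F P b) D (Suc q) h \<and> kos n h = x b"
      proof (rule koszul_exact_polys[OF k])
        show "kos n (x b) = 0"
        proof (cases q)
          case 0
          then show ?thesis using kos_kchain_0 k by blast
        next
          case q: (Suc q')
          have "kos n (x b) \<sigma> = dver (Suc P) (Suc q') x b \<sigma>" for \<sigma> by (simp add: dver_def)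
          also have "\<dots> \<sigma> = 0" for \<sigma> using z[of q] Suc q by simp
          finally show ?thesis by auto
        qed
        show "lookup (x b {}) 0 = 0" if "q = 0"
        proof -
          have "dver (Suc P) 0 x b {} = 0" using z[of 0] Suc that by simp
          then show ?thesis by (simp add: dver_def) (metis lookup_single_eq lookup_zero)
        qed
      qed
      then show ?thesis using True by blast
    next
      case False
      then show ?thesis using x Suc by (intro exI[of _ 0]) (simp add: cplx_Suc_Suc)
    qed
    then obtain h where h: "\<And>b. kchain n (shift F P b) D (Suc q) (h b)" "\<And>b. kos n (h b) = x b"
      "\<And>b. b \<notin> basis F P \<Longrightarrow> h b = 0" by metis
    then have "h \<in> cplx D (Suc P) (Suc Q)" by (simp add: Suc cplx_Suc_Suc)
    moreover have "dver (Suc P) Q h = x" by (intro ext) (simp add: dver_def Suc h)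
    ultimately show ?thesis by blast
  qed
qed (use cplx_diff dhor_cplx dver_cplx dhor_diff dver_diff in auto)

end

text \<open>Vanishing of Tor_i(I, K) in internal degree D, read off from the Koszul resolution of K.
  The field appears only in the type of the chains, hence the type token.\<close>

definition koszul_acyclic :: "nat \<Rightarrow> nat set set \<Rightarrow> 'k::field itself \<Rightarrow> nat \<Rightarrow> nat \<Rightarrow> bool" where
  "koszul_acyclic n J K i D \<longleftrightarrow> (\<forall>f :: nat set \<Rightarrow> 'k mpoly. kchain n 0 D i f \<longrightarrow> supp_in J f \<longrightarrow> kos n f = 0 \<longrightarrow>
     (\<exists>h. kchain n 0 D (Suc i) h \<and> supp_in J h \<and> kos n h = f))"

lemma vector_space_fun: "vector_space (\<lambda>c (v :: nat \<Rightarrow> 'k::field) p. c * v p)"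
  by standard (auto simp: fun_eq_iff algebra_simps)

context resolution
begin

text \<open>Koszul chains over I lift to the interior along the row, so being a composite means
  being a Koszul boundary. The index \<open>Suc i\<close> reflects the shift in
  \<open>cplx\<close>.\<close>

lemma exact_at_koszul:
  "double_complex.exact_at (cplx D) dhor dver 0 (Suc i) \<longleftrightarrow> koszul_acyclic n J TYPE('k) i D"
proof -
  interpret dc: double_complex "cplx D" dhor dver by (rule double_complex)
  have dver0: "dver 0 i b = 0 \<longleftrightarrow> kos n (b 0) = 0" if b: "b \<in> cplx D 0 (Suc i)" for b
  proof (cases i)
    case 0
    then show ?thesis using b kos_kchain_0[of n 0 D "b 0"]
      by (auto simp: cplx_0_Suc dver_def fun_eq_iff)
  next
    case (Suc j)
    have "dver 0 i b c = 0" if "c \<noteq> 0" for c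
      using b that by (simp add: Suc dver_Suc cplx_0_Suc)
    moreover have "dver 0 i b 0 = kos n (b 0)" by (simp add: Suc dver_Suc)
    ultimately have "dver 0 i b c = (if c = 0 then kos n (b 0) else 0)" for c by simp
    then have "dver 0 i b = (\<lambda>c. if c = 0 then kos n (b 0) else 0)" by (rule ext)
    then show ?thesis by (auto simp: fun_eq_iff)
  qed
  have iff: "(\<exists>c\<in>cplx D (Suc 0) (Suc (Suc i)). b = dhor 0 (Suc i) (dver (Suc 0) (Suc i) c)) \<longleftrightarrow>
      (\<exists>h. kchain n 0 D (Suc i) h \<and> supp_in J h \<and> kos n h = b 0)"
    if b: "b \<in> cplx D 0 (Suc i)" for b
  proof
    assume "\<exists>c\<in>cplx D (Suc 0) (Suc (Suc i)). b = dhor 0 (Suc i) (dver (Suc 0) (Suc i) c)"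
    then obtain c where c: "c \<in> cplx D (Suc 0) (Suc (Suc i))"
      "b = dver 0 (Suc i) (dhor 0 (Suc (Suc i)) c)" using dc.comm by metis
    have "dhor 0 (Suc (Suc i)) c \<in> cplx D 0 (Suc (Suc i))" using dhor_cplx c by blast
    then show "\<exists>h. kchain n 0 D (Suc i) h \<and> supp_in J h \<and> kos n h = b 0"
      unfolding cplx_0_Suc c(2) dver_Suc by blast
  next
    assume "\<exists>h. kchain n 0 D (Suc i) h \<and> supp_in J h \<and> kos n h = b 0"
    then obtain h where h: "kchain n 0 D (Suc i) h" "supp_in J h" "kos n h = b 0" by blast
    define x where "x c = (if c = 0 then h else 0)" for c :: nat
    have "x \<in> cplx D 0 (Suc (Suc i))" using h by (simp add: cplx_0_Suc x_def)
    then obtain c where c: "c \<in> cplx D (Suc 0) (Suc (Suc i))" "dhor 0 (Suc (Suc i)) c = x"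
      using dc.row[of x 0 "Suc i"] by blast
    have "dver 0 (Suc i) x = b"
      using b h by (intro ext) (simp add: dver_Suc x_def cplx_0_Suc)
    then show "\<exists>c\<in>cplx D (Suc 0) (Suc (Suc i)). b = dhor 0 (Suc i) (dver (Suc 0) (Suc i) c)"
      using c dc.comm[OF c(1)] by metis
  qed
  show ?thesis
  proof
    assume e: "dc.exact_at 0 (Suc i)"
    show "koszul_acyclic n J TYPE('k) i D"
      unfolding koszul_acyclic_def
    proof (intro allI impI)
      fix f :: "nat set \<Rightarrow> 'k mpoly" assume f: "kchain n 0 D i f" "supp_in J f" "kos n f = 0"
      define b where "b c = (if c = 0 then f else 0)" for c :: nat
      have b: "b \<in> cplx D 0 (Suc i)" using f by (simp add: cplx_0_Suc b_def)
      moreover have "dver 0 i b = 0" using dver0[OF b] f by (simp add: b_def)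
      ultimately have "\<exists>c\<in>cplx D (Suc 0) (Suc (Suc i)). b = dhor 0 (Suc i) (dver (Suc 0) (Suc i) c)"
        using e unfolding dc.exact_at_def by blast
      then show "\<exists>h. kchain n 0 D (Suc i) h \<and> supp_in J h \<and> kos n h = f"
        using iff[OF b] by (simp add: b_def)
    qed
  next
    assume k: "koszul_acyclic n J TYPE('k) i D"
    show "dc.exact_at 0 (Suc i)"
      unfolding dc.exact_at_def
    proof (intro ballI impI)
      fix b assume b: "b \<in> cplx D 0 (Suc i)" and z: "\<forall>q'. Suc i = Suc q' \<longrightarrow> dver 0 q' b = 0"
      have "kos n (b 0) = 0" using dver0[OF b] z by simp
      then show "\<exists>c\<in>cplx D (Suc 0) (Suc (Suc i)). b = dhor 0 (Suc i) (dver (Suc 0) (Suc i) c)"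
        using k b unfolding iff[OF b] koszul_acyclic_def cplx_0_Suc by blast
    qed
  qed
qed

section \<open>Row zero and the homology of the tensored resolution\<close>

definition emb :: "(nat \<Rightarrow> 'k) \<Rightarrow> nat \<Rightarrow> nat set \<Rightarrow> 'k mpoly" where
  "emb v = (\<lambda>b \<sigma>. if \<sigma> = {} then single 0 (v b) else 0)"

lemma emb_inject [simp]: "emb v = emb w \<longleftrightarrow> v = w"
proof
  assume "emb v = emb w"
  then have "lookup (emb v b {}) 0 = lookup (emb w b {}) 0" for b by simp
  then show "v = w" by (auto simp: emb_def)
qed simp

lemma emb_zero [simp]: "emb 0 = 0"
  by (intro ext) (simp add: emb_def)

lemma emb_cplx: "emb v \<in> cplx D (Suc p) 0 \<longleftrightarrow> v \<in> tens F p D"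
  by (auto simp: cplx_Suc_0 emb_def tens_def lookup_single when_def split: if_splits)

lemma cplx_emb:
  assumes "x \<in> cplx D (Suc p) 0"
  obtains v where "v \<in> tens F p D" "x = emb v"
proof -
  define v where "v b = lookup (x b {}) 0" for b
  have "x = emb v"
    using assms unfolding cplx_Suc_0
    by (intro ext poly_mapping_eqI) (auto simp: emb_def v_def lookup_single when_def)
  then show ?thesis using that emb_cplx assms by metis
qed

lemma dhor_emb: "dhor (Suc p) 0 (emb v) = emb (tens_map F (Suc p) v)"
proof (intro ext)
  fix c \<sigma>
  have "tens_map F (Suc p) (\<lambda>b. 0) c = 0" by (simp add: tens_map_def)
  then show "dhor (Suc p) 0 (emb v) c \<sigma> = emb (tens_map F (Suc p) v) c \<sigma>"
    by (simp add: dhor_def emb_def)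
qed

lemma exact_at_tens:
  "double_complex.exact_at (cplx D) dhor dver (Suc i) 0 \<longleftrightarrow> tens_cycles F i D \<subseteq> tens_boundaries F i D"
proof -
  interpret dc: double_complex "cplx D" dhor dver by (rule double_complex)
  have cyc: "(\<forall>p'. Suc i = Suc p' \<longrightarrow> dhor p' 0 (emb v) = 0) \<longleftrightarrow> i = 0 \<or> tens_map F i v = 0" for v
  proof (cases i)
    case 0
    then show ?thesis by (auto simp: dhor_def fun_eq_iff)
  next
    case (Suc j)
    then show ?thesis by (simp add: dhor_emb) (metis emb_inject emb_zero)
  qed
  have bnd: "(\<exists>c\<in>cplx D (Suc (Suc i)) (Suc 0). emb v = dhor (Suc i) 0 (dver (Suc (Suc i)) 0 c)) \<longleftrightarrow>
      v \<in> tens_boundaries F i D" for v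
  proof
    assume "\<exists>c\<in>cplx D (Suc (Suc i)) (Suc 0). emb v = dhor (Suc i) 0 (dver (Suc (Suc i)) 0 c)"
    then obtain c where c: "c \<in> cplx D (Suc (Suc i)) (Suc 0)"
      "emb v = dhor (Suc i) 0 (dver (Suc (Suc i)) 0 c)" by blast
    obtain w where w: "w \<in> tens F (Suc i) D" "dver (Suc (Suc i)) 0 c = emb w"
      using cplx_emb[OF dver_cplx[OF c(1)]] by blast
    then show "v \<in> tens_boundaries F i D" using c by (auto simp: tens_boundaries_def dhor_emb)
  next
    assume "v \<in> tens_boundaries F i D"
    then obtain w where w: "w \<in> tens F (Suc i) D" "v = tens_map F (Suc i) w"
      by (auto simp: tens_boundaries_def)
    then obtain c where "c \<in> cplx D (Suc (Suc i)) (Suc 0)" "dver (Suc (Suc i)) 0 c = emb w"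
      using dc.col[of "emb w" "Suc i" 0] emb_cplx by blast
    then show "\<exists>c\<in>cplx D (Suc (Suc i)) (Suc 0). emb v = dhor (Suc i) 0 (dver (Suc (Suc i)) 0 c)"
      using w dhor_emb by metis
  qed
  show ?thesis
  proof
    assume e: "dc.exact_at (Suc i) 0"
    show "tens_cycles F i D \<subseteq> tens_boundaries F i D"
    proof
      fix v assume "v \<in> tens_cycles F i D"
      then have "emb v \<in> cplx D (Suc i) 0" "\<forall>p'. Suc i = Suc p' \<longrightarrow> dhor p' 0 (emb v) = 0"
        unfolding emb_cplx cyc by (auto simp: tens_cycles_def)
      then show "v \<in> tens_boundaries F i D"
        using e unfolding dc.exact_at_def bnd[symmetric] by blast
    qed
  next
    assume s: "tens_cycles F i D \<subseteq> tens_boundaries F i D"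
    show "dc.exact_at (Suc i) 0"
      unfolding dc.exact_at_def
    proof (intro ballI impI)
      fix b assume b: "b \<in> cplx D (Suc i) 0" "\<forall>p'. Suc i = Suc p' \<longrightarrow> dhor p' 0 b = 0"
      obtain v where v: "v \<in> tens F i D" "b = emb v" using cplx_emb b(1) by blast
      then have "v \<in> tens_cycles F i D" using b(2) cyc[of v] by (simp add: tens_cycles_def)
      then show "\<exists>c\<in>cplx D (Suc (Suc i)) (Suc 0). b = dhor (Suc i) 0 (dver (Suc (Suc i)) 0 c)"
        unfolding v(2) bnd using s by blast
    qed
  qed
qed

text \<open>Balancing of Tor: the two positions are the ends of one antidiagonal.\<close>

lemma tens_exact_iff:
  "tens_cycles F i D \<subseteq> tens_boundaries F i D \<longleftrightarrow> koszul_acyclic n J TYPE('k) i D"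
  using double_complex.exact_at_iff[OF double_complex, of D "Suc i"]
  by (simp add: exact_at_koszul exact_at_tens)

lemma boundaries_subset_cycles: "tens_boundaries F i D \<subseteq> tens_cycles F i D"
proof
  fix v assume "v \<in> tens_boundaries F i D"
  then obtain w where w: "w \<in> tens F (Suc i) D" "v = tens_map F (Suc i) w"
    by (auto simp: tens_boundaries_def)
  have "emb v \<in> cplx D (Suc i) 0"
    using dhor_cplx[of "emb w" D "Suc i" 0] w by (simp add: emb_cplx dhor_emb)
  moreover have "tens_map F i v = 0" if "i = Suc j" for j
    using w that by (intro ext) (auto simp: tens_def intro!: tens_map_tens_map)
  ultimately show "v \<in> tens_cycles F i D" by (cases i) (simp_all add: tens_cycles_def emb_cplx)
qed

text \<open>The difference of dimensions is truncated, and \<open>dim\<close> is informative only in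
  finite dimension; here everything lies in the span of finitely many unit vectors. The boundaries
  form a subspace, so a cycle outside it enlarges a basis and makes the inequality strict.\<close>

lemma homology_dim_nonzero_iff:
  "homology_dim F i D \<noteq> 0 \<longleftrightarrow> \<not> koszul_acyclic n J TYPE('k) i D"
proof -
  interpret vs: vector_space "\<lambda>c (v :: nat \<Rightarrow> 'k) p. c * v p" by (rule vector_space_fun)
  define Z W where "Z = tens_cycles F i D" and "W = tens_boundaries F i D"
  have sub: "W \<subseteq> Z" unfolding Z_def W_def by (rule boundaries_subset_cycles)
  have "vs.subspace W"
  proof (rule vs.subspaceI)
    show "0 \<in> W" unfolding W_def tens_boundaries_def
      by (intro image_eqI[of _ _ 0]) (auto simp: tens_def tens_map_def fun_eq_iff)
    show "x + y \<in> W" if "x \<in> W" "y \<in> W" for x y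
    proof -
      obtain a b where ab: "a \<in> tens F (Suc i) D" "b \<in> tens F (Suc i) D"
        "x = tens_map F (Suc i) a" "y = tens_map F (Suc i) b"
        using \<open>x \<in> W\<close> \<open>y \<in> W\<close> unfolding W_def tens_boundaries_def by blast
      have "tens_map F (Suc i) (a + b) = x + y"
        by (intro ext) (simp add: ab tens_map_def sum.distrib distrib_right)
      moreover have "a + b \<in> tens F (Suc i) D"
        using ab by (simp add: tens_def) (metis add.right_neutral)
      ultimately show ?thesis unfolding W_def tens_boundaries_def by force
    qed
    show "(\<lambda>p. c * x p) \<in> W" if "x \<in> W" for c x
    proof -
      obtain a where a: "a \<in> tens F (Suc i) D" "x = tens_map F (Suc i) a"
        using \<open>x \<in> W\<close> unfolding W_def tens_boundaries_def by blast
      have "tens_map F (Suc i) (\<lambda>p. c * a p) = (\<lambda>p. c * x p)"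
        by (intro ext) (simp add: a tens_map_def sum_distrib_left mult.assoc)
      moreover have "(\<lambda>p. c * a p) \<in> tens F (Suc i) D" using a by (simp add: tens_def)
      ultimately show ?thesis unfolding W_def tens_boundaries_def by force
    qed
  qed
  define E where "E = (\<lambda>p q. if q = p then 1 else 0 :: 'k) ` basis F i"
  have "finite E" by (simp add: E_def)
  have "Z \<subseteq> vs.span E"
  proof
    fix v assume "v \<in> Z"
    then have v: "v p \<noteq> 0 \<Longrightarrow> p \<in> basis F i" for p
      by (auto simp: Z_def tens_cycles_def tens_def)
    have "v = (\<Sum>p\<in>basis F i. (\<lambda>q. v p * (if q = p then 1 else 0)))"
    proof
      fix q
      have "(\<Sum>p\<in>basis F i. (\<lambda>q. v p * (if q = p then 1 else 0))) q
          = (\<Sum>p\<in>basis F i. v p * (if q = p then 1 else 0))"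
        by (induction rule: finite_induct[OF finite_basis[of i]]) simp_all
      also have "\<dots> = v q" using v[of q] by (auto simp: if_distrib cong: if_cong)
      finally show "v q = (\<Sum>p\<in>basis F i. (\<lambda>q. v p * (if q = p then 1 else 0))) q" ..
    qed
    also have "\<dots> \<in> vs.span E"
      by (intro vs.span_sum vs.span_scale vs.span_base) (simp add: E_def)
    finally show "v \<in> vs.span E" .
  qed
  obtain C where C: "C \<subseteq> Z" "vs.independent C" "Z \<subseteq> vs.span C" "card C = vs.dim Z"
    using vs.basis_exists by blast
  have "finite C"
    using vs.independent_span_bound[OF \<open>finite E\<close> C(2)] C(1) \<open>Z \<subseteq> vs.span E\<close> by blast
  obtain B where B: "B \<subseteq> W" "vs.independent B" "W \<subseteq> vs.span B" "card B = vs.dim W"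
    using vs.basis_exists by blast
  have "finite B"
    using vs.independent_span_bound[OF \<open>finite C\<close> B(2)] B(1) sub C(3) by blast
  have span_B: "vs.span B = W"
    using B \<open>vs.subspace W\<close> vs.span_minimal by blast
  have "vs.dim W < vs.dim Z" if "\<not> Z \<subseteq> W"
  proof -
    obtain v where v: "v \<in> Z" "v \<notin> W" using \<open>\<not> Z \<subseteq> W\<close> by blast
    have "vs.independent (insert v B)"
      using B(2) v span_B vs.independent_insert by metis
    then have "card (insert v B) \<le> card C"
      using vs.independent_span_bound[OF \<open>finite C\<close>, of "insert v B"] v C(3) B(1) sub by blast
    moreover have "v \<notin> B" using v B(1) by blast
    ultimately show ?thesis using \<open>finite B\<close> B C by simp
  qed
  moreover have "vs.dim Z = vs.dim W" if "Z \<subseteq> W" using that sub by (simp add: subset_antisym)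
  ultimately have "vs.dim Z - vs.dim W \<noteq> 0 \<longleftrightarrow> \<not> Z \<subseteq> W"
    by (cases "Z \<subseteq> W") simp_all
  then show ?thesis
    unfolding homology_dim_def Z_def[symmetric] W_def[symmetric]
    using tens_exact_iff[of i D] by (simp add: Z_def W_def)
qed

end

section \<open>The Taylor resolution\<close>

lemma polys_single [simp]: "keys m \<subseteq> {1..n} \<Longrightarrow> single m c \<in> polys n"
  by (auto simp: polys_def)

lemma polys_zero [simp]: "0 \<in> polys n"
  by (simp add: polys_def)

lemma polys_one [simp]: "1 \<in> polys n"
  by (simp add: polys_def)

lemma polys_add: "f \<in> polys n \<Longrightarrow> g \<in> polys n \<Longrightarrow> f + g \<in> polys n"
  unfolding polys_def using Poly_Mapping.keys_add[of f g] by blast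

lemma polys_sum: "(\<And>b. b \<in> B \<Longrightarrow> f b \<in> polys n) \<Longrightarrow> sum f B \<in> polys n"
  by (induction B rule: infinite_finite_induct) (auto simp: polys_add)

lemma polys_mult:
  assumes "f \<in> polys n" "g \<in> polys n"
  shows "f * g \<in> polys n"
proof -
  have "keys m \<subseteq> {1..n}" if "m \<in> keys (f * g)" for m
  proof -
    obtain a b where "m = a + b" "a \<in> keys f" "b \<in> keys g"
      using \<open>m \<in> keys (f * g)\<close> keys_mult by blast
    then show ?thesis using assms by (auto simp: polys_def keys_add_expo)
  qed
  then show ?thesis by (simp add: polys_def)
qed

lemma polys_uminus: "f \<in> polys n \<Longrightarrow> - f \<in> polys n"
  by (simp add: polys_def in_keys_iff)

locale taylor =
  fixes n r :: nat and U :: "nat \<Rightarrow> nat set"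
  assumes U_sub: "j < r \<Longrightarrow> U j \<subseteq> {1..n}"
begin

abbreviation V :: "nat set" where "V \<equiv> {..<r}"

text \<open>The least common multiple of the generators with index in B. Cutting B down to V keeps
  the support finite for every B, so \<open>L_mono\<close> has no side conditions.\<close>

definition L :: "nat set \<Rightarrow> expo" where
  "L B = ind (\<Union>j\<in>B \<inter> V. U j)"

lemma finite_U: "j < r \<Longrightarrow> finite (U j)"
  using U_sub finite_subset by blast

lemma finite_Union_U: "finite (\<Union>j\<in>B \<inter> V. U j)"
  using finite_U by auto

lemma L_mono: "edvd (L s) (L (insert j s))"
  unfolding L_def edvd_ind_iff[OF finite_Union_U] keys_ind[OF finite_Union_U] by auto

lemma keys_L: "keys (L B) = (\<Union>j\<in>B \<inter> V. U j)"
  unfolding L_def by (rule keys_ind[OF finite_Union_U])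

lemma edvd_L_iff: "edvd (L B) a \<longleftrightarrow> (\<forall>j\<in>B \<inter> V. U j \<subseteq> keys a)"
  unfolding L_def edvd_ind_iff[OF finite_Union_U] by auto

lemma L_empty [simp]: "L {} = 0"
  by (simp add: L_def ind_def)

lemma wbd_wbd:
  fixes f :: "nat set \<Rightarrow> 'k::comm_ring_1 mpoly"
  assumes "\<And>s. f s \<noteq> 0 \<Longrightarrow> s \<subseteq> V"
  shows "wbd V L (wbd V L f) = 0"
proof (rule cf_eqD[of L], rule ext)
  fix a \<sigma>
  show "cf L (wbd V L (wbd V L f)) a \<sigma> = cf L 0 a \<sigma>"
  proof (cases "finite \<sigma>")
    case True
    then show ?thesis by (simp add: cf_wbd L_mono bd_bd)
  next
    case False
    then have "\<not> insert j (insert l \<sigma>) \<subseteq> V" for j l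
      using finite_subset[of \<sigma> V] by auto
    then have "f (insert j (insert l \<sigma>)) = 0" for j l using assms by blast
    then have "cf L f a (insert j (insert l \<sigma>)) = 0" for j l by (simp add: cf_def)
    then show ?thesis by (simp add: cf_wbd L_mono bd_def)
  qed
qed

text \<open>In multidegree a the Taylor complex is the full simplex on the generators dividing the
  monomial a. Any such generator p is the apex of a cone, since adding p preserves divisibility. In
  degree 0 its existence says that f {} lies in the ideal.\<close>

lemma wbd_exact:
  fixes f :: "nat set \<Rightarrow> 'k::field mpoly"
  assumes supp: "\<And>s. f s \<noteq> 0 \<Longrightarrow> s \<subseteq> V \<and> card s = i"
    and polys: "\<And>s. f s \<in> polys n" and cyc: "wbd V L f = 0"
    and i0: "\<And>m. i = 0 \<Longrightarrow> m \<in> keys (f {}) \<Longrightarrow> \<exists>j<r. U j \<subseteq> keys m"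
  shows "\<exists>h. wbd V L h = f \<and> (\<forall>s. h s \<noteq> 0 \<longrightarrow> s \<subseteq> V \<and> card s = Suc i) \<and> (\<forall>s. h s \<in> polys n)"
proof -
  define P where "P a s \<longleftrightarrow> s \<subseteq> V \<and> card s = Suc i \<and> keys a \<subseteq> {1..n}" for a :: expo and s
  have "\<exists>h. wbd V L h = f \<and> (\<forall>s m. lookup (h s) m \<noteq> 0 \<longrightarrow> P (m + L s) s)"
  proof (rule lift_boundary)
    fix a assume a: "cf L f a \<noteq> 0"
    define g where "g = cf L f a"
    have g: "edvd (L s) a \<and> lookup (f s) (a - L s) \<noteq> 0 \<and> s \<subseteq> V \<and> card s = i" if "g s \<noteq> 0" for s
    proof -
      have "edvd (L s) a" "lookup (f s) (a - L s) \<noteq> 0"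
        using that by (auto simp: g_def cf_def split: if_splits)
      moreover from this have "f s \<noteq> 0" by auto
      ultimately show ?thesis using supp by blast
    qed
    obtain s0 where s0: "g s0 \<noteq> 0" using a by (auto simp: g_def fun_eq_iff)
    note g0 = g[OF s0]
    have ka: "keys a = keys (a - L s0) \<union> keys (L s0)"
      using edvd_diff_add g0 keys_add_expo by metis
    moreover have "keys (a - L s0) \<subseteq> {1..n}"
      using polys[of s0] g0 by (auto simp: polys_def in_keys_iff)
    moreover have "keys (L s0) \<subseteq> {1..n}" using U_sub by (auto simp: keys_L)
    ultimately have a_sub: "keys a \<subseteq> {1..n}" by simp
    have "\<exists>p<r. U p \<subseteq> keys a"
    proof (cases "i = 0")
      case True
      then have "s0 = {}" using g0 finite_subset[of s0 V] by auto
      then show ?thesis using i0[OF True, of a] g0 by (simp add: in_keys_iff)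
    next
      case False
      then obtain p where "p \<in> s0" using g0 by fastforce
      then show ?thesis using g0 by (intro exI[of _ p]) (auto simp: edvd_L_iff)
    qed
    then obtain p where p: "p < r" "U p \<subseteq> keys a" by blast
    define w where "w = toggle p (Pow V) g"
    have "bd V w = g"
      unfolding w_def
    proof (rule bd_cone)
      show "bd V g s = 0" for s
        using cyc unfolding g_def by (simp add: cf_wbd[symmetric] L_mono)
    qed (use p g in auto)
    moreover have "edvd (L s) a \<and> P a s" if "w s \<noteq> 0" for s
    proof -
      have s: "p \<in> s" "s \<subseteq> V" "g (s - {p}) \<noteq> 0"
        using that by (auto simp: w_def toggle_def split: if_splits)
      have "finite s" using s finite_subset by blast
      then have "card s = Suc i" using g[OF s(3)] s card_Suc_Diff1[of s p] by simp
      moreover have "edvd (L s) a" using g[OF s(3)] s p unfolding edvd_L_iff by blast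
      ultimately show ?thesis using s a_sub by (simp add: P_def)
    qed
    ultimately show "\<exists>w. bd V w = cf L f a \<and> (\<forall>s. w s \<noteq> 0 \<longrightarrow> edvd (L s) a \<and> P a s)"
      unfolding g_def by blast
  qed (use supp in \<open>auto simp: L_mono\<close>)
  then obtain h where h: "wbd V L h = f" "\<And>s m. lookup (h s) m \<noteq> 0 \<Longrightarrow> P (m + L s) s" by blast
  have "s \<subseteq> V \<and> card s = Suc i" if "h s \<noteq> 0" for s
  proof -
    obtain m where "lookup (h s) m \<noteq> 0" using \<open>h s \<noteq> 0\<close> by (metis lookup_zero poly_mapping_eqI)
    then show ?thesis using h(2) unfolding P_def by blast
  qed
  moreover have "h s \<in> polys n" for s
    using h(2) unfolding polys_def P_def by (auto simp: in_keys_iff keys_add_expo)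
  ultimately show ?thesis using h(1) by blast
qed

text \<open>Basis indices must be numbers, so sets of generators are coded by
  \<open>set_encode\<close>. Degree i belongs to sets of size i + 1, the empty set being the place
  of the ideal itself. At most one j fulfils the condition in an entry of the differential.\<close>

definition res :: "'k::field free_complex" where
  "res = \<lparr>basis = (\<lambda>i. {p. set_decode p \<subseteq> V \<and> card (set_decode p) = Suc i}),
    shift = (\<lambda>i p. total_deg (L (set_decode p))),
    diff = (\<lambda>i p q. \<Sum>j\<in>V - set_decode q. if set_decode p = insert j (set_decode q)
      then single (L (set_decode p) - L (set_decode q)) (bsgn j (set_decode q)) else 0),
    aug = (\<lambda>p. single (L (set_decode p)) 1)\<rparr>"

definition fam :: "(nat \<Rightarrow> 'k::field mpoly) \<Rightarrow> nat set \<Rightarrow> 'k mpoly" where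
  "fam v B = (if finite B then v (set_encode B) else 0)"

lemma fam_inject: "fam v = fam w \<Longrightarrow> v = w"
proof
  fix p assume "fam v = fam w"
  then have "fam v (set_decode p) = fam w (set_decode p)" by simp
  then show "v p = w p" by (simp add: fam_def)
qed

lemma finite_res_basis [simp]: "finite (basis res i)"
proof -
  have "basis res i \<subseteq> set_encode ` Pow V"
  proof
    fix p assume "p \<in> basis res i"
    then show "p \<in> set_encode ` Pow V"
      by (intro image_eqI[of _ _ "set_decode p"]) (auto simp: res_def)
  qed
  then show ?thesis by (rule finite_subset) simp
qed

lemma free_mod_iff: "v \<in> free_mod n (res :: 'k::field free_complex) i \<longleftrightarrow>
  (\<forall>B. fam v B \<noteq> 0 \<longrightarrow> B \<subseteq> V \<and> card B = Suc i) \<and> (\<forall>B. fam v B \<in> polys n)"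
proof
  assume v: "v \<in> free_mod n (res :: 'k free_complex) i"
  have "B \<subseteq> V \<and> card B = Suc i" if "fam v B \<noteq> 0" for B
  proof -
    have B: "finite B" "v (set_encode B) \<noteq> 0" using that by (auto simp: fam_def split: if_splits)
    then have "set_encode B \<in> basis (res :: 'k free_complex) i" using v by (auto simp: free_mod_def)
    then show ?thesis using B by (simp add: res_def)
  qed
  then show "(\<forall>B. fam v B \<noteq> 0 \<longrightarrow> B \<subseteq> V \<and> card B = Suc i) \<and> (\<forall>B. fam v B \<in> polys n)"
    using v by (auto simp: free_mod_def fam_def)
next
  assume a: "(\<forall>B. fam v B \<noteq> 0 \<longrightarrow> B \<subseteq> V \<and> card B = Suc i) \<and> (\<forall>B. fam v B \<in> polys n)"
  have "fam v (set_decode p) = v p" for p by (simp add: fam_def)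
  then show "v \<in> free_mod n (res :: 'k free_complex) i"
    using a unfolding free_mod_def res_def by simp metis
qed

lemma fam_surj:
  assumes "\<And>B. h B \<noteq> 0 \<Longrightarrow> B \<subseteq> V"
  obtains v where "fam v = h"
proof
  show "fam (\<lambda>p. h (set_decode p)) = h"
  proof
    fix B
    show "fam (\<lambda>p. h (set_decode p)) B = h B"
      using assms[of B] finite_subset[of B V] by (auto simp: fam_def)
  qed
qed

lemma sum_basis:
  fixes v :: "nat \<Rightarrow> 'k::field mpoly"
  assumes v: "v \<in> free_mod n (res :: 'k free_complex) i" and "finite C"
  shows "(\<Sum>p\<in>basis (res :: 'k free_complex) i. v p *
      (\<Sum>j\<in>V - C. if set_decode p = insert j C then c p j else 0)) =
    (\<Sum>j\<in>V - C. c (set_encode (insert j C)) j * fam v (insert j C))"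
proof -
  have "(\<Sum>p\<in>basis (res :: 'k free_complex) i. v p *
      (\<Sum>j\<in>V - C. if set_decode p = insert j C then c p j else 0)) =
    (\<Sum>j\<in>V - C. \<Sum>p\<in>basis (res :: 'k free_complex) i.
      if set_decode p = insert j C then v p * c p j else 0)"
    unfolding sum_distrib_left by (subst sum.swap) (intro sum.cong refl, simp)
  also have "\<dots> = (\<Sum>j\<in>V - C. c (set_encode (insert j C)) j * fam v (insert j C))"
  proof (intro sum.cong refl)
    fix j assume "j \<in> V - C"
    define q where "q = set_encode (insert j C)"
    have q: "set_decode p = insert j C \<longleftrightarrow> p = q" for p
      using \<open>finite C\<close> by (auto simp: q_def) (metis set_decode_inverse)
    have "(\<Sum>p\<in>basis (res :: 'k free_complex) i. if set_decode p = insert j C then v p * c p j else 0)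
      = (if q \<in> basis (res :: 'k free_complex) i then v q * c q j else 0)"
      by (simp add: q)
    also have "\<dots> = v q * c q j" using v by (auto simp: free_mod_def)
    finally show "(\<Sum>p\<in>basis (res :: 'k free_complex) i. if set_decode p = insert j C then v p * c p j else 0)
      = c (set_encode (insert j C)) j * fam v (insert j C)"
      using \<open>finite C\<close> by (simp add: q_def fam_def mult.commute)
  qed
  finally show ?thesis .
qed

lemma fam_diff_map:
  fixes v :: "nat \<Rightarrow> 'k::field mpoly"
  assumes v: "v \<in> free_mod n (res :: 'k free_complex) (Suc i)"
  shows "fam (diff_map res (Suc i) v) = wbd V L (fam v)"
proof
  fix C
  have fv: "C \<subseteq> V \<and> finite C \<and> card C = Suc i" if "fam v (insert j C) \<noteq> 0" "j \<notin> C" for j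
  proof -
    have "insert j C \<subseteq> V" "card (insert j C) = Suc (Suc i)" using v that unfolding free_mod_iff by blast+
    moreover from this have "finite C" using finite_subset[of C V] by auto
    ultimately show ?thesis using that by auto
  qed
  show "fam (diff_map res (Suc i) v) C = wbd V L (fam v) C"
  proof (cases "C \<subseteq> V \<and> finite C \<and> card C = Suc i")
    case True
    then have dec: "set_decode (set_encode C) = C" by simp
    have "fam (diff_map res (Suc i) v) C =
      (\<Sum>p\<in>basis (res :: 'k free_complex) (Suc i). v p * (\<Sum>j\<in>V - C. if set_decode p = insert j C
        then single (L (set_decode p) - L C) (bsgn j C) else 0))"
      using True by (simp add: fam_def diff_map_def) (simp add: res_def dec cong: if_cong)
    also have "\<dots> = (\<Sum>j\<in>V - C. single (L (set_decode (set_encode (insert j C))) - L C) (bsgn j C)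
        * fam v (insert j C))"
      by (rule sum_basis[OF v]) (use True in simp)
    also have "\<dots> = wbd V L (fam v) C"
      unfolding wbd_def using True by (intro sum.cong) (simp_all del: set_encode_insert)
    finally show ?thesis .
  next
    case False
    then have "wbd V L (fam v) C = 0"
      unfolding wbd_def using fv by (intro sum.neutral) fastforce
    moreover have "fam (diff_map res (Suc i) v) C = 0"
      using False by (auto simp: fam_def diff_map_def res_def)
    ultimately show ?thesis by simp
  qed
qed

text \<open>The augmentation is the Taylor differential into the empty set, so its kernel and image
  fall under \<open>wbd_exact\<close> as well.\<close>

lemma aug_map_wbd:
  fixes v :: "nat \<Rightarrow> 'k::field mpoly"
  assumes v: "v \<in> free_mod n (res :: 'k free_complex) 0"
  shows "wbd V L (fam v) = (\<lambda>C. if C = {} then aug_map res v else 0)"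
proof
  fix C
  show "wbd V L (fam v) C = (if C = {} then aug_map res v else 0)"
  proof (cases "C = {}")
    case True
    have "aug_map res v = (\<Sum>p\<in>basis (res :: 'k free_complex) 0. v p *
      (\<Sum>j\<in>V - {}. if set_decode p = insert j {} then single (L (set_decode p)) 1 else 0))"
      unfolding aug_map_def
    proof (intro sum.cong refl)
      fix p assume "p \<in> basis (res :: 'k free_complex) 0"
      then obtain j0 where j0: "set_decode p = {j0}" "j0 < r"
        by (auto simp: res_def card_1_singleton_iff)
      then show "v p * aug res p = v p *
        (\<Sum>j\<in>V - {}. if set_decode p = insert j {} then single (L (set_decode p)) 1 else 0)"
        by (simp add: res_def)
    qed
    also have "\<dots> = (\<Sum>j\<in>V - {}. single (L (set_decode (set_encode (insert j {})))) 1 * fam v (insert j {}))"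
      by (rule sum_basis[OF v]) simp
    also have "\<dots> = wbd V L (fam v) {}"
      unfolding wbd_def by (intro sum.cong) (simp_all add: bsgn_def set_encode_inverse del: set_encode_insert)
    finally show ?thesis using True by simp
  next
    case False
    have "fam v (insert j C) = 0" if "j \<notin> C" for j
    proof (rule ccontr)
      assume "fam v (insert j C) \<noteq> 0"
      then have "card (insert j C) = 1" "insert j C \<subseteq> V" using v unfolding free_mod_iff by auto
      moreover from this have "finite C" using finite_subset[of C V] by auto
      ultimately show False using False that by (simp add: card_eq_0_iff)
    qed
    then show ?thesis using False by (simp add: wbd_def)
  qed
qed

lemma graded_free_resolution_res:
  "graded_free_resolution n {f \<in> polys n. \<forall>m\<in>keys f. \<exists>j<r. U j \<subseteq> keys m} (res :: 'k::field free_complex)"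
proof -
  define I where "I = {f :: 'k mpoly. f \<in> polys n \<and> (\<forall>m\<in>keys f. \<exists>j<r. U j \<subseteq> keys m)}"
  let ?R = "res :: 'k free_complex"
  have keys_L_sub: "keys (L B) \<subseteq> {1..n}" for B using U_sub by (auto simp: keys_L)
  have aug: "aug ?R p \<in> I" if p: "p \<in> basis ?R 0" for p
  proof -
    obtain j0 where j0: "set_decode p = {j0}" "j0 < r"
      using p by (auto simp: res_def card_1_singleton_iff)
    then show ?thesis using keys_L_sub[of "{j0}"] by (auto simp: I_def res_def keys_L)
  qed
  have diff: "diff ?R (Suc i) p q \<in> polys n"
    "m \<in> keys (diff ?R (Suc i) p q) \<Longrightarrow> total_deg m + shift ?R i q = shift ?R (Suc i) p" for i p q m
  proof -
    let ?B = "set_decode p" and ?C = "set_decode q"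
    have sub: "keys (L ?B - L ?C) \<subseteq> keys (L ?B)" by (auto simp: in_keys_iff lookup_minus)
    then show "diff ?R (Suc i) p q \<in> polys n"
      using subset_trans[OF sub keys_L_sub[of ?B]] unfolding res_def
      by (simp, intro polys_sum) (metis (full_types) polys_single polys_zero)
    assume "m \<in> keys (diff ?R (Suc i) p q)"
    then have "(\<Sum>j\<in>V - ?C. lookup (if ?B = insert j ?C then single (L ?B - L ?C) (bsgn j ?C) else 0 :: 'k mpoly) m) \<noteq> 0"
      by (simp add: res_def in_keys_iff lookup_sum)
    then obtain j where "?B = insert j ?C" "m = L ?B - L ?C"
      by (elim sum.not_neutral_contains_not_neutral) (auto simp: lookup_single when_def split: if_splits)
    then have "m + L ?C = L ?B" using L_mono edvd_diff_add by metis
    then show "total_deg m + shift ?R i q = shift ?R (Suc i) p"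
      by (simp add: res_def) (metis total_deg_add)
  qed
  have free_mod_diff: "diff_map ?R (Suc i) v \<in> free_mod n ?R i" if "v \<in> free_mod n ?R (Suc i)" for i v
    using that diff(1) unfolding free_mod_def diff_map_def by (auto intro!: polys_sum polys_mult)
  have fam0: "fam v = 0 \<Longrightarrow> v = 0" for v :: "nat \<Rightarrow> 'k mpoly"
    using fam_inject[of v 0] by (auto simp: fam_def fun_eq_iff)
  have fam_00: "fam (0 :: nat \<Rightarrow> 'k mpoly) = 0" by (auto simp: fam_def fun_eq_iff)
  \<comment> \<open>The common form of the exactness claims: i = 0 gives surjectivity onto the
    ideal, i = 1 exactness at the augmentation, larger i the rest.\<close>
  have lift: "\<exists>w\<in>free_mod n ?R i. wbd V L (fam w) = f"
    if "\<And>s. f s \<noteq> 0 \<Longrightarrow> s \<subseteq> V \<and> card s = i" "\<And>s. f s \<in> polys n" "wbd V L f = 0"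
      "\<And>m. i = 0 \<Longrightarrow> m \<in> keys (f {}) \<Longrightarrow> \<exists>j<r. U j \<subseteq> keys m" for f :: "nat set \<Rightarrow> 'k mpoly" and i
  proof -
    have "\<exists>h. wbd V L h = f \<and> (\<forall>s. h s \<noteq> 0 \<longrightarrow> s \<subseteq> V \<and> card s = Suc i) \<and> (\<forall>s. h s \<in> polys n)"
      by (rule wbd_exact) (use that in auto)
    then obtain h where h: "wbd V L h = f" "\<And>s. h s \<noteq> 0 \<Longrightarrow> s \<subseteq> V \<and> card s = Suc i" "\<And>s. h s \<in> polys n"
      by blast
    obtain w where w: "fam w = h" using fam_surj[of h] h(2) by blast
    have "w \<in> free_mod n ?R i" unfolding free_mod_iff w using h by blast
    then show ?thesis using w h by blast
  qed
  have "aug_map ?R ` free_mod n ?R 0 = I"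
  proof (intro subset_antisym subsetI)
    fix f assume "f \<in> aug_map ?R ` free_mod n ?R 0"
    then obtain v where v: "v \<in> free_mod n ?R 0" "f = aug_map ?R v" by blast
    have "v p * aug ?R p \<in> polys n" if "p \<in> basis ?R 0" for p
      using v aug[OF that] by (intro polys_mult) (auto simp: free_mod_def I_def)
    then have "f \<in> polys n" unfolding v aug_map_def by (rule polys_sum)
    moreover have "\<exists>j<r. U j \<subseteq> keys m" if m: "m \<in> keys f" for m
    proof -
      have "(\<Sum>p\<in>basis ?R 0. lookup (v p * aug ?R p) m) \<noteq> 0"
        using m by (simp add: v aug_map_def in_keys_iff lookup_sum)
      then obtain p where p: "p \<in> basis ?R 0" "m \<in> keys (v p * aug ?R p)"
        by (elim sum.not_neutral_contains_not_neutral) (auto simp: in_keys_iff)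
      then obtain a b where ab: "m = a + b" "b \<in> keys (aug ?R p)" using keys_mult by blast
      then obtain j where "j < r" "U j \<subseteq> keys b" using aug[OF p(1)] by (auto simp: I_def)
      then show ?thesis using ab by (auto simp: keys_add_expo)
    qed
    ultimately show "f \<in> I" by (simp add: I_def)
  next
    fix f assume f: "f \<in> I"
    define g where "g C = (if C = {} then f else 0)" for C :: "nat set"
    have "wbd V L g = 0" by (intro ext) (simp add: wbd_def g_def)
    then have "\<exists>w\<in>free_mod n ?R 0. wbd V L (fam w) = g"
      by (intro lift) (use f in \<open>auto simp: g_def I_def split: if_splits\<close>)
    then obtain w where "w \<in> free_mod n ?R 0" "wbd V L (fam w) = g" by blast
    then show "f \<in> aug_map ?R ` free_mod n ?R 0"
      using aug_map_wbd[of w] by (auto simp: g_def dest: fun_cong[of _ _ "{}"])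
  qed
  moreover have "{v \<in> free_mod n ?R 0. aug_map ?R v = 0} = diff_map ?R 1 ` free_mod n ?R 1"
  proof (intro subset_antisym subsetI)
    fix v assume v: "v \<in> {v \<in> free_mod n ?R 0. aug_map ?R v = 0}"
    then have "wbd V L (fam v) = 0" by (intro ext) (simp add: aug_map_wbd)
    then have "\<exists>w\<in>free_mod n ?R 1. wbd V L (fam w) = fam v"
      by (intro lift) (use v in \<open>auto simp: free_mod_iff\<close>)
    then obtain w where w: "w \<in> free_mod n ?R 1" "wbd V L (fam w) = fam v" by blast
    have "fam (diff_map ?R 1 w) = fam v" using fam_diff_map[of w 0] w by simp
    then have "diff_map ?R 1 w = v" by (rule fam_inject)
    then show "v \<in> diff_map ?R 1 ` free_mod n ?R 1" using w(1) by blast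
  next
    fix v assume "v \<in> diff_map ?R 1 ` free_mod n ?R 1"
    then obtain w where w: "w \<in> free_mod n ?R (Suc 0)" "v = diff_map ?R (Suc 0) w" by auto
    have v: "v \<in> free_mod n ?R 0" using free_mod_diff w by blast
    have "wbd V L (wbd V L (fam w)) = 0"
      by (rule wbd_wbd) (use w(1) in \<open>auto simp: free_mod_iff\<close>)
    then have "wbd V L (fam v) = 0" using fam_diff_map[OF w(1)] w(2) by simp
    then have "aug_map ?R v = 0" using aug_map_wbd[OF v] by (auto dest: fun_cong[of _ _ "{}"])
    then show "v \<in> {v \<in> free_mod n ?R 0. aug_map ?R v = 0}" using v by simp
  qed
  moreover have "{v \<in> free_mod n ?R i. diff_map ?R i v = 0} = diff_map ?R (Suc i) ` free_mod n ?R (Suc i)"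
    if "i \<ge> 1" for i
  proof (intro subset_antisym subsetI)
    fix v assume v: "v \<in> {v \<in> free_mod n ?R i. diff_map ?R i v = 0}"
    obtain k where i: "i = Suc k" using \<open>i \<ge> 1\<close> by (cases i) auto
    have "wbd V L (fam v) = 0" using v fam_diff_map[of v k] by (simp add: i fam_00)
    then have "\<exists>w\<in>free_mod n ?R (Suc i). wbd V L (fam w) = fam v"
      by (intro lift) (use v in \<open>auto simp: free_mod_iff\<close>)
    then obtain w where w: "w \<in> free_mod n ?R (Suc i)" "wbd V L (fam w) = fam v" by blast
    have "fam (diff_map ?R (Suc i) w) = fam v" using fam_diff_map[OF w(1)] w(2) by simp
    then have "diff_map ?R (Suc i) w = v" by (rule fam_inject)
    then show "v \<in> diff_map ?R (Suc i) ` free_mod n ?R (Suc i)" using w(1) by blast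
  next
    fix v assume "v \<in> diff_map ?R (Suc i) ` free_mod n ?R (Suc i)"
    then obtain w where w: "w \<in> free_mod n ?R (Suc i)" "v = diff_map ?R (Suc i) w" by auto
    obtain k where i: "i = Suc k" using \<open>i \<ge> 1\<close> by (cases i) auto
    have v: "v \<in> free_mod n ?R (Suc k)" using free_mod_diff w i by blast
    have "wbd V L (wbd V L (fam w)) = 0"
      by (rule wbd_wbd) (use w(1) in \<open>auto simp: free_mod_iff\<close>)
    then have "fam (diff_map ?R (Suc k) v) = 0"
      using fam_diff_map[OF v] fam_diff_map[OF w(1)] w(2) by simp
    then show "v \<in> {v \<in> free_mod n ?R i. diff_map ?R i v = 0}" using v fam0 i by blast
  qed
  moreover have "homogeneous (shift ?R 0 p) (aug ?R p)" for p
    by (simp add: homogeneous_def res_def)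
  ultimately have "graded_free_resolution n I ?R"
    unfolding graded_free_resolution_def using aug diff by simp
  then show ?thesis by (simp add: I_def)
qed

end

section \<open>Monomial ideals\<close>

lemma t_spread_iff:
  assumes "t \<ge> 1"
  shows "t_spread n t u \<longleftrightarrow> (\<exists>xs. spread n t xs \<and> u = ind (set xs))"
proof -
  have "expo_of_list xs = ind (set xs)" if "spread n t xs" for xs
    using spread_sorted_distinct[OF that assms]
    by (simp add: expo_of_list_def ind_def sum_list_distinct_conv_sum_set)
  moreover have "sorted xs" if "spread n t xs" for xs
    using spread_sorted_distinct[OF that assms] by simp
  ultimately show ?thesis unfolding t_spread_def spread_def by metis
qed

lemma poly_ring_simps [simp]:
  "carrier (poly_ring n) = polys n" "mult (poly_ring n) = (*)" "one (poly_ring n) = 1"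
  "zero (poly_ring n) = 0" "add (poly_ring n) = (+)"
  by (simp_all add: poly_ring_def)

lemma ring_poly_ring: "ring (poly_ring n :: 'k::field mpoly ring)"
proof (rule ringI)
  show "abelian_group (poly_ring n :: 'k mpoly ring)"
    by (rule abelian_groupI)
      (auto simp: polys_add add.assoc add.commute intro!: bexI[of _ "- _"] polys_uminus)
  show "monoid (poly_ring n :: 'k mpoly ring)"
    by (rule monoidI) (auto simp: polys_mult mult.assoc)
qed (auto simp: algebra_simps)

lemma genideal_monom:
  assumes A: "\<And>u. u \<in> A \<Longrightarrow> keys u \<subseteq> {1..n}"
  shows "Idl\<^bsub>poly_ring n\<^esub> (monom ` A) = {f :: 'k::field mpoly. f \<in> polys n \<and> (\<forall>m\<in>keys f. \<exists>u\<in>A. edvd u m)}"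
    (is "_ = ?S")
proof -
  interpret R: ring "poly_ring n :: 'k mpoly ring" by (rule ring_poly_ring)
  have sub: "monom ` A \<subseteq> carrier (poly_ring n :: 'k mpoly ring)"
    using A by (auto simp: monom_def)
  have mult: "x * a \<in> ?S" if "x \<in> polys n" "a \<in> ?S" for x a
  proof -
    have "\<exists>u\<in>A. edvd u m" if m: "m \<in> keys (x * a)" for m
    proof -
      obtain p q where "m = p + q" "q \<in> keys a" using m keys_mult by blast
      moreover from this obtain u where "u \<in> A" "edvd u q" using \<open>a \<in> ?S\<close> by blast
      ultimately show ?thesis using edvd_trans edvd_add by metis
    qed
    then show ?thesis using that polys_mult by blast
  qed
  have "ideal ?S (poly_ring n)"
  proof (rule idealI[OF ring_poly_ring])
    show "subgroup ?S (add_monoid (poly_ring n))"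
    proof (rule group.subgroupI[OF R.a_group])
      show "?S \<noteq> {}" by (auto intro!: exI[of _ 0])
      show "inv\<^bsub>add_monoid (poly_ring n)\<^esub> a \<in> ?S" if a: "a \<in> ?S" for a
      proof -
        have "inv\<^bsub>add_monoid (poly_ring n)\<^esub> a = \<ominus>\<^bsub>poly_ring n\<^esub> a" by (simp add: a_inv_def)
        also have "\<dots> = - a" using a by (intro R.minus_equality) (auto simp: polys_uminus)
        finally show ?thesis using a by (auto simp: polys_uminus in_keys_iff)
      qed
      show "a \<otimes>\<^bsub>add_monoid (poly_ring n)\<^esub> b \<in> ?S" if "a \<in> ?S" "b \<in> ?S" for a b
        using that Poly_Mapping.keys_add[of a b] by (auto simp: polys_add)
    qed auto
    show "x \<otimes>\<^bsub>poly_ring n\<^esub> a \<in> ?S" "a \<otimes>\<^bsub>poly_ring n\<^esub> x \<in> ?S"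
      if "a \<in> ?S" "x \<in> carrier (poly_ring n)" for a x
      using mult[of x a] that by (simp_all only: poly_ring_simps mult.commute[of a x])
  qed
  moreover have "monom ` A \<subseteq> ?S" using A by (auto simp: monom_def edvd_def)
  ultimately have "Idl\<^bsub>poly_ring n\<^esub> (monom ` A) \<subseteq> ?S" by (rule R.genideal_minimal)
  moreover have "?S \<subseteq> Idl\<^bsub>poly_ring n\<^esub> (monom ` A)"
  proof
    let ?Id = "Idl\<^bsub>poly_ring n\<^esub> (monom ` A) :: 'k mpoly set"
    fix f assume f: "f \<in> ?S"
    interpret I: ideal ?Id "poly_ring n :: 'k mpoly ring"
      by (rule R.genideal_ideal[OF sub])
    have mono: "single m c \<in> ?Id" if "m \<in> keys f" for m c
    proof -
      have fm: "keys m \<subseteq> {1..n}" "\<exists>u\<in>A. edvd u m"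
        using f \<open>m \<in> keys f\<close> by (auto simp: polys_def simp del: atLeastAtMost_iff)
      then obtain u where u: "u \<in> A" "edvd u m" by blast
      have "monom u \<in> ?Id" using R.genideal_self[OF sub] u by blast
      moreover have "keys (m - u) \<subseteq> keys m" by (auto simp: in_keys_iff lookup_minus)
      then have "single (m - u) c \<in> polys n"
        using fm(1) by (intro polys_single) (rule subset_trans)
      ultimately have "single (m - u) c * monom u \<in> ?Id"
        using I.I_l_closed by fastforce
      then show ?thesis by (simp add: monom_def mult_single edvd_diff_add u)
    qed
    have "(\<Sum>m\<in>M. single m (lookup f m)) \<in> ?Id"
      if "finite M" "M \<subseteq> keys f" for M
      using that
    proof (induction M rule: finite_induct)
      case empty
      then show ?case using I.zero_closed by simp
    next
      case (insert m M)
      then show ?case using I.a_closed[OF mono] by simp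
    qed
    then have "(\<Sum>m\<in>keys f. single m (lookup f m)) \<in> ?Id" by simp
    also have "(\<Sum>m\<in>keys f. single m (lookup f m)) = f"
      by (rule poly_mapping_eqI) (auto simp: lookup_sum lookup_single when_def in_keys_iff)
    finally show "f \<in> ?Id" .
  qed
  ultimately show ?thesis by blast
qed

lemma (in stable_family) exists_resolution:
  "\<exists>F. graded_free_resolution n {f :: 'k::field mpoly. f \<in> polys n \<and> (\<forall>m\<in>keys f. keys m \<in> J)} F"
proof -
  obtain r :: nat and U where U: "set ` gens = U ` {j. j < r}"
    using finite_imp_nat_seg_image_inj_on[of "set ` gens"] finite_gens by blast
  interpret T: taylor n r U
  proof
    fix j assume "j < r"
    then have "U j \<in> set ` gens" using U by blast
    then show "U j \<subseteq> {1..n}" using J_sub gens_J by blast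
  qed
  have J: "X \<in> J \<longleftrightarrow> (\<exists>j<r. U j \<subseteq> X)" if "X \<subseteq> {1..n}" for X
  proof
    assume "X \<in> J"
    then have "set (lead X) \<in> U ` {j. j < r}" "set (lead X) \<subseteq> X"
      using lead_props U by blast+
    then show "\<exists>j<r. U j \<subseteq> X" by auto
  next
    assume "\<exists>j<r. U j \<subseteq> X"
    then obtain j where j: "j < r" "U j \<subseteq> X" by blast
    then have "U j \<in> set ` gens" using U by blast
    then show "X \<in> J" using J_up gens_J j that by blast
  qed
  have "{f :: 'k mpoly. f \<in> polys n \<and> (\<forall>m\<in>keys f. keys m \<in> J)} =
      {f \<in> polys n. \<forall>m\<in>keys f. \<exists>j<r. U j \<subseteq> keys m}"
    using J unfolding polys_def by (intro Collect_cong) (auto simp del: atLeastAtMost_iff)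
  then show ?thesis using T.graded_free_resolution_res[where ?'k = 'k] by auto
qed

lemma (in stable_family) betti_nonzero_iff:
  assumes "I = {f :: 'k::field mpoly. f \<in> polys n \<and> (\<forall>m\<in>keys f. keys m \<in> J)}"
  shows "betti n I i D \<noteq> 0 \<longleftrightarrow> \<not> koszul_acyclic n J TYPE('k) i D"
proof -
  have "graded_free_resolution n I (SOME F. graded_free_resolution n I F)"
    using someI_ex[OF exists_resolution] assms by simp
  then interpret resolution n t J I "SOME F. graded_free_resolution n I F"
    by unfold_locales (simp_all add: assms)
  show ?thesis unfolding betti_def by (rule homology_dim_nonzero_iff)
qed

lemma strongly_stable_family:
  assumes t: "t \<ge> 1" and I: "t_spread_strongly_stable n t (I :: 'k::field mpoly set)"
  shows "\<exists>J. stable_family n t J \<and> I = {f \<in> polys n. \<forall>m\<in>keys f. keys m \<in> J}"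
proof -
  obtain A where A: "\<And>u. u \<in> A \<Longrightarrow> t_spread n t u" and Idl: "I = Idl\<^bsub>poly_ring n\<^esub> (monom ` A)"
    using I unfolding t_spread_strongly_stable_def t_spread_ideal_def by blast
  have Ax: "\<exists>xs. spread n t xs \<and> u = ind (set xs)" if "u \<in> A" for u
    using A[OF that] t_spread_iff[OF t] by blast
  have A_sub: "keys u \<subseteq> {1..n}" if "u \<in> A" for u using Ax[OF that] by (auto simp: spread_def)
  have A_edvd: "edvd u m \<longleftrightarrow> keys u \<subseteq> keys m" if "u \<in> A" for u m
    using Ax[OF that] edvd_ind_iff by fastforce
  define J where "J = {X. X \<subseteq> {1..n} \<and> (\<exists>u\<in>A. keys u \<subseteq> X)}"
  have I_eq: "I = {f \<in> polys n. \<forall>m\<in>keys f. keys m \<in> J}"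
  proof -
    have "I = {f \<in> polys n. \<forall>m\<in>keys f. \<exists>u\<in>A. edvd u m}"
      unfolding Idl by (rule genideal_monom) (rule A_sub)
    then show ?thesis unfolding J_def polys_def using A_edvd by blast
  qed
  have mono: "monom (ind X) \<in> I \<longleftrightarrow> X \<in> J" if "X \<subseteq> {1..n}" for X
    using that finite_subset[OF that] by (auto simp: I_eq monom_def polys_def)
  have "stable_family n t J"
  proof
    fix X assume X: "X \<in> J"
    then obtain u where u: "u \<in> A" "keys u \<subseteq> X" by (auto simp: J_def)
    then obtain xs where xs: "spread n t xs" "u = ind (set xs)" using Ax by blast
    then have "keys u = set xs" by simp
    then have "set xs \<in> J" "set xs \<subseteq> X" using u A_sub[OF u(1)] unfolding J_def by blast+
    then show "\<exists>xs. spread n t xs \<and> set xs \<in> J \<and> set xs \<subseteq> X" using xs(1) by blast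
  next
    show "Y \<in> J" if "X \<in> J" "X \<subseteq> Y" "Y \<subseteq> {1..n}" for X Y
      using that unfolding J_def by blast
  next
    fix xs l s
    assume xs: "spread n t xs" "set xs \<in> J" and l: "l < length xs" "s < xs ! l"
      and sp: "spread n t (xs[l := s])"
    let ?Y = "set xs - {xs ! l}"
    have dist: "distinct xs" "distinct (xs[l := s])"
      using spread_sorted_distinct xs sp t by blast+
    have set: "set (xs[l := s]) = insert s ?Y" using dist l by (simp add: set_update_distinct)
    \<comment> \<open>Both lists are distinct and equally long, so s is a new index and the updated
      list is the monomial with one variable exchanged, as in the definition of strong
      stability.\<close>
    have "card (insert s ?Y) = length xs" using distinct_card[OF dist(2)] set by simp
    moreover have "card ?Y = length xs - 1" using distinct_card[OF dist(1)] l by simp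
    ultimately have s: "s \<notin> ?Y" using l by (auto simp: insert_absorb)
    have "ind (set xs) = ind (insert (xs ! l) ?Y)" using l by (simp add: insert_absorb)
    also have "\<dots> = single (xs ! l) 1 + ind ?Y" by (rule ind_insert) auto
    finally have v: "single s 1 + (ind (set xs) - single (xs ! l) 1) = ind (set (xs[l := s]))"
      unfolding set using ind_insert[OF _ s] by simp
    have s1: "s \<in> {1..<xs ! l}"
      using spread_nth_range(1)[OF sp, of l] l by simp
    have "t_spread n t (ind (set xs))" "t_spread n t (ind (set (xs[l := s])))"
      using t_spread_iff[OF t] xs(1) sp by blast+
    moreover have "xs ! l \<in> keys (ind (set xs))" using l by simp
    moreover have "monom (ind (set xs)) \<in> I" using mono xs by (simp add: J_def)
    ultimately have "monom (ind (set (xs[l := s]))) \<in> I"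
      using I s1 v unfolding t_spread_strongly_stable_def Let_def by metis
    then show "set (xs[l := s]) \<in> J" using mono sp by (simp add: spread_def)
  qed (use t in \<open>auto simp: J_def\<close>)
  then show ?thesis using I_eq by blast
qed

section \<open>Corners\<close>

context stable_family
begin

lemma gens_length_card: "xs \<in> gens \<Longrightarrow> card (set xs) = length xs"
  using spread_sorted_distinct gens_spread t_pos distinct_card by blast

lemma koszul_not_acyclic_gens:
  assumes "\<not> koszul_acyclic n J TYPE('k::field) i (i + j)"
  shows "\<exists>xs\<in>gens. length xs = j \<and> (\<exists>T\<subseteq>gap t xs. card T = i)"
proof (rule ccontr)
  assume no: "\<not> ?thesis"
  have "koszul_acyclic n J TYPE('k) i (i + j)"
    unfolding koszul_acyclic_def
  proof (intro allI impI)
    fix f :: "nat set \<Rightarrow> 'k mpoly"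
    assume "kchain n 0 (i + j) i f" "supp_in J f" "kos n f = 0"
    then show "\<exists>h. kchain n 0 (i + j) (Suc i) h \<and> supp_in J h \<and> kos n h = f"
      by (rule koszul_exact) (use no in auto)
  qed
  then show False using assms by blast
qed

text \<open>The minimum is attained because the ideal is nonzero. A monomial of that degree contains
  the support of a generator, whose length is thus at most the degree of the monomial.\<close>

lemma gens_initial_degree:
  assumes I: "I = {f :: 'k::field mpoly. f \<in> polys n \<and> (\<forall>m\<in>keys f. keys m \<in> J)}"
    and "I \<noteq> {0}" and init: "initial_degree I = j"
  shows "\<And>xs. xs \<in> gens \<Longrightarrow> j \<le> length xs" and "\<exists>xs\<in>gens. length xs = j"
proof -
  define Q where "Q j \<longleftrightarrow> (\<exists>f\<in>I. f \<noteq> 0 \<and> homogeneous j f)" for j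
  have Least: "(LEAST j. Q j) = j" using init by (simp add: initial_degree_def Q_def)
  have Q: "Q (length xs)" if xs: "xs \<in> gens" for xs
    unfolding Q_def
  proof (intro bexI conjI)
    have "set xs \<subseteq> {1..n}" using xs gens_J J_sub by blast
    then show "(monom (ind (set xs)) :: 'k mpoly) \<in> I"
      using gens_J[OF xs] by (simp add: I monom_def)
    show "(monom (ind (set xs)) :: 'k mpoly) \<noteq> 0"
      by (auto simp: monom_def poly_mapping_eq_iff lookup_single fun_eq_iff when_def)
    show "homogeneous (length xs) (monom (ind (set xs)) :: 'k mpoly)"
      by (simp add: homogeneous_def monom_def gens_length_card[OF xs])
  qed
  show le: "j \<le> length xs" if "xs \<in> gens" for xs
    using Least_le[of Q, OF Q[OF that]] Least by simp
  have ex: "\<exists>m. m \<in> keys f" if "f \<noteq> 0" for f :: "'k mpoly"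
    using that by (metis in_keys_iff lookup_zero poly_mapping_eqI)
  have "0 \<in> I" by (simp add: I)
  then obtain f where "f \<in> I" "f \<noteq> 0" using \<open>I \<noteq> {0}\<close> by blast
  then obtain m where "m \<in> keys f" using ex by blast
  then have "keys m \<in> J" using \<open>f \<in> I\<close> by (auto simp: I)
  then have "Q (length (lead (keys m)))" using Q lead_props by blast
  then have "Q j" using LeastI[of Q] Least by metis
  then obtain f where f: "f \<in> I" "f \<noteq> 0" "homogeneous j f" by (auto simp: Q_def)
  then obtain m where m: "m \<in> keys f" using ex by blast
  then have mJ: "keys m \<in> J" and deg: "total_deg m = j" using f by (auto simp: I homogeneous_def)
  define xs where "xs = lead (keys m)"
  have xs: "xs \<in> gens" "set xs \<subseteq> keys m" using lead_props mJ by (auto simp: xs_def)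
  have "length xs \<le> card (keys m)"
    using card_mono[OF _ xs(2)] gens_length_card[OF xs(1)] by simp
  also have "\<dots> = (\<Sum>i\<in>keys m. 1)" by simp
  also have "\<dots> \<le> total_deg m"
    unfolding total_deg_def by (intro sum_mono) (simp add: in_keys_iff Suc_le_eq)
  finally show "\<exists>xs\<in>gens. length xs = j" using xs le[OF xs(1)] deg by auto
qed

lemma pair_mem_J:
  assumes "[a, b] \<in> gens" "1 \<le> x" "x + t \<le> c" "x \<le> a" "c \<le> b"
  shows "{x, c} \<in> J"
proof -
  have "b \<le> n" using gens_spread[OF assms(1)] by (simp add: spread_def)
  have "set [x, c] \<in> J"
  proof (rule borel)
    show "spread n t [a, b]" "set [a, b] \<in> J" using assms gens_spread gens_J by blast+
    show "spread n t [x, c]" using assms \<open>b \<le> n\<close> t_pos by (auto simp: spread_def less_Suc_eq)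
    show "[x, c] ! l \<le> [a, b] ! l" if "l < length [a, b]" for l
      using that assms by (auto simp: less_Suc_eq)
  qed simp
  then show ?thesis by simp
qed

lemma gens_no_pair:
  assumes "xs \<in> gens" "length xs \<ge> 3" "x \<in> set xs" "y \<in> set xs"
  shows "{x, y} \<notin> J"
proof
  assume "{x, y} \<in> J"
  then have "{x, y} = set xs" using gens_minimal assms by blast
  moreover have "card {x, y} \<le> 2" by (simp add: card_insert_if)
  ultimately show False using gens_length_card[OF assms(1)] assms(2) by simp
qed

lemma spread_nth_bounds:
  assumes "spread n t xs" "l < length xs"
  shows "1 + l * t \<le> xs ! 0 + l * t" "xs ! 0 + l * t \<le> xs ! l"
    and "xs ! l + (length xs - 1 - l) * t \<le> n"
proof -
  show "xs ! 0 + l * t \<le> xs ! l" using spread_nth_add[OF assms, of 0] by simp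
  show "1 + l * t \<le> xs ! 0 + l * t" using spread_nth_range(1)[OF assms(1), of 0] assms(2) by (cases xs) auto
  have "xs ! l + (length xs - 1 - l) * t \<le> xs ! (length xs - 1)"
    using spread_nth_add[OF assms(1), of "length xs - 1" l] assms(2) by simp
  moreover have "length xs - 1 < length xs" using assms(2) by simp
  ultimately show "xs ! l + (length xs - 1 - l) * t \<le> n"
    using spread_nth_range(2)[OF assms(1)] le_trans by blast
qed

text \<open>The gaps of [a, b] number (a - 1) + (b - a - t) = b - t - 1, whatever a is.\<close>

lemma card_gap_pair:
  assumes "spread n t [a, b]" "T \<subseteq> gap t [a, b]"
  shows "card T + t + 1 \<le> b"
proof -
  have ab: "1 \<le> a" "a + t \<le> b" using assms(1) by (auto simp: spread_def)
  have "T \<subseteq> {1..<a} \<union> {a + t..<b}"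
    using assms(2) by (force simp: gap_def less_Suc_eq)
  then have "card T \<le> card ({1..<a} \<union> {a + t..<b})" by (intro card_mono) auto
  also have "\<dots> \<le> card {1..<a} + card {a + t..<b}" by (rule card_Un_le)
  finally show ?thesis using ab by simp
qed

end

theorem theorem4p1:
  fixes n t k d :: nat
    and I :: "'k::field mpoly set"
  assumes "n \<ge> 2" and "t \<ge> 2" and "k \<ge> 3"
    and "1 \<le> d" and "d \<le> t" and "n = d + k * t"
    and "I \<in> spread_stable_one t n"
    and "I \<noteq> {0}" and "initial_degree I = 2"
    and "\<exists>k1. corner n I (k1, 2)"
  shows "finite {c. corner n I c} \<and>
    int (card {c. corner n I c}) \<le> int k + \<lfloor>(real d - 3) / real t\<rfloor> \<and>
    int k + \<lfloor>(real d - 3) / real t\<rfloor> = (if d = 1 \<or> d = 2 then int k - 1 else int k)"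
proof -
  have "t_spread_strongly_stable n t I" using assms(7) by (simp add: spread_stable_one_def)
  then obtain J where J: "stable_family n t J" "I = {f \<in> polys n. \<forall>m\<in>keys f. keys m \<in> J}"
    using strongly_stable_family[of t n I] assms(2) by auto
  interpret stable_family n t J by (rule J(1))
  note betti = betti_nonzero_iff[OF J(2)]
  note len_ge2 = gens_initial_degree(1)[OF J(2) assms(8,9)]
  obtain zs0 where zs0: "zs0 \<in> gens" "length zs0 = 2"
    using gens_initial_degree(2)[OF J(2) assms(8,9)] by blast
  then obtain a0 b0 where ab0: "[a0, b0] \<in> gens"
    by (auto simp: length_Suc_conv numeral_2_eq_2)
  define C where "C = {c. corner n I c}"
  have gens_of: "\<exists>xs\<in>gens. length xs = l \<and> (\<exists>T\<subseteq>gap t xs. card T = i)" if "corner n I (i, l)" for i l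
    using that betti[of i "i + l"] koszul_not_acyclic_gens[where ?'k = 'k] by (simp add: corner_def)
  \<comment> \<open>The extremality of (i, l) excludes nonzero Betti numbers in homological degree
    at least i and degree at least l.\<close>
  have decreasing: "i' < i" if "corner n I (i, l)" "corner n I (i', l')" "l \<le> l'" "(i', l') \<noteq> (i, l)" for i l i' l'
  proof (rule ccontr)
    assume "\<not> i' < i"
    then have "i \<le> i'" by simp
    then have "betti n I i' (i' + l') = 0"
      using that(1,3,4) unfolding corner_def prod.case by blast
    then show False using that(2) by (simp add: corner_def)
  qed
  have inj: "inj_on snd C"
  proof (rule inj_onI)
    fix c c' assume c: "c \<in> C" "c' \<in> C" "snd c = snd c'"
    obtain i i' l where "c = (i, l)" "c' = (i', l)" using c(3) by (metis prod.collapse)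
    then show "c = c'"
      using c decreasing[of i l i' l] decreasing[of i' l i l] by (cases "i = i'") (auto simp: C_def)
  qed
  have range: "2 \<le> l \<and> l \<le> k + 1" if "corner n I (i, l)" for i l
  proof -
    obtain xs where xs: "xs \<in> gens" "length xs = l" using gens_of \<open>corner n I (i, l)\<close> by blast
    have "2 \<le> l" using len_ge2 xs by blast
    then have "1 + (l - 1) * t \<le> n"
      using spread_nth_bounds(1,2)[OF gens_spread[OF xs(1)], of "l - 1"]
        spread_nth_range(2)[OF gens_spread[OF xs(1)], of "l - 1"] xs by simp
    \<comment> \<open>Here d <= t enters: a spread list of length k + 2 needs at least 1 + (k + 1) t
      variables.\<close>
    also have "n < 1 + (k + 1) * t" using assms by simp
    finally have "(l - 1) * t < (k + 1) * t" by simp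
    then have "l - 1 < k + 1" by (simp only: mult_less_cancel2)
    then show ?thesis using \<open>2 \<le> l\<close> by simp
  qed
  have sub: "snd ` C \<subseteq> {2..k + 1}" using range by (auto simp: C_def)
  have fin: "finite C" using finite_imageD[OF finite_subset[OF sub] inj] by simp
  have card: "card C = card (snd ` C)" using card_image[OF inj] by simp
  \<comment> \<open>The k - l entries that follow position l use up at least (k - l) t indices,
    which leaves d + l t.\<close>
  have pos: "xs ! l \<le> d + l * t" if "xs \<in> gens" "length xs = k + 1" "l \<le> k" for xs l
  proof -
    have "(k - l) * t + l * t = k * t" using that by (simp add: add_mult_distrib[symmetric])
    then show ?thesis
      using spread_nth_bounds(3)[OF gens_spread[OF that(1)], of l] that assms(6) by simp
  qed
  have start: "xs ! 0 = 1 \<Longrightarrow> {1, xs ! 1} \<notin> J" if "xs \<in> gens" "length xs \<ge> 3" for xs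
    using gens_no_pair[OF that, of "xs ! 0" "xs ! 1"] nth_mem[of 0 xs] nth_mem[of 1 xs] that by force
  have small: "card C \<le> k - 1" if "d = 1 \<or> d = 2"
  proof (cases "k + 1 \<in> snd ` C")
    case False
    then have "snd ` C \<subseteq> {2..k}" using sub by (force simp: le_Suc_eq)
    then show ?thesis using card card_mono[of "{2..k}" "snd ` C"] by simp
  next
    case True
    then obtain i where i: "corner n I (i, k + 1)" by (auto simp: C_def)
    obtain us where us: "us \<in> gens" "length us = k + 1" using gens_of[OF i] by blast
    have us_lower: "us ! 0 + l * t \<le> us ! l" if "l \<le> k" for l
      using spread_nth_bounds(2)[OF gens_spread[OF us(1)], of l] us that by simp
    have us0: "1 \<le> us ! 0" using spread_nth_range(1)[OF gens_spread[OF us(1)], of 0] us by simp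
    have us1: "us ! 0 + t \<le> us ! 1" "us ! 0 \<le> d" "us ! 1 \<le> d + t"
      using us_lower[of 1] pos[OF us, of 0] pos[OF us, of 1] assms(3) by simp_all
    obtain k1 where k1: "corner n I (k1, 2)" using assms(10) by blast
    have "i < k1" using decreasing[OF k1 i] assms(3) by simp
    obtain zs T where zs: "zs \<in> gens" "length zs = 2" "T \<subseteq> gap t zs" "card T = k1"
      using gens_of[OF k1] by blast
    then obtain a b where ab: "zs = [a, b]" by (auto simp: length_Suc_conv numeral_2_eq_2)
    have b: "k1 + t + 1 \<le> b" using card_gap_pair[of a b T] zs gens_spread ab by auto
    have "1 \<le> a" using spread_nth_range(1)[OF gens_spread[OF zs(1)], of 0] ab by simp
    then have pair: "{1, c} \<in> J" if "1 + t \<le> c" "c \<le> b" for c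
      using pair_mem_J[of a b 1 c] zs(1) ab that by simp
    \<comment> \<open>Since k1 > i, b is at least 2 + t, while us ! 1 is at most d + t <= 2 + t. A
      list starting with 1 would thus contain a pair in J.\<close>
    have "us ! 0 \<noteq> 1"
      using start[OF us(1)] pair[of "us ! 1"] us us1 b \<open>i < k1\<close> assms(3) that by force
    then have "d = 2" "us ! 0 = 2" using us0 us1(2) that by auto
    have us_eq: "us ! l = 2 + l * t" if "l \<le> k" for l
      using us_lower[OF that] pos[OF us that] \<open>d = 2\<close> \<open>us ! 0 = 2\<close> by simp
    have "k \<notin> snd ` C"
    proof
      assume "k \<in> snd ` C"
      then obtain i' where "corner n I (i', k)" by (auto simp: C_def)
      then obtain vs where vs: "vs \<in> gens" "length vs = k" using gens_of by blast
      note sv = gens_spread[OF vs(1)]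
      have v0: "vs ! 0 = 1"
      proof (rule ccontr)
        assume "vs ! 0 \<noteq> 1"
        then have "2 \<le> vs ! 0" using spread_nth_range(1)[OF sv, of 0] vs assms(3) by simp
        \<comment> \<open>With first entry at least 2, vs dominates the first k entries of us
          entrywise, so us would have a proper prefix in J.\<close>
        have "set (take k us) \<in> J"
        proof (rule borel[OF sv gens_J[OF vs(1)] spread_take[OF gens_spread[OF us(1)]]])
          show "take k us ! l \<le> vs ! l" if "l < length vs" for l
            using that us_eq[of l] spread_nth_bounds(2)[OF sv that] \<open>2 \<le> vs ! 0\<close> vs by simp
        qed (use us vs in simp)
        then have "set (take k us) = set us"
          using gens_minimal[OF us(1)] set_take_subset by fastforce
        then have "card (set us) \<le> k" using card_length[of "take k us"] us by simp
        then show False using gens_length_card[OF us(1)] us by simp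
      qed
      have v1: "1 + t \<le> vs ! 1" using spread_nth_bounds(2)[OF sv, of 1] v0 vs assms(3) by simp
      have "b < vs ! 1"
        using start[OF vs(1)] pair[of "vs ! 1"] v0 v1 vs assms(3) by force
      \<comment> \<open>All indices below vs ! 1 that can follow the first entry 1 in its place. As
        vs ! 1 > b >= k1 + t + 1, there are more than k1 of them.\<close>
      define \<sigma> where "\<sigma> = {1 + t..<vs ! 1}"
      have "vs ! 1 \<le> n" using spread_nth_range(2)[OF sv, of 1] vs assms(3) by simp
      have mem: "x = 1 \<or> vs ! 1 \<le> x" if "x \<in> set vs" for x
      proof -
        obtain l where l: "l < length vs" "x = vs ! l" using \<open>x \<in> set vs\<close> by (metis in_set_conv_nth)
        show ?thesis
        proof (cases "l = 0")
          case False
          then show ?thesis using spread_nth_add[OF sv, of l 1] l by simp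
        qed (use l v0 in simp)
      qed
      have "\<exists>f :: nat set \<Rightarrow> 'k mpoly. kchain n 0 (length vs + card \<sigma>) (card \<sigma>) f \<and> supp_in J f \<and>
        kos n f = 0 \<and> \<not> (\<exists>h. supp_in J h \<and> kos n h = f)"
      proof (rule koszul_nonexact[OF vs(1), of 1])
        show "\<sigma> \<subseteq> {1..n}" using \<open>vs ! 1 \<le> n\<close> by (auto simp: \<sigma>_def)
        show "\<sigma> \<inter> set vs = {}" using mem assms(2) by (fastforce simp: \<sigma>_def)
        show "insert s (set vs - {vs ! 1}) \<in> J" if "s \<in> \<sigma>" for s
        proof -
          have "spread n t (vs[1 := s])"
            by (rule spread_update) (use sv vs assms(3) that v0 in \<open>auto simp: \<sigma>_def\<close>)
          then have "set (vs[1 := s]) \<in> J"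
            using J_stable[OF sv gens_J[OF vs(1)], of 1 s] that vs assms(3) by (simp add: \<sigma>_def)
          moreover have "distinct vs" using spread_sorted_distinct[OF sv t_pos] by simp
          ultimately show ?thesis using vs assms(3) by (simp add: set_update_distinct)
        qed
      qed (use vs assms(3) in simp)
      then have "\<not> koszul_acyclic n J TYPE('k) (card \<sigma>) (card \<sigma> + k)"
        unfolding koszul_acyclic_def using vs by (metis add.commute)
      then have "betti n I (card \<sigma>) (card \<sigma> + k) \<noteq> 0" using betti by blast
      moreover have "k1 \<le> card \<sigma>" using b \<open>b < vs ! 1\<close> by (simp add: \<sigma>_def)
      \<comment> \<open>Since k >= 3, this nonzero Betti number sits in a degree above 2, so the
        extremality of (k1, 2) applies.\<close>
      ultimately show False using k1 assms(3) by (auto simp: corner_def)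
    qed
    then have "snd ` C \<subseteq> {2..k + 1} - {k}" using sub by blast
    then have "card (snd ` C) \<le> card ({2..k + 1} - {k})" by (intro card_mono) auto
    also have "\<dots> = k - 1" using assms(3) by simp
    finally show ?thesis using card by simp
  qed
  have big: "card C \<le> k" using card card_mono[OF _ sub] by simp
  \<comment> \<open>For d = 1 it is t >= 2 that keeps (d - 3) / t from dropping below -1.\<close>
  have floor: "\<lfloor>(real d - 3) / real t\<rfloor> = (if d = 1 \<or> d = 2 then - 1 else 0)"
  proof (cases "d = 1 \<or> d = 2")
    case True
    then have "- 1 \<le> (real d - 3) / real t" "(real d - 3) / real t < 0"
      using assms(2) by (auto simp: field_simps)
    then show ?thesis using True by (simp add: floor_eq_iff)
  next
    case False
    then have "0 \<le> (real d - 3) / real t" "(real d - 3) / real t < 1"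
      using assms(2,4,5) by (auto simp: field_simps)
    then show ?thesis using False by (simp add: floor_eq_iff)
  qed
  show ?thesis
    unfolding C_def[symmetric] floor using fin small big assms(3) by auto
qed

end
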